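(* Let $W$ be the minimal model of an $L_{\infty}[1]$-algebra $V$ over a field $\mathbb{K}$ of characteristic $0$. Then there exists a morphism of spectral sequences $$E(V,V)^{p,q}_r\to E(W,W)^{p,q}_r$$ between their Chevalley-Eilenberg spectral sequences, which is an isomorphism for every $r\ge 1$ and preserves the Euler derivations.
   Context: All vector spaces are over a fixed field $\mathbb{K}$ of characteristic $0$; the degree of $v$ is $\bar v$. For a $\mathbb{Z}$-graded vector space $V$, $S^c(V)=\bigoplus_{n\ge0}V^{\odot n}$ is the symmetric coalgebra, with coproduct $\Delta(v_1\odot\cdots\odot v_n)=\sum_{k=0}^n\sum_{\sigma\in S(k,n-k)}\epsilon(\sigma)(v_{\sigma(1)}\odot\cdots\odot v_{\sigma(k)})\otimes(v_{\sigma(k+1)}\odot\cdots\odot v_{\sigma(n)})$, where $S(k,n-k)$ are the $(k,n-k)$-shuffles and $\epsilon(\sigma)$ is the Koszul sign. For a linear map $f\colon S^c(V)\to S^c(W)$, $f^i_j\colon V^{\odot j}\to W^{\odot i}$ denotes its components. Morphisms of symmetric coalgebras are morphisms of graded coalgebras with $f(1)=1$. An $L_\infty[1]$-algebra is a graded vector space $V$ with a degree $+1$ coderivation $Q$ of $S^c(V)$ with $Q(1)=0$, $QQ=0$; writing $q_n=Q^1_n$ it is also denoted $(V,q_1,q_2,\ldots)$. An $L_\infty$-morphism $f\colon(V,Q)\dashrightarrow(W,R)$ is a morphism of symmetric coalgebras $f\colon S^c(V)\to S^c(W)$ with $fQ=Rf$. The tangent cohomology $H^*(V)$ is the cohomology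 of $(V,q_1)$. $f$ is a weak equivalence if $f^1_1\colon H^*(V)\to H^*(W)$ is an isomorphism. $V$ is minimal if $q_1=0$. The minimal model of $V$ is the (unique up to isomorphism) minimal $L_\infty[1]$-algebra $W$ for which there exist weak equivalences $f\colon V\dashrightarrow W$, $g\colon W\dashrightarrow V$ with $fg=\mathrm{Id}_W$; it always exists. The Chevalley-Eilenberg complex $CE(V,V)$ is the graded space $\operatorname{Coder}^*(S^c(V),S^c(V))$ of coderivations of $S^c(V)$, with differential $d\alpha=Q\alpha-(-1)^{\bar\alpha}\alpha Q$ and decreasing filtration $F^p=\{\alpha\mid\alpha(V^{\odot i})=0\ \forall i<p\}$. $E(V,V)^{p,q}_r$ (total degree $p+q$, $d_r\colon E^{p,q}_r\to E^{p+r,q-r+1}_r$) is the associated cohomology spectral sequence: $Z^{p,q}_r=\{x\in F^p \text{ of degree } p+q\mid dx\in F^{p+r}\}$, $E^{p,q}_r=Z^{p,q}_r/(Z^{p+1,q-1}_{r-1}+dZ^{p-r+1,q+r-2}_{r-1})$, $r\ge 0$. One has $E(V,V)^{p,q}_1=\operatorname{Hom}^{p+q}_{\mathbb{K}}(H^*(V)^{\odot p},H^*(V))$. The Euler derivation of $V$ is the element $e\in E(V,V)^{1,-1}_1=\operatorname{Hom}^0_{\mathbb{K}}(H^*(V),H^*(V))$, $e(v)=(\bar v+1)v$. Preserving Euler derivations means that the map on $E_1^{1,-1}$ sends the Euler derivation of $V$ to that of $W$. *)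

theory Defs
  imports
    Complex_Main
    "HOL-Library.Poly_Mapping"
    "HOL-Library.Function_Algebras"
    "HOL-Combinatorics.Permutations"
begin

section \<open>Linear algebra: free spaces and quotients\<close>

definition fscl :: "'k::field \<Rightarrow> ('a \<Rightarrow>\<^sub>0 'k) \<Rightarrow> ('a \<Rightarrow>\<^sub>0 'k)" where
  "fscl c x = Poly_Mapping.map ((*) c) x"

lemma lookup_fscl [simp]: "Poly_Mapping.lookup (fscl c x) a = c * Poly_Mapping.lookup x a"
  by (cases "Poly_Mapping.lookup x a = 0") (simp_all add: fscl_def Poly_Mapping.map.rep_eq when_def)

lemma vector_space_fscl: "vector_space (fscl :: 'k::field \<Rightarrow> ('a \<Rightarrow>\<^sub>0 'k) \<Rightarrow> _)"
  by unfold_locales (auto intro!: poly_mapping_eqI simp: lookup_add algebra_simps)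

definition linext :: "('k \<Rightarrow> 'b \<Rightarrow> 'b) \<Rightarrow> ('a \<Rightarrow> 'b) \<Rightarrow> ('a \<Rightarrow>\<^sub>0 'k::field) \<Rightarrow> 'b::ab_group_add" where
  "linext s g x = (\<Sum>a\<in>Poly_Mapping.keys x. s (Poly_Mapping.lookup x a) (g a))"

definition pscl :: "('k \<Rightarrow> 'b \<Rightarrow> 'b) \<Rightarrow> 'k \<Rightarrow> ('a \<Rightarrow> 'b) \<Rightarrow> ('a \<Rightarrow> 'b)" where
  "pscl s c f = (\<lambda>x. s c (f x))"

lemma vector_space_pscl:
  assumes "vector_space s"
  shows "vector_space (pscl s)"
proof -
  interpret vector_space s by fact
  show ?thesis
    by unfold_locales (auto simp: pscl_def fun_eq_iff scale_left_distrib scale_right_distrib)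
qed

text \<open>
  The quotient by a subspace \<open>N\<close> is modelled inside the ambient space: \<open>quot_map s N\<close> is a chosen
  linear projection with kernel \<open>N\<close>. It is the class map, and for a subspace \<open>A\<close> containing \<open>N\<close>
  the quotient \<open>A / N\<close> is the image of \<open>A\<close>, a vector space. Since the projection is idempotent,
  every class is one of its own representatives. So a map \<open>f\<close> that carries \<open>N\<close> into \<open>N'\<close> induces
  on quotients the map sending a class \<open>h\<close> to \<open>quot_map s' N' (f h)\<close>.
  A linear map out of \<open>A / N\<close> can also be given as a linear map out of \<open>A\<close> that vanishes on \<open>N\<close>.
\<close>

definition quot_map :: "('k::field \<Rightarrow> 'a::ab_group_add \<Rightarrow> 'a) \<Rightarrow> 'a set \<Rightarrow> 'a \<Rightarrow> 'a" where
  "quot_map s N = (SOME p. Vector_Spaces.linear s s p \<and> (\<forall>x. p (p x) = p x) \<and> {x. p x = 0} = N)"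

lemma quot_map_props:
  assumes "vector_space s" and "module.subspace s N"
  shows "Vector_Spaces.linear s s (quot_map s N) \<and>
         (\<forall>x. quot_map s N (quot_map s N x) = quot_map s N x) \<and>
         {x. quot_map s N x = 0} = N"
proof -
  interpret vector_space s by fact
  interpret vp: vector_space_pair s s by unfold_locales
  have "Vector_Spaces.linear s s id" by (rule linear_id)
  from vp.linear_exists_left_inverse_on[OF this assms(2)]
  obtain g where g: "g ` UNIV \<subseteq> N" "Vector_Spaces.linear s s g" "\<forall>v\<in>N. g v = v"
    by auto
  interpret g: Vector_Spaces.linear s s g by fact
  have "Vector_Spaces.linear s s (\<lambda>x. x - g x)"
    by (rule vp.linear_compose_sub[OF linear_ident g(2)])
  moreover have "\<forall>x. (x - g x) - g (x - g x) = x - g x"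
    using g(1,3) by (simp add: g.diff image_subset_iff)
  moreover have "x - g x = 0 \<longleftrightarrow> x \<in> N" for x
    using g(1,3) by (metis eq_iff_diff_eq_0 rangeI subsetD)
  then have "{x. x - g x = 0} = N"
    by blast
  ultimately have "\<exists>p. Vector_Spaces.linear s s p \<and> (\<forall>x. p (p x) = p x) \<and> {x. p x = 0} = N"
    by (intro exI[of _ "\<lambda>x. x - g x"] conjI)
  then show ?thesis
    unfolding quot_map_def by (rule someI_ex)
qed

definition linear_between ::
  "('k \<Rightarrow> 'a \<Rightarrow> 'a) \<Rightarrow> 'a set \<Rightarrow> ('k \<Rightarrow> 'b \<Rightarrow> 'b) \<Rightarrow> 'b set \<Rightarrow> ('a::ab_group_add \<Rightarrow> 'b::ab_group_add) \<Rightarrow> bool"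
where
  "linear_between s A t B f \<longleftrightarrow> f ` A \<subseteq> B \<and>
     (\<forall>x\<in>A. \<forall>y\<in>A. f (x + y) = f x + f y) \<and> (\<forall>c. \<forall>x\<in>A. f (s c x) = t c (f x))"


section \<open>Graded spaces and the symmetric coalgebra\<close>

text \<open>
  A graded vector space is a family of subspaces of one type. The subspaces need not be
  independent in that type: elements of different degree are told apart by their degree label.
\<close>

record ('k, 'v) graded_space =
  scl :: "'k \<Rightarrow> 'v \<Rightarrow> 'v"
  part :: "int \<Rightarrow> 'v set"

definition graded_vector_space :: "('k::field, 'v::ab_group_add) graded_space \<Rightarrow> bool" where
  "graded_vector_space V \<longleftrightarrow> vector_space (scl V) \<and> (\<forall>n. module.subspace (scl V) (part V n))"

text \<open>A word is a list of vectors, each labelled with its degree.\<close>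

type_synonym 'v word = "(int \<times> 'v) list"
type_synonym ('k, 'v) free = "'v word \<Rightarrow>\<^sub>0 'k"

definition wdeg :: "'v word \<Rightarrow> int" where
  "wdeg w = sum_list (map fst w)"

definition valid_word :: "('k, 'v) graded_space \<Rightarrow> 'v word \<Rightarrow> bool" where
  "valid_word V w \<longleftrightarrow> (\<forall>(n, v)\<in>set w. v \<in> part V n)"

text \<open>
  The symmetric coalgebra is the free space on all words, modulo the invalid words,
  multilinearity, and graded commutativity.
\<close>

definition sym_relators :: "('k::field, 'v::ab_group_add) graded_space \<Rightarrow> ('k, 'v) free set" where
  "sym_relators V =
     {Poly_Mapping.single w 1 | w. \<not> valid_word V w} \<union>
     {Poly_Mapping.single (u @ (n, scl V a x + scl V b y) # t) 1
        - fscl a (Poly_Mapping.single (u @ (n, x) # t) 1)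
        - fscl b (Poly_Mapping.single (u @ (n, y) # t) 1)
      | u n a x b y t. x \<in> part V n \<and> y \<in> part V n} \<union>
     {Poly_Mapping.single (u @ (m, x) # (n, y) # t) 1
        - fscl ((-1) powi (m * n)) (Poly_Mapping.single (u @ (n, y) # (m, x) # t) 1)
      | u m x n y t. x \<in> part V m \<and> y \<in> part V n}"

definition sym_proj ::
  "('k::field, 'v::ab_group_add) graded_space \<Rightarrow> ('k, 'v) free \<Rightarrow> ('k, 'v) free" where
  "sym_proj V = quot_map fscl (module.span fscl (sym_relators V))"

definition sym_coalg :: "('k::field, 'v::ab_group_add) graded_space \<Rightarrow> ('k, 'v) free set" where
  "sym_coalg V = range (sym_proj V)"

text \<open>The monomial \<open>v\<^sub>1 \<odot> \<dots> \<odot> v\<^sub>n\<close>; the empty word gives the unit \<open>1\<close>.\<close>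

definition smono :: "('k::field, 'v::ab_group_add) graded_space \<Rightarrow> 'v word \<Rightarrow> ('k, 'v) free" where
  "smono V w = sym_proj V (Poly_Mapping.single w 1)"

definition sym_degree :: "('k::field, 'v::ab_group_add) graded_space \<Rightarrow> int \<Rightarrow> ('k, 'v) free set" where
  "sym_degree V d = module.span fscl {smono V w | w. valid_word V w \<and> wdeg w = d}"

definition sym_power :: "('k::field, 'v::ab_group_add) graded_space \<Rightarrow> nat \<Rightarrow> ('k, 'v) free set" where
  "sym_power V n = module.span fscl {smono V w | w. valid_word V w \<and> length w = n}"

text \<open>
  The projection of \<open>S\<^sup>c(V)\<close> to \<open>V\<^sup>\<odot>\<^sup>1 = V\<close>, followed by the projection to the component of degree \<open>m\<close>.
\<close>

definition corestr :: "('k::field, 'v::ab_group_add) graded_space \<Rightarrow> int \<Rightarrow> ('k, 'v) free \<Rightarrow> 'v" where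
  "corestr V m =
     linext (scl V) (\<lambda>w. case w of [(n, v)] \<Rightarrow> (if n = m \<and> v \<in> part V m then v else 0) | _ \<Rightarrow> 0)"

text \<open>
  Over a field, the tensor square of a subspace \<open>S\<close> of the free space is the span of the \<open>x \<otimes> y\<close>,
  \<open>x, y \<in> S\<close>, inside the tensor square of the free space, which is free on pairs of words.
\<close>

definition tensor ::
  "('a \<Rightarrow>\<^sub>0 'k::field) \<Rightarrow> ('b \<Rightarrow>\<^sub>0 'k) \<Rightarrow> ('a \<times> 'b \<Rightarrow>\<^sub>0 'k)" where
  "tensor x y = (\<Sum>a\<in>Poly_Mapping.keys x. \<Sum>b\<in>Poly_Mapping.keys y.
                   Poly_Mapping.single (a, b) (Poly_Mapping.lookup x a * Poly_Mapping.lookup y b))"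

definition shuffle_perms :: "nat \<Rightarrow> nat \<Rightarrow> (nat \<Rightarrow> nat) set" where
  "shuffle_perms k n = {\<sigma>. \<sigma> permutes {..<n} \<and> strict_mono_on {..<k} \<sigma> \<and> strict_mono_on {k..<n} \<sigma>}"

text \<open>
  The Koszul sign, \<open>v\<^sub>1 \<odot> \<dots> \<odot> v\<^sub>n = \<epsilon>(\<sigma>) v\<^sub>\<sigma>\<^sub>(\<^sub>1\<^sub>) \<odot> \<dots> \<odot> v\<^sub>\<sigma>\<^sub>(\<^sub>n\<^sub>)\<close>: one factor for each inversion of \<open>\<sigma>\<close>.
\<close>

definition koszul_sign :: "'v word \<Rightarrow> (nat \<Rightarrow> nat) \<Rightarrow> 'k::field" where
  "koszul_sign w \<sigma> =
     (\<Prod>(i, j)\<in>{(i, j). i < j \<and> j < length w \<and> \<sigma> j < \<sigma> i}. (-1) powi (fst (w ! \<sigma> i) * fst (w ! \<sigma> j)))"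

definition coprod ::
  "('k::field, 'v::ab_group_add) graded_space \<Rightarrow> ('k, 'v) free \<Rightarrow> ('v word \<times> 'v word \<Rightarrow>\<^sub>0 'k)" where
  "coprod V = linext fscl (\<lambda>w. \<Sum>k\<le>length w. \<Sum>\<sigma>\<in>shuffle_perms k (length w).
     fscl (koszul_sign w \<sigma>)
       (tensor (smono V (map (\<lambda>i. w ! \<sigma> i) [0..<k])) (smono V (map (\<lambda>i. w ! \<sigma> i) [k..<length w]))))"

text \<open>\<open>f \<otimes> g\<close> for \<open>g\<close> of degree \<open>e\<close>: it sends \<open>x \<otimes> y\<close> to \<open>(-1)\<^bsup>e |x|\<^esup> f x \<otimes> g y\<close>.\<close>

definition tensor_map ::
  "int \<Rightarrow> (('k::field, 'v) free \<Rightarrow> ('k, 'w) free) \<Rightarrow> (('k, 'v) free \<Rightarrow> ('k, 'w) free) \<Rightarrow>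
   ('v word \<times> 'v word \<Rightarrow>\<^sub>0 'k) \<Rightarrow> ('w word \<times> 'w word \<Rightarrow>\<^sub>0 'k)" where
  "tensor_map e f g = linext fscl (\<lambda>(u, w). fscl ((-1) powi (e * wdeg u))
     (tensor (f (Poly_Mapping.single u 1)) (g (Poly_Mapping.single w 1))))"

text \<open>
  Linear maps \<open>S\<^sup>c(V) \<rightarrow> S\<^sup>c(W)\<close> of degree \<open>d\<close>, given as linear maps on the free space that factor
  through the projection; so two of them are equal iff they agree on \<open>S\<^sup>c(V)\<close>, and the identity of
  \<open>S\<^sup>c(V)\<close> is \<open>sym_proj V\<close>.
\<close>

definition sym_hom ::
  "('k::field, 'v::ab_group_add) graded_space \<Rightarrow> ('k, 'w::ab_group_add) graded_space \<Rightarrow> int \<Rightarrow>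
   (('k, 'v) free \<Rightarrow> ('k, 'w) free) set" where
  "sym_hom V W d = {f. Vector_Spaces.linear fscl fscl f \<and> (\<forall>x. f (sym_proj V x) = f x) \<and>
     range f \<subseteq> sym_coalg W \<and> (\<forall>n. f ` sym_degree V n \<subseteq> sym_degree W (n + d))}"

definition coalg_morphism ::
  "('k::field, 'v::ab_group_add) graded_space \<Rightarrow> ('k, 'w::ab_group_add) graded_space \<Rightarrow>
   (('k, 'v) free \<Rightarrow> ('k, 'w) free) \<Rightarrow> bool" where
  "coalg_morphism V W f \<longleftrightarrow> f \<in> sym_hom V W 0 \<and>
     (\<forall>x\<in>sym_coalg V. coprod W (f x) = tensor_map 0 f f (coprod V x)) \<and>
     f (smono V []) = smono W []"

definition Coder ::
  "('k::field, 'v::ab_group_add) graded_space \<Rightarrow> int \<Rightarrow> (('k, 'v) free \<Rightarrow> ('k, 'v) free) set" where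
  "Coder V d = {\<alpha> \<in> sym_hom V V d. \<forall>x\<in>sym_coalg V.
     coprod V (\<alpha> x) = tensor_map 0 \<alpha> (sym_proj V) (coprod V x) + tensor_map d (sym_proj V) \<alpha> (coprod V x)}"


section \<open>L-infinity[1]-algebras and minimal models\<close>

definition Linf_algebra ::
  "('k::field, 'v::ab_group_add) graded_space \<Rightarrow> (('k, 'v) free \<Rightarrow> ('k, 'v) free) \<Rightarrow> bool" where
  "Linf_algebra V Q \<longleftrightarrow> graded_vector_space V \<and> Q \<in> Coder V 1 \<and> Q (smono V []) = 0 \<and>
     (\<forall>x\<in>sym_coalg V. Q (Q x) = 0)"

definition Linf_morphism ::
  "('k::field, 'v::ab_group_add) graded_space \<Rightarrow> (('k, 'v) free \<Rightarrow> ('k, 'v) free) \<Rightarrow>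
   ('k, 'w::ab_group_add) graded_space \<Rightarrow> (('k, 'w) free \<Rightarrow> ('k, 'w) free) \<Rightarrow>
   (('k, 'v) free \<Rightarrow> ('k, 'w) free) \<Rightarrow> bool" where
  "Linf_morphism V Q W R f \<longleftrightarrow> coalg_morphism V W f \<and> (\<forall>x\<in>sym_coalg V. f (Q x) = R (f x))"

text \<open>The component \<open>f\<^sup>1\<^sub>1\<close> of a map \<open>f\<close> of degree \<open>d\<close>, on the degree \<open>n\<close> part of \<open>V\<close>.\<close>

definition lin_part ::
  "('k::field, 'v::ab_group_add) graded_space \<Rightarrow> ('k, 'w::ab_group_add) graded_space \<Rightarrow> int \<Rightarrow>
   (('k, 'v) free \<Rightarrow> ('k, 'w) free) \<Rightarrow> int \<Rightarrow> 'v \<Rightarrow> 'w" where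
  "lin_part V W d f n v = corestr W (n + d) (f (smono V [(n, v)]))"

definition coboundaries ::
  "('k::field, 'v::ab_group_add) graded_space \<Rightarrow> (('k, 'v) free \<Rightarrow> ('k, 'v) free) \<Rightarrow> int \<Rightarrow> 'v set" where
  "coboundaries V Q n = lin_part V V 1 Q (n - 1) ` part V (n - 1)"

definition coh_class ::
  "('k::field, 'v::ab_group_add) graded_space \<Rightarrow> (('k, 'v) free \<Rightarrow> ('k, 'v) free) \<Rightarrow> int \<Rightarrow> 'v \<Rightarrow> 'v" where
  "coh_class V Q n = quot_map (scl V) (coboundaries V Q n)"

definition tangent_coh ::
  "('k::field, 'v::ab_group_add) graded_space \<Rightarrow> (('k, 'v) free \<Rightarrow> ('k, 'v) free) \<Rightarrow> int \<Rightarrow> 'v set" where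
  "tangent_coh V Q n = coh_class V Q n ` {v \<in> part V n. lin_part V V 1 Q n v = 0}"

definition weak_equivalence ::
  "('k::field, 'v::ab_group_add) graded_space \<Rightarrow> (('k, 'v) free \<Rightarrow> ('k, 'v) free) \<Rightarrow>
   ('k, 'w::ab_group_add) graded_space \<Rightarrow> (('k, 'w) free \<Rightarrow> ('k, 'w) free) \<Rightarrow>
   (('k, 'v) free \<Rightarrow> ('k, 'w) free) \<Rightarrow> bool" where
  "weak_equivalence V Q W R f \<longleftrightarrow> Linf_morphism V Q W R f \<and>
     (\<forall>n. bij_betw (\<lambda>h. coh_class W R n (lin_part V W 0 f n h)) (tangent_coh V Q n) (tangent_coh W R n))"

definition minimal_Linf ::
  "('k::field, 'v::ab_group_add) graded_space \<Rightarrow> (('k, 'v) free \<Rightarrow> ('k, 'v) free) \<Rightarrow> bool" where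
  "minimal_Linf V Q \<longleftrightarrow> Linf_algebra V Q \<and> (\<forall>n. \<forall>v\<in>part V n. lin_part V V 1 Q n v = 0)"

definition is_minimal_model ::
  "('k::field, 'w::ab_group_add) graded_space \<Rightarrow> (('k, 'w) free \<Rightarrow> ('k, 'w) free) \<Rightarrow>
   ('k, 'v::ab_group_add) graded_space \<Rightarrow> (('k, 'v) free \<Rightarrow> ('k, 'v) free) \<Rightarrow> bool" where
  "is_minimal_model W R V Q \<longleftrightarrow> minimal_Linf W R \<and>
     (\<exists>f g. weak_equivalence V Q W R f \<and> weak_equivalence W R V Q g \<and>
            (\<forall>x\<in>sym_coalg W. f (g x) = x))"


section \<open>The Chevalley-Eilenberg spectral sequence\<close>

type_synonym ('k, 'v) endo = "('k, 'v) free \<Rightarrow> ('k, 'v) free"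

abbreviation escl :: "'k::field \<Rightarrow> ('k, 'v) endo \<Rightarrow> ('k, 'v) endo" where
  "escl \<equiv> pscl fscl"

definition CE_filt :: "('k::field, 'v::ab_group_add) graded_space \<Rightarrow> int \<Rightarrow> ('k, 'v) endo set" where
  "CE_filt V p = {\<alpha>. \<forall>i. int i < p \<longrightarrow> (\<forall>x\<in>sym_power V i. \<alpha> x = 0)}"

text \<open>The differential on coderivations of degree \<open>n\<close>.\<close>

definition CE_diff :: "('k::field, 'v) endo \<Rightarrow> int \<Rightarrow> ('k, 'v) endo \<Rightarrow> ('k, 'v) endo" where
  "CE_diff Q n \<alpha> = (\<lambda>x. Q (\<alpha> x) - fscl ((-1) powi n) (\<alpha> (Q x)))"

text \<open>The page index of \<open>CE_Z\<close> is an integer because \<open>E\<^sub>0\<close> involves \<open>Z\<^sub>-\<^sub>1\<close>.\<close>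

definition CE_Z ::
  "('k::field, 'v::ab_group_add) graded_space \<Rightarrow> ('k, 'v) endo \<Rightarrow> int \<Rightarrow> int \<Rightarrow> int \<Rightarrow> ('k, 'v) endo set" where
  "CE_Z V Q r p q = {\<alpha> \<in> Coder V (p + q). \<alpha> \<in> CE_filt V p \<and> CE_diff Q (p + q) \<alpha> \<in> CE_filt V (p + r)}"

definition CE_B ::
  "('k::field, 'v::ab_group_add) graded_space \<Rightarrow> ('k, 'v) endo \<Rightarrow> nat \<Rightarrow> int \<Rightarrow> int \<Rightarrow> ('k, 'v) endo set" where
  "CE_B V Q r p q = {\<alpha> + CE_diff Q (p + q - 1) \<beta> | \<alpha> \<beta>.
     \<alpha> \<in> CE_Z V Q (int r - 1) (p + 1) (q - 1) \<and>
     \<beta> \<in> CE_Z V Q (int r - 1) (p - int r + 1) (q + int r - 2)}"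

definition CE_class ::
  "('k::field, 'v::ab_group_add) graded_space \<Rightarrow> ('k, 'v) endo \<Rightarrow> nat \<Rightarrow> int \<Rightarrow> int \<Rightarrow>
   ('k, 'v) endo \<Rightarrow> ('k, 'v) endo" where
  "CE_class V Q r p q = quot_map escl (CE_B V Q r p q)"

definition CE_E ::
  "('k::field, 'v::ab_group_add) graded_space \<Rightarrow> ('k, 'v) endo \<Rightarrow> nat \<Rightarrow> int \<Rightarrow> int \<Rightarrow> ('k, 'v) endo set" where
  "CE_E V Q r p q = CE_class V Q r p q ` CE_Z V Q (int r) p q"

definition CE_d ::
  "('k::field, 'v::ab_group_add) graded_space \<Rightarrow> ('k, 'v) endo \<Rightarrow> nat \<Rightarrow> int \<Rightarrow> int \<Rightarrow>
   ('k, 'v) endo \<Rightarrow> ('k, 'v) endo" where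
  "CE_d V Q r p q \<xi> = CE_class V Q r (p + int r) (q - int r + 1) (CE_diff Q (p + q) \<xi>)"

text \<open>The class map from the cycles of \<open>E\<^sub>r\<^bsup>p,q\<^esup>\<close> to the cohomology of \<open>(E\<^sub>r, d\<^sub>r)\<close>.\<close>

definition CE_page_class ::
  "('k::field, 'v::ab_group_add) graded_space \<Rightarrow> ('k, 'v) endo \<Rightarrow> nat \<Rightarrow> int \<Rightarrow> int \<Rightarrow>
   ('k, 'v) endo \<Rightarrow> ('k, 'v) endo" where
  "CE_page_class V Q r p q =
     quot_map escl (CE_d V Q r (p - int r) (q + int r - 1) ` CE_E V Q r (p - int r) (q + int r - 1))"

text \<open>
  The canonical isomorphism from \<open>E\<^sub>r\<^sub>+\<^sub>1\<close> to the cohomology of \<open>E\<^sub>r\<close>: the class of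
  \<open>x \<in> Z\<^sub>r\<^sub>+\<^sub>1\<close> is sent to the cohomology class of the class of \<open>x\<close> in \<open>E\<^sub>r\<close>.
\<close>

definition CE_next ::
  "('k::field, 'v::ab_group_add) graded_space \<Rightarrow> ('k, 'v) endo \<Rightarrow> nat \<Rightarrow> int \<Rightarrow> int \<Rightarrow>
   ('k, 'v) endo \<Rightarrow> ('k, 'v) endo" where
  "CE_next V Q r p q \<xi> = CE_page_class V Q r p q (CE_class V Q r p q \<xi>)"

text \<open>
  A morphism of spectral sequences: linear maps of pages that commute with the differentials, the
  map on page \<open>r + 1\<close> being the one induced in cohomology by the map on page \<open>r\<close>.
\<close>

definition CE_morphism ::
  "('k::field, 'v::ab_group_add) graded_space \<Rightarrow> ('k, 'v) endo \<Rightarrow>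
   ('k, 'w::ab_group_add) graded_space \<Rightarrow> ('k, 'w) endo \<Rightarrow>
   (nat \<Rightarrow> int \<Rightarrow> int \<Rightarrow> ('k, 'v) endo \<Rightarrow> ('k, 'w) endo) \<Rightarrow> bool" where
  "CE_morphism V Q W R \<phi> \<longleftrightarrow>
     (\<forall>r p q. linear_between escl (CE_E V Q r p q) escl (CE_E W R r p q) (\<phi> r p q)) \<and>
     (\<forall>r p q. \<forall>\<xi>\<in>CE_E V Q r p q.
        \<phi> r (p + int r) (q - int r + 1) (CE_d V Q r p q \<xi>) = CE_d W R r p q (\<phi> r p q \<xi>)) \<and>
     (\<forall>r p q. \<forall>\<xi>\<in>CE_E V Q (Suc r) p q.
        CE_next W R r p q (\<phi> (Suc r) p q \<xi>) = CE_page_class W R r p q (\<phi> r p q (CE_next V Q r p q \<xi>)))"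

text \<open>
  The Euler derivation. The identification of \<open>E\<^sub>1\<^bsup>1,-1\<^esup>\<close> with the endomorphisms of degree 0 of the
  tangent cohomology takes the class of a coderivation to the map induced by its component from
  \<open>V\<close> to \<open>V\<close>.
\<close>

definition euler_derivation ::
  "('k::field, 'v::ab_group_add) graded_space \<Rightarrow> ('k, 'v) endo \<Rightarrow> ('k, 'v) endo" where
  "euler_derivation V Q = (THE \<xi>. \<xi> \<in> CE_E V Q 1 1 (-1) \<and>
     (\<forall>n. \<forall>h\<in>tangent_coh V Q n. coh_class V Q n (lin_part V V 0 \<xi> n h) = scl V (of_int (n + 1)) h))"

end

(*
  Let f : V -> W and g : W -> V be the weak equivalences with f g = 1. Because f g = 1, the map
  alpha |-> f alpha g sends coderivations of S(V) to coderivations of S(W). It commutes with the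
  differentials and, since f and g do not raise word length, preserves the filtrations. A map of
  filtered complexes that is bijective on E_1 is bijective on every later page.

  Surjectivity on E_1: a coderivation gamma in F^p comes from the coderivation that extends the
  restriction of g gamma f to words of length p.
  Injectivity on E_1: the kernel of the linear part of f is acyclic. A contraction of it extends to a
  coderivation h of degree -1, and E = [Q, h] multiplies a word with j letters in ker f and all
  others in im g by j, up to shorter words. For closed alpha the map alpha E is null-homotopic,
  so (-1)^p p! alpha is homotopic to alpha (E - 1) ... (E - p). The latter vanishes on words with j > 0.
  On the remaining words alpha is alpha g, whose values are boundaries when f alpha g vanishes on
  words of length p. This replaces the Kuenneth formula.

  The Euler derivation of W extends to a coderivation whose differential lies in F^2 because W has no
  linear differential; a coderivation of V that lifts it represents the Euler derivation of V.
*)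
theory Submission
  imports Defs "HOL-Library.Multiset"
begin

section \<open>Linear maps out of free spaces\<close>

text \<open>The coalgebra is a quotient of a free space on words, with no normal form for its
  elements. A linear map out of it is therefore handled as a function on words that respects the
  relators (\<open>sym_fun\<close>), and the coproduct as a recursion on words (\<open>spl\<close>).
  How morphisms and coderivations act on word length is read off one identity: multiplying after the
  coproduct scales length m by 2^m. Since 2^m - 2 is invertible for m \<noteq> 1 in characteristic
  0, all components except the one of length 1 are determined by shorter words.

  Conjugation works in one direction only. As g f is not the identity, \<gamma> \<mapsto> g \<gamma>
  f does not yield coderivations of S(V), and no inverse chain map is at hand. Hence E_1 is treated
  with representatives, and on later pages surjectivity and injectivity are carried through one
  joint induction. On E_1 the composites with E and with sections of Q need not be coderivations
  either; so the homotopies live among plain linear maps (\<open>coch\<close>), and only their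
  values on words of length p are finally extended to coderivations.\<close>

abbreviation sgl :: "'a \<Rightarrow> ('a \<Rightarrow>\<^sub>0 'k::field)" where
  "sgl w \<equiv> Poly_Mapping.single w 1"

abbreviation flin :: "(('a \<Rightarrow>\<^sub>0 'k::field) \<Rightarrow> ('b \<Rightarrow>\<^sub>0 'k)) \<Rightarrow> bool" where
  "flin \<equiv> Vector_Spaces.linear fscl fscl"

global_interpretation fs: vector_space "fscl :: 'k::field \<Rightarrow> ('a \<Rightarrow>\<^sub>0 'k) \<Rightarrow> _"
  by (rule vector_space_fscl)

global_interpretation fsp: vector_space_pair
  "fscl :: 'k::field \<Rightarrow> ('a \<Rightarrow>\<^sub>0 'k) \<Rightarrow> _" "fscl :: 'k \<Rightarrow> ('b \<Rightarrow>\<^sub>0 'k) \<Rightarrow> _"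
  by unfold_locales

lemma linearI:
  assumes "vector_space s" "vector_space t" "\<And>x y. f (x + y) = f x + f y" "\<And>c x. f (s c x) = t c (f x)"
  shows "Vector_Spaces.linear s t f"
  using assms by (simp add: Vector_Spaces.linear_def module_hom_def module_hom_axioms_def vector_space_def
      module_def)

lemma flinI:
  assumes "\<And>x y. f (x + y) = f x + f y" "\<And>c x. f (fscl c x) = fscl c (f x)"
  shows "flin f"
  using assms by (intro linearI vector_space_fscl)

lemma lin_simps:
  assumes "Vector_Spaces.linear s t f"
  shows "f (x + y) = f x + f y" "f (x - y) = f x - f y" "f (- x) = - f x" "f 0 = 0"
    "f (s c x) = t c (f x)" "f (sum g A) = (\<Sum>a\<in>A. f (g a))"
proof -
  interpret Vector_Spaces.linear s t f by fact
  show "f (x + y) = f x + f y" "f (x - y) = f x - f y" "f (- x) = - f x" "f 0 = 0"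
    "f (s c x) = t c (f x)" "f (sum g A) = (\<Sum>a\<in>A. f (g a))"
    by (rule add diff neg zero scale sum)+
qed

lemma poly_mapping_sum_fscl: "x = (\<Sum>w\<in>Poly_Mapping.keys x. fscl (Poly_Mapping.lookup x w) (sgl w))"
  by (rule poly_mapping_eqI)
     (auto simp: lookup_sum lookup_single when_def if_distrib cong: if_cong split: if_splits
        simp: in_keys_iff)

text \<open>\<open>linext\<close> sums over the support; allowing any finite superset makes
  arguments with different supports comparable, as additivity requires.\<close>

lemma linext_eq_sum:
  fixes x :: "'a \<Rightarrow>\<^sub>0 'k::field"
  assumes "vector_space s" "finite A" "Poly_Mapping.keys x \<subseteq> A"
  shows "linext s g x = (\<Sum>a\<in>A. s (Poly_Mapping.lookup x a) (g a))"
proof -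
  interpret vector_space s by fact
  show ?thesis
    unfolding linext_def using assms(2,3)
    by (intro sum.mono_neutral_left) (auto simp: in_keys_iff)
qed

lemma linear_linext:
  fixes g :: "'c \<Rightarrow> 'b::ab_group_add" and s :: "'k::field \<Rightarrow> 'b \<Rightarrow> 'b"
  assumes "vector_space s"
  shows "Vector_Spaces.linear fscl s (linext s g)"
proof -
  interpret vector_space s by fact
  show ?thesis
  proof (rule linearI)
    fix x y :: "'c \<Rightarrow>\<^sub>0 'k"
    let ?A = "Poly_Mapping.keys x \<union> Poly_Mapping.keys y"
    have "linext s g (x + y) = (\<Sum>a\<in>?A. s (Poly_Mapping.lookup (x + y) a) (g a))"
      by (rule linext_eq_sum) (use assms keys_add[of x y] in auto)
    also have "\<dots> = linext s g x + linext s g y"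
      by (subst (1 2) linext_eq_sum[OF assms, where A = ?A])
         (auto simp: lookup_add scale_left_distrib sum.distrib)
    finally show "linext s g (x + y) = linext s g x + linext s g y" .
  next
    fix c :: 'k and x :: "'c \<Rightarrow>\<^sub>0 'k"
    have "linext s g (fscl c x) = (\<Sum>a\<in>Poly_Mapping.keys x. s (Poly_Mapping.lookup (fscl c x) a) (g a))"
      by (rule linext_eq_sum) (use assms in \<open>auto simp: in_keys_iff\<close>)
    then show "linext s g (fscl c x) = s c (linext s g x)"
      by (simp add: linext_def scale_sum_right)
  qed (fact vector_space_fscl assms)+
qed

lemma linext_sgl:
  assumes "vector_space s"
  shows "linext s g (sgl w) = g w"
proof -
  interpret vector_space s by fact
  show ?thesis by (simp add: linext_def)
qed

lemmas flin_linext [intro, simp] = linear_linext[OF vector_space_fscl]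
lemmas flinext_sgl [simp] = linext_sgl[OF vector_space_fscl]

lemma linear_expand:
  assumes "Vector_Spaces.linear fscl s f"
  shows "f x = linext s (\<lambda>w. f (sgl w)) x"
proof -
  have "f x = f (\<Sum>w\<in>Poly_Mapping.keys x. fscl (Poly_Mapping.lookup x w) (sgl w))"
    using poly_mapping_sum_fscl[of x] by simp
  then show ?thesis
    by (simp only: lin_simps[OF assms] linext_def)
qed

lemma linear_eq_linext:
  assumes "Vector_Spaces.linear fscl s f"
  shows "f = linext s (\<lambda>w. f (sgl w))"
  using linear_expand[OF assms] by blast

lemma linear_ext_sgl:
  assumes "Vector_Spaces.linear fscl s f" "Vector_Spaces.linear fscl s g" "\<And>w. f (sgl w) = g (sgl w)"
  shows "f = g"
  using linear_eq_linext[OF assms(1)] linear_eq_linext[OF assms(2)] assms(3) by simp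

lemma linear_ext_sgl':
  assumes "Vector_Spaces.linear fscl s f" "Vector_Spaces.linear fscl s g" "\<And>w. f (sgl w) = g (sgl w)"
  shows "f x = g x"
  using linear_ext_sgl[OF assms] by simp

lemma linear_comp:
  assumes "Vector_Spaces.linear s t f" "Vector_Spaces.linear t u g"
  shows "Vector_Spaces.linear s u (\<lambda>x. g (f x))"
proof -
  have "vector_space s" "vector_space u"
    using assms by (auto simp: Vector_Spaces.linear_def)
  then show ?thesis
    using assms by (intro linearI) (auto simp: lin_simps[OF assms(1)] lin_simps[OF assms(2)])
qed

lemma flin_intros:
  assumes "flin f" "flin g"
  shows "flin (\<lambda>x. f x + g x)" "flin (\<lambda>x. f x - g x)" "flin (\<lambda>x. fscl c (f x))" "flin (\<lambda>x. - f x)"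
  by (auto intro!: flinI simp: lin_simps[OF assms(1)] lin_simps[OF assms(2)] fs.scale_right_distrib
      fs.scale_right_diff_distrib mult.commute)

lemma flin_zero: "flin (\<lambda>x. 0)" by (rule flinI) auto

lemma flin_comp: "flin f \<Longrightarrow> flin g \<Longrightarrow> flin (\<lambda>x. g (f x))"
  by (rule linear_comp)

text \<open>The scalar \<open>(-1)\<^sup>m\<close>, without reference to a field of scalars.\<close>

definition sg :: "int \<Rightarrow> 'a::ab_group_add \<Rightarrow> 'a" where
  "sg m x = (if even m then x else - x)"

lemma sg_simps [simp]: "sg m 0 = 0" "sg 0 x = x"  "sg m (sg m x) = x"
  by (auto simp: sg_def)

lemma sg_sg: "sg m (sg n x) = sg (m + n) x"
  by (auto simp: sg_def)

lemma sg_add: "sg m (x + y) = sg m x + sg m y" by (auto simp: sg_def)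
lemma sg_minus: "sg m (- x) = - sg m x" by (auto simp: sg_def)
lemma sg_diff: "sg m (x - y) = sg m x - sg m y" by (auto simp: sg_def)
lemma sg_eq_0 [simp]: "sg m x = 0 \<longleftrightarrow> x = 0" by (auto simp: sg_def)
lemma sg_cong: "even (m + n) \<Longrightarrow> sg m x = sg n x" by (auto simp: sg_def)

lemma sg_fscl: "fscl c (sg m x) = sg m (fscl c x)"
  by (auto simp: sg_def)

lemma lin_sg: "Vector_Spaces.linear s t f \<Longrightarrow> f (sg m x) = sg m (f x)"
  by (auto simp: sg_def lin_simps)

lemma minus_one_powi: "(-1) powi m = (if even m then 1 else -1 :: 'k::field)"
  by (cases "even m") (auto elim!: evenE oddE simp: power_int_add power_int_mult)

lemma scale_powi: "vector_space s \<Longrightarrow> s ((-1) powi m) x = sg m x"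
proof -
  assume "vector_space s"
  then interpret vector_space s .
  show ?thesis by (simp add: minus_one_powi sg_def)
qed

lemmas fscl_powi = scale_powi[OF vector_space_fscl]

lemma flin_sg: "flin f \<Longrightarrow> flin (\<lambda>x. sg m (f x))"
  using flin_intros(4)[of f f] by (cases "even m") (auto simp: sg_def)


section \<open>Splittings of a word\<close>

text \<open>
  \<open>spl w F\<close> is the sum of \<open>\<plusminus> F u v\<close> over all ways to split \<open>w\<close> into two complementary subwords, with
  Koszul signs: the value on \<open>w\<close> of the unshuffle coproduct followed by the bilinear extension of \<open>F\<close>.
\<close>

fun spl :: "'v word \<Rightarrow> ('v word \<Rightarrow> 'v word \<Rightarrow> 'b) \<Rightarrow> 'b::ab_group_add" where
  "spl [] F = F [] []"
| "spl (a # w) F = spl w (\<lambda>u v. F (a # u) v) + spl w (\<lambda>u v. sg (fst a * wdeg u) (F u (a # v)))"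

lemma wdeg_simps [simp]: "wdeg [] = 0" "wdeg (a # w) = fst a + wdeg w" "wdeg (u @ v) = wdeg u + wdeg v"
  by (simp_all add: wdeg_def)

text \<open>The two halves of a splitting share out the letters of \<open>w\<close> with
  multiplicities, so an identity under \<open>spl\<close> need only be checked for such
  pairs.\<close>

lemma spl_cong_mset:
  assumes "\<And>u v. mset u + mset v = mset w \<Longrightarrow> F u v = G u v"
  shows "spl w F = spl w G"
  using assms
proof (induction w arbitrary: F G)
  case (Cons a w)
  have "spl w (\<lambda>u v. F (a # u) v) = spl w (\<lambda>u v. G (a # u) v)"
    by (rule Cons.IH) (simp add: Cons.prems)
  moreover have "spl w (\<lambda>u v. sg (fst a * wdeg u) (F u (a # v))) = spl w (\<lambda>u v. sg (fst a * wdeg u) (G u (a # v)))"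
    by (rule Cons.IH) (simp add: Cons.prems)
  ultimately show ?case by simp
qed simp

lemma wdeg_mset: "wdeg w = sum_mset (image_mset fst (mset w))"
  by (simp add: wdeg_def sum_mset_sum_list flip: mset_map)

lemma spl_cong:
  assumes "\<And>u v. \<lbrakk>length u + length v = length w; wdeg u + wdeg v = wdeg w; set u \<union> set v = set w\<rbrakk>
     \<Longrightarrow> F u v = G u v"
  shows "spl w F = spl w G"
proof (rule spl_cong_mset)
  fix u v :: "'a word"
  assume *: "mset u + mset v = mset w"
  show "F u v = G u v"
  proof (rule assms)
    show "length u + length v = length w"
      using arg_cong[OF *, of size] by simp
    show "wdeg u + wdeg v = wdeg w"
      unfolding wdeg_mset *[symmetric] by simp
    show "set u \<union> set v = set w"
      using arg_cong[OF *, of set_mset] by simp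
  qed
qed

lemma spl_add: "spl w (\<lambda>u v. F u v + G u v) = spl w F + spl w G"
  by (induction w arbitrary: F G) (simp_all add: sg_add)

lemma spl_zero: "spl w (\<lambda>u v. 0) = 0"
  by (induction w) auto

lemma spl_linear:
  assumes "Vector_Spaces.linear s t f"
  shows "f (spl w F) = spl w (\<lambda>u v. f (F u v))"
  by (induction w arbitrary: F) (simp_all add: lin_simps[OF assms] lin_sg[OF assms])

lemma spl_uminus: "spl w (\<lambda>u v. - F u v) = - spl w F"
  by (induction w arbitrary: F) (simp_all add: sg_minus)

lemma spl_diff: "spl w (\<lambda>u v. F u v - G u v) = spl w F - spl w G"
  using spl_add[of w F "\<lambda>u v. - G u v"] by (simp add: spl_uminus)

lemma spl_sg: "spl w (\<lambda>u v. sg m (F u v)) = sg m (spl w F)"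
  by (simp add: sg_def spl_uminus)

text \<open>Letters of the first block that go right (v) end up behind letters of the second block
  that go left (u'). The sign pays for this exchange.\<close>

lemma spl_append:
  "spl (w @ w') F = spl w (\<lambda>u v. spl w' (\<lambda>u' v'. sg (wdeg v * wdeg u') (F (u @ u') (v @ v'))))"
proof (induction w arbitrary: F)
  case (Cons a w)
  show ?case
    by (simp add: Cons.IH sg_sg algebra_simps flip: spl_sg)
qed simp

text \<open>Both sides distribute the letters over three subwords. A head letter sent to the third
  crosses the other two, and additivity of \<open>wdeg\<close> makes the two ways of counting the
  crossings agree.\<close>

lemma spl_coassoc:
  "spl w (\<lambda>x v. spl x (\<lambda>u u'. F u u' v)) = spl w (\<lambda>u y. spl y (\<lambda>u' v. F u u' v))"
proof (induction w arbitrary: F)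
  case (Cons a w)
  have *: "spl w (\<lambda>x v. spl x (\<lambda>u u'. sg (fst a * wdeg x) (F u u' (a # v)))) =
    spl w (\<lambda>x v. spl x (\<lambda>u u'. sg (fst a * (wdeg u + wdeg u')) (F u u' (a # v))))"
    by (auto intro!: spl_cong)
  show ?case
    by (simp add: * spl_add Cons.IH add.assoc sg_add sg_sg distrib_left flip: spl_sg)
qed simp

text \<open>Graded cocommutativity: exchanging the halves reverses every crossing between them,
  which costs the sign of moving one half past the other.\<close>

lemma spl_cocomm: "spl w F = spl w (\<lambda>u v. sg (wdeg u * wdeg v) (F v u))"
proof (induction w arbitrary: F)
  case (Cons a w)
  show ?case
    apply simp
    apply (subst (1) Cons.IH)
    apply (subst (2) Cons.IH)
    apply (subst (3) add.commute)
    apply (intro arg_cong2[where f = "(+)"] spl_cong refl)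
     apply (auto simp: sg_sg intro!: sg_cong simp: algebra_simps)
    done
qed simp

text \<open>Isolates the two trivial splittings. What remains involves strictly shorter words only,
  which is what every induction on word length rests on.\<close>

lemma spl_nonempty:
  assumes "w \<noteq> []"
  shows "spl w F = F w [] + F [] w + spl w (\<lambda>u v. if u = [] \<or> v = [] then 0 else F u v)"
  using assms
proof (induction w arbitrary: F)
  case (Cons a w)
  show ?case
  proof (cases "w = []")
    case False
    have 1: "spl w (\<lambda>u v. F (a # u) v) = F (a # w) [] + spl w (\<lambda>u v. if v = [] then 0 else F (a # u) v)"
      by (subst (1 2) Cons.IH[OF False]) (auto simp: False intro!: spl_cong)
    have 2: "spl w (\<lambda>u v. sg (fst a * wdeg u) (F u (a # v))) = F [] (a # w) +
        spl w (\<lambda>u v. if u = [] then 0 else sg (fst a * wdeg u) (F u (a # v)))"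
      by (subst (1 2) Cons.IH[OF False]) (auto simp: False intro!: spl_cong)
    show ?thesis
      by (simp add: 1 2 if_distrib[of "sg _"] cong: if_cong)
  qed simp
qed simp


section \<open>Shuffles and splittings\<close>

text \<open>The exponent of the Koszul sign for bringing the positions in A to the front: one term
  for each position in A that is preceded by a position outside A.\<close>

definition inv_exp :: "'v word \<Rightarrow> nat set \<Rightarrow> int" where
  "inv_exp w A = (\<Sum>(a, b)\<in>{(a, b). a \<in> A \<and> a < length w \<and> b \<notin> A \<and> b < a}. fst (w ! a) * fst (w ! b))"

lemma finite_inv_pairs: "finite {(a, b). a \<in> A \<and> a < (n::nat) \<and> b \<notin> B \<and> b < a}"
  by (rule finite_subset[of _ "{..<n} \<times> {..<n}"]) auto

text \<open>A head letter outside A is crossed by every letter in A, hence the extra term. A head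
  letter inside A costs nothing (\<open>inv_exp_insert_0\<close>).\<close>

lemma inv_exp_Suc: "inv_exp (x # w) (Suc ` B) = inv_exp w B + fst x * wdeg (nths w B)"
proof -
  have nths: "wdeg (nths w B) = (\<Sum>a | a < length w \<and> a \<in> B. fst (w ! a))"
  proof (induction w arbitrary: B)
    case (Cons y w)
    have "{a. a < Suc (length w) \<and> a \<in> B} =
        (if 0 \<in> B then {0} else {}) \<union> Suc ` {a. a < length w \<and> a \<in> {j. Suc j \<in> B}}"
      by (auto simp: image_iff less_Suc_eq_0_disj)
    then show ?case
      by (simp add: nths_Cons Cons.IH sum.union_disjoint sum.reindex)
  qed simp
  have "{(a, b). a \<in> Suc ` B \<and> a < length (x # w) \<and> b \<notin> Suc ` B \<and> b < a} =
      map_prod Suc Suc ` {(a, b). a \<in> B \<and> a < length w \<and> b \<notin> B \<and> b < a} \<union>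
      (\<lambda>a. (Suc a, 0)) ` {a. a < length w \<and> a \<in> B}" (is "?L = ?M \<union> ?N")
  proof (intro equalityI subsetI)
    fix z assume "z \<in> ?L"
    then obtain a b where z: "z = (Suc a, b)" "a \<in> B" "a < length w" "b \<notin> Suc ` B" "b < Suc a"
      by auto
    then show "z \<in> ?M \<union> ?N"
      by (cases b) (auto simp: image_iff)
  qed auto
  then have "inv_exp (x # w) (Suc ` B) = (\<Sum>(a, b)\<in>?M. fst ((x # w) ! a) * fst ((x # w) ! b)) +
      (\<Sum>(a, b)\<in>?N. fst ((x # w) ! a) * fst ((x # w) ! b))"
    unfolding inv_exp_def by (simp only:) (rule sum.union_disjoint, auto intro: finite_inv_pairs)
  moreover have "(\<Sum>(a, b)\<in>?M. fst ((x # w) ! a) * fst ((x # w) ! b)) = inv_exp w B"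
    unfolding inv_exp_def by (subst sum.reindex) (auto simp: inj_on_def intro!: sum.cong)
  moreover have "(\<Sum>(a, b)\<in>?N. fst ((x # w) ! a) * fst ((x # w) ! b)) = fst x * wdeg (nths w B)"
    by (subst sum.reindex) (auto simp: inj_on_def nths sum_distrib_left mult.commute intro!: sum.cong)
  ultimately show ?thesis by simp
qed

lemma inv_exp_insert_0: "inv_exp (x # w) (insert 0 (Suc ` B)) = inv_exp w B"
proof -
  have "{(a, b). a \<in> insert 0 (Suc ` B) \<and> a < length (x # w) \<and> b \<notin> insert 0 (Suc ` B) \<and> b < a} =
      map_prod Suc Suc ` {(a, b). a \<in> B \<and> a < length w \<and> b \<notin> B \<and> b < a}" (is "?L = ?M")
  proof (intro equalityI subsetI)
    fix z assume "z \<in> ?L"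
    then obtain a b where z: "z = (Suc a, b)" "a \<in> B" "a < length w" "b \<notin> Suc ` B" "b < Suc a" "b \<noteq> 0"
      by auto
    then show "z \<in> ?M"
      by (cases b) (auto simp: image_iff)
  qed auto
  then show ?thesis
    unfolding inv_exp_def by (simp only:) (subst sum.reindex, auto simp: inj_on_def intro!: sum.cong)
qed

text \<open>Sending each letter left or right amounts to choosing a subset of positions, and the
  signs collected by the recursion add up to the inversion sign.\<close>

lemma spl_subsets:
  "spl w F = (\<Sum>A\<in>Pow {..<length w}. sg (inv_exp w A) (F (nths w A) (nths w (- A))))"
proof (induction w arbitrary: F)
  case Nil
  show ?case by (simp add: inv_exp_def)
next
  case (Cons x w)
  have nths: "nths (x # w) (Suc ` B) = nths w B" "nths (x # w) (- (Suc ` B)) = x # nths w (- B)"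
    "nths (x # w) (insert 0 (Suc ` B)) = x # nths w B" "nths (x # w) (- insert 0 (Suc ` B)) = nths w (- B)" for B
    by (auto simp: nths_Cons image_iff Collect_neg_eq)
  let ?G = "\<lambda>A. sg (inv_exp (x # w) A) (F (nths (x # w) A) (nths (x # w) (- A)))"
  have eq: "Pow {..<length (x # w)} = image Suc ` Pow {..<length w} \<union> (\<lambda>B. insert 0 (Suc ` B)) ` Pow {..<length w}"
  proof -
    have "Pow (Suc ` {..<length w}) = image Suc ` Pow {..<length w}"
      by (rule image_Pow_surj[symmetric]) simp
    then show ?thesis
      by (simp add: lessThan_Suc_eq_insert_0 Pow_insert image_image)
  qed
  have "sum ?G (Pow {..<length (x # w)}) =
     sum ?G (image Suc ` Pow {..<length w}) + sum ?G ((\<lambda>B. insert 0 (Suc ` B)) ` Pow {..<length w})"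
    unfolding eq by (rule sum.union_disjoint) auto
  also have "sum ?G (image Suc ` Pow {..<length w}) = (\<Sum>B\<in>Pow {..<length w}. ?G (Suc ` B))"
    by (subst sum.reindex) (auto simp: inj_on_def inj_image_eq_iff)
  also have "sum ?G ((\<lambda>B. insert 0 (Suc ` B)) ` Pow {..<length w}) =
      (\<Sum>B\<in>Pow {..<length w}. ?G (insert 0 (Suc ` B)))"
  proof (subst sum.reindex)
    show "inj_on (\<lambda>B. insert 0 (Suc ` B)) (Pow {..<length w})"
      by (rule inj_onI) (metis Zero_not_Suc image_iff insert_ident inj_image_eq_iff inj_Suc)
  qed auto
  finally show ?case
    by (simp add: Cons.IH nths inv_exp_Suc inv_exp_insert_0 sg_sg add.commute)
qed

text \<open>Inverse to taking the set of the first k values of a shuffle: the positions in A in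
  increasing order, followed by the others. It fixes everything from n on because
  \<open>permutes\<close> demands it.\<close>

definition set_perm :: "nat \<Rightarrow> nat set \<Rightarrow> nat \<Rightarrow> nat" where
  "set_perm n A i = (if i < n then (filter (\<lambda>i. i \<in> A) [0..<n] @ filter (\<lambda>i. i \<notin> A) [0..<n]) ! i else i)"

lemma strict_sorted_filter_upt: "sorted_wrt (<) (filter P [m..<n])"
  by (simp add: sorted_wrt_filter)

lemma set_perm_shuffle:
  assumes "A \<subseteq> {..<n}"
  shows "set_perm n A \<in> shuffle_perms (card A) n" "set_perm n A ` {..<card A} = A" "card A \<le> n"
proof -
  let ?l = "filter (\<lambda>i. i \<in> A) [0..<n]" and ?m = "filter (\<lambda>i. i \<notin> A) [0..<n]"
  have set: "set ?l = A" using assms by auto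
  have ll: "length ?l = card A"
    using distinct_card[of ?l] set by simp
  have lm: "length (?l @ ?m) = n"
    using sum_length_filter_compl[of "\<lambda>i. i \<in> A" "[0..<n]"] by simp
  show le: "card A \<le> n" using ll lm by simp
  have "bij_betw ((!) (?l @ ?m)) {..<n} {..<n}"
    by (rule bij_betw_nth) (use lm in auto)
  then have "bij_betw (set_perm n A) {..<n} {..<n}"
    by (subst bij_betw_cong[of _ _ "(!) (?l @ ?m)"]) (auto simp: set_perm_def)
  then have "set_perm n A permutes {..<n}"
    by (rule bij_imp_permutes) (auto simp: set_perm_def)
  moreover have "strict_mono_on {..<card A} (set_perm n A)"
    using le by (auto simp: set_perm_def ll strict_mono_on_def nth_append
        intro!: sorted_wrt_nth_less[OF strict_sorted_filter_upt])
  moreover have "strict_mono_on {card A..<n} (set_perm n A)"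
    using le lm by (auto simp: set_perm_def ll strict_mono_on_def nth_append
        intro!: sorted_wrt_nth_less[OF strict_sorted_filter_upt])
  ultimately show "set_perm n A \<in> shuffle_perms (card A) n"
    by (simp add: shuffle_perms_def)
  have "set_perm n A ` {..<card A} = (!) ?l ` {..<card A}"
    using le by (intro image_cong) (auto simp: set_perm_def nth_append ll)
  also have "\<dots> = A"
    using set ll by (metis lessThan_atLeast0 list.set_map map_nth set_upt)
  finally show "set_perm n A ` {..<card A} = A" .
qed

text \<open>Each block of a shuffle is strictly increasing, hence determined by its set of
  values.\<close>

lemma shuffle_perm_lists:
  assumes "\<sigma> \<in> shuffle_perms k n" "k \<le> n"
  shows "map \<sigma> [0..<k] = filter (\<lambda>i. i \<in> \<sigma> ` {..<k}) [0..<n]"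
    and "map \<sigma> [k..<n] = filter (\<lambda>i. i \<notin> \<sigma> ` {..<k}) [0..<n]"
proof -
  have p: "\<sigma> permutes {..<n}" and m: "strict_mono_on {..<k} \<sigma>" "strict_mono_on {k..<n} \<sigma>"
    using assms(1) by (auto simp: shuffle_perms_def)
  have im: "\<sigma> ` {..<n} = {..<n}" using p by (rule permutes_image)
  have sl: "sorted_wrt (<) (map \<sigma> [0..<k])" "sorted_wrt (<) (map \<sigma> [k..<n])"
    using m by (auto simp: sorted_wrt_map strict_mono_on_def intro!: sorted_wrt_mono_rel[OF _ sorted_wrt_upt])
  show "map \<sigma> [0..<k] = filter (\<lambda>i. i \<in> \<sigma> ` {..<k}) [0..<n]"
  proof (rule strict_sorted_equal[OF strict_sorted_filter_upt sl(1)])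
    show "set (map \<sigma> [0..<k]) = set (filter (\<lambda>i. i \<in> \<sigma> ` {..<k}) [0..<n])"
      using im assms(2) by (auto simp: lessThan_atLeast0[symmetric])
  qed
  show "map \<sigma> [k..<n] = filter (\<lambda>i. i \<notin> \<sigma> ` {..<k}) [0..<n]"
  proof (rule strict_sorted_equal[OF strict_sorted_filter_upt sl(2)])
    have "\<sigma> ` {k..<n} = {..<n} - \<sigma> ` {..<k}"
    proof -
      have "{k..<n} = {..<n} - {..<k}" using assms(2) by auto
      then have "\<sigma> ` {k..<n} = \<sigma> ` {..<n} - \<sigma> ` {..<k}"
        using permutes_inj[OF p] by (simp only: image_set_diff)
      then show ?thesis using im by simp
    qed
    then show "set (map \<sigma> [k..<n]) = set (filter (\<lambda>i. i \<notin> \<sigma> ` {..<k}) [0..<n])"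
      by (auto simp: lessThan_atLeast0[symmetric])
  qed
qed

lemma shuffle_perm_eq:
  assumes "\<sigma> \<in> shuffle_perms k n" "k \<le> n"
  shows "set_perm n (\<sigma> ` {..<k}) = \<sigma>" "card (\<sigma> ` {..<k}) = k"
proof -
  have p: "\<sigma> permutes {..<n}"
    using assms(1) by (auto simp: shuffle_perms_def)
  have "set_perm n (\<sigma> ` {..<k}) i = \<sigma> i" for i
  proof (cases "i < n")
    case True
    have "map \<sigma> [0..<k] @ map \<sigma> [k..<n] = map \<sigma> [0..<n]"
      using assms(2) by (metis le_add_diff_inverse map_append upt_add_eq_append zero_le)
    then show ?thesis
      using True unfolding set_perm_def shuffle_perm_lists[OF assms, symmetric] by simp
  next
    case False
    then show ?thesis using p by (simp add: set_perm_def permutes_not_in)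
  qed
  then show "set_perm n (\<sigma> ` {..<k}) = \<sigma>" by blast
  show "card (\<sigma> ` {..<k}) = k"
    using permutes_inj[OF p] by (simp add: card_image inj_on_def inj_def)
qed

text \<open>A shuffle has inversions only between its two blocks, and \<sigma> carries them
  bijectively to the crossing pairs of positions counted by \<open>inv_exp\<close>.\<close>

lemma koszul_sign_scale:
  assumes "\<sigma> \<in> shuffle_perms k (length w)" "k \<le> length w"
  shows "fscl (koszul_sign w \<sigma> :: 'k::field) x = sg (inv_exp w (\<sigma> ` {..<k})) (x :: 'a \<Rightarrow>\<^sub>0 'k)"
proof -
  let ?I = "{(i, j). i < j \<and> j < length w \<and> \<sigma> j < \<sigma> i}"
  have p: "\<sigma> permutes {..<length w}" and m: "strict_mono_on {..<k} \<sigma>" "strict_mono_on {k..<length w} \<sigma>"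
    using assms(1) by (auto simp: shuffle_perms_def)
  have fin: "finite ?I"
    by (rule finite_subset[of _ "{..<length w} \<times> {..<length w}"]) auto
  have prod: "(\<Prod>(i, j)\<in>I. (-1 :: 'k) powi f i j) = (-1) powi (\<Sum>(i, j)\<in>I. f i j)" if "finite I" for I and f :: "nat \<Rightarrow> nat \<Rightarrow> int"
    using that by (induction I rule: finite_induct) (auto simp: power_int_add)
  have inj: "inj \<sigma>" using p by (rule permutes_inj)
  have I: "i < k \<and> \<not> j < k" if "i < j" "j < length w" "\<sigma> j < \<sigma> i" for i j
  proof (rule ccontr)
    assume "\<not> ?thesis"
    then have "(i \<in> {..<k} \<and> j \<in> {..<k}) \<or> (i \<in> {k..<length w} \<and> j \<in> {k..<length w})"
      using that by auto
    then have "\<sigma> i < \<sigma> j"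
      using strict_mono_onD[OF m(1), of i j] strict_mono_onD[OF m(2), of i j] that by blast
    then show False using that by simp
  qed
  have "map_prod \<sigma> \<sigma> ` ?I = {(a, b). a \<in> \<sigma> ` {..<k} \<and> a < length w \<and> b \<notin> \<sigma> ` {..<k} \<and> b < a}" (is "_ = ?R")
  proof (intro equalityI subsetI)
    fix z assume "z \<in> map_prod \<sigma> \<sigma> ` ?I"
    then obtain i j where "z = (\<sigma> i, \<sigma> j)" "i < j" "j < length w" "\<sigma> j < \<sigma> i" by auto
    then show "z \<in> ?R"
      using I[of i j] permutes_in_image[OF p, of i] inj by (auto simp: inj_image_mem_iff inj_eq)
  next
    fix z assume "z \<in> ?R"
    then obtain i b where z: "z = (\<sigma> i, b)" "i < k" "b \<notin> \<sigma> ` {..<k}" "b < \<sigma> i" "\<sigma> i < length w" by auto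
    then obtain j where j: "b = \<sigma> j" using permutes_surj[OF p] by (metis surjD)
    have "j < length w" using z j permutes_in_image[OF p, of j] by auto
    moreover have "\<not> j < k" using z j by auto
    ultimately show "z \<in> map_prod \<sigma> \<sigma> ` ?I"
      using z j by (auto intro!: image_eqI[of _ _ "(i, j)"])
  qed
  then have "inv_exp w (\<sigma> ` {..<k}) = (\<Sum>(a, b)\<in>map_prod \<sigma> \<sigma> ` ?I. fst (w ! a) * fst (w ! b))"
    by (simp add: inv_exp_def)
  also have "\<dots> = (\<Sum>(i, j)\<in>?I. fst (w ! \<sigma> i) * fst (w ! \<sigma> j))"
    using inj by (subst sum.reindex) (auto simp: inj_on_def inj_def intro!: sum.cong)
  finally show ?thesis
    unfolding koszul_sign_def by (simp add: prod[OF fin] fscl_powi)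
qed

lemma nths_eq_map_filter: "nths w A = map ((!) w) (filter (\<lambda>i. i \<in> A) [0..<length w])"
proof -
  have "nths (map ((!) w) [0..<length w]) A = map ((!) w) (nths [0..<length w] A)"
    by (rule nths_map)
  also have "nths [0..<length w] A = filter (\<lambda>i. i \<in> A) [0..<length w]"
    by (induction w) (auto simp: nths_append)
  finally show ?thesis by (simp add: map_nth)
qed

text \<open>Shuffles of all types (k, n - k) correspond to subsets of positions. This turns the
  double sum that defines the coproduct into the recursion \<open>spl\<close>, which suits induction
  on the word.\<close>

lemma sum_shuffles:
  fixes F :: "'v word \<Rightarrow> 'v word \<Rightarrow> ('a \<Rightarrow>\<^sub>0 'k::field)"
  shows "(\<Sum>k\<le>length w. \<Sum>\<sigma>\<in>shuffle_perms k (length w).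
     fscl (koszul_sign w \<sigma>) (F (map (\<lambda>i. w ! \<sigma> i) [0..<k]) (map (\<lambda>i. w ! \<sigma> i) [k..<length w]))) = spl w F"
    (is "?L = _")
proof -
  let ?n = "length w"
  have fin: "finite (shuffle_perms k ?n)" for k
    by (rule finite_subset[OF _ finite_permutations[of "{..<?n}"]]) (auto simp: shuffle_perms_def)
  have "?L = (\<Sum>(k, \<sigma>)\<in>Sigma {..?n} (\<lambda>k. shuffle_perms k ?n).
     fscl (koszul_sign w \<sigma>) (F (map (\<lambda>i. w ! \<sigma> i) [0..<k]) (map (\<lambda>i. w ! \<sigma> i) [k..<length w])))"
    by (rule sum.Sigma) (auto intro: fin)
  also have "\<dots> = (\<Sum>A\<in>Pow {..<?n}. sg (inv_exp w A) (F (nths w A) (nths w (- A))))"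
  proof (rule sum.reindex_bij_witness[where i = "\<lambda>A. (card A, set_perm ?n A)" and j = "\<lambda>(k, \<sigma>). \<sigma> ` {..<k}"];
      clarsimp simp: set_perm_shuffle)
    fix k \<sigma> assume k: "k \<le> ?n" and s: "\<sigma> \<in> shuffle_perms k ?n"
    show "card (\<sigma> ` {..<k}) = k \<and> set_perm ?n (\<sigma> ` {..<k}) = \<sigma>"
      using shuffle_perm_eq[OF s k] by simp
    have "nths w (\<sigma> ` {..<k}) = map (\<lambda>i. w ! \<sigma> i) [0..<k]"
      using shuffle_perm_lists(1)[OF s k] unfolding nths_eq_map_filter by (metis (no_types, lifting) map_map comp_apply map_eq_conv)
    moreover have "nths w (- \<sigma> ` {..<k}) = map (\<lambda>i. w ! \<sigma> i) [k..<?n]"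
      using shuffle_perm_lists(2)[OF s k] unfolding nths_eq_map_filter
      by (metis (no_types, lifting) map_map comp_apply map_eq_conv Compl_iff filter_cong)
    ultimately show "sg (inv_exp w (\<sigma> ` {..<k})) (F (nths w (\<sigma> ` {..<k})) (nths w (- \<sigma> ` {..<k}))) =
        fscl (koszul_sign w \<sigma>) (F (map (\<lambda>i. w ! \<sigma> i) [0..<k]) (map (\<lambda>i. w ! \<sigma> i) [k..<?n]))"
      by (simp add: koszul_sign_scale[OF s k])
  next
    fix k \<sigma> x assume "k \<le> ?n" "\<sigma> \<in> shuffle_perms k ?n" "x < k"
    then show "\<sigma> x < ?n"
      using permutes_in_image[of \<sigma> "{..<?n}" x] by (auto simp: shuffle_perms_def)
  qed
  finally show ?thesis by (simp add: spl_subsets)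
qed


section \<open>Symmetric functions on words\<close>

text \<open>The functions on words whose linear extension descends to the symmetric coalgebra: one
  clause for each of the three families in \<open>sym_relators\<close>.\<close>

definition sym_fun ::
  "('k::field, 'v::ab_group_add) graded_space \<Rightarrow> ('k \<Rightarrow> 'b \<Rightarrow> 'b) \<Rightarrow> ('v word \<Rightarrow> 'b::ab_group_add) \<Rightarrow> bool" where
  "sym_fun V s f \<longleftrightarrow> (\<forall>w. \<not> valid_word V w \<longrightarrow> f w = 0) \<and>
    (\<forall>u n x y t a b. x \<in> part V n \<longrightarrow> y \<in> part V n \<longrightarrow>
       f (u @ (n, scl V a x + scl V b y) # t) = s a (f (u @ (n, x) # t)) + s b (f (u @ (n, y) # t))) \<and>
    (\<forall>u m x n y t. x \<in> part V m \<longrightarrow> y \<in> part V n \<longrightarrow>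
       f (u @ (m, x) # (n, y) # t) = sg (m * n) (f (u @ (n, y) # (m, x) # t)))"

lemma sym_funD:
  assumes "sym_fun V s f"
  shows "\<not> valid_word V w \<Longrightarrow> f w = 0"
    and "x \<in> part V n \<Longrightarrow> y \<in> part V n \<Longrightarrow>
      f (u @ (n, scl V a x + scl V b y) # t) = s a (f (u @ (n, x) # t)) + s b (f (u @ (n, y) # t))"
    and "x \<in> part V m \<Longrightarrow> y \<in> part V n \<Longrightarrow>
      f (u @ (m, x) # (n, y) # t) = sg (m * n) (f (u @ (n, y) # (m, x) # t))"
  using assms unfolding sym_fun_def by blast+

lemma valid_word_simps [simp]:
  "valid_word V []" "valid_word V (a # w) \<longleftrightarrow> snd a \<in> part V (fst a) \<and> valid_word V w"
  "valid_word V (u @ w) \<longleftrightarrow> valid_word V u \<and> valid_word V w"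
  by (auto simp: valid_word_def)

lemma sym_fun_Cons:
  assumes "sym_fun V s f"
  shows "sym_fun V s (\<lambda>w. f (a # w))"
  unfolding sym_fun_def
proof (intro conjI allI impI)
  fix w assume "\<not> valid_word V w"
  then show "f (a # w) = 0" by (intro sym_funD(1)[OF assms]) simp
next
  fix u n x y t b c assume "x \<in> part V n" "y \<in> part V n"
  then show "f (a # u @ (n, scl V b x + scl V c y) # t) = s b (f (a # u @ (n, x) # t)) + s c (f (a # u @ (n, y) # t))"
    using sym_funD(2)[OF assms, of x n y "a # u" b c t] by simp
next
  fix u m x n y t assume "x \<in> part V m" "y \<in> part V n"
  then show "f (a # u @ (m, x) # (n, y) # t) = sg (m * n) (f (a # u @ (n, y) # (m, x) # t))"
    using sym_funD(3)[OF assms, of x m y n "a # u" t] by simp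
qed

lemma valid_word_set:
  assumes "set u \<union> set v = set w"
  shows "valid_word V w \<longleftrightarrow> valid_word V u \<and> valid_word V v"
  unfolding valid_word_def assms[symmetric] by (simp only: ball_Un)

abbreviation rel_span :: "('k::field, 'v::ab_group_add) graded_space \<Rightarrow> ('k, 'v) free set" where
  "rel_span V \<equiv> module.span fscl (sym_relators V)"

lemma linear_kills_rel_span:
  assumes h: "Vector_Spaces.linear fscl s h" and "sym_fun V s (\<lambda>w. h (sgl w))" and x: "x \<in> rel_span V"
  shows "h x = 0"
proof -
  interpret h: Vector_Spaces.linear fscl s h by fact
  have "h z = 0" if "z \<in> sym_relators V" for z
    using that unfolding sym_relators_def
  proof (elim UnE CollectE exE conjE)
    fix u m x n y t assume "x \<in> part V m" "y \<in> part V n" and z: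
      "z = sgl (u @ (m, x) # (n, y) # t) - fscl ((-1) powi (m * n)) (sgl (u @ (n, y) # (m, x) # t))"
    then have "h (sgl (u @ (m, x) # (n, y) # t)) = sg (m * n) (h (sgl (u @ (n, y) # (m, x) # t)))"
      by (intro sym_funD(3)[OF assms(2)])
    then show "h z = 0"
      by (simp add: z h.diff h.scale scale_powi[OF h.vs2.vector_space_axioms])
  qed (simp_all add: h.diff h.scale sym_funD(1,2)[OF assms(2)])
  then show ?thesis
    using x by (rule h.eq_0_on_span)
qed

lemma sym_proj_props:
  "flin (sym_proj V)" "sym_proj V (sym_proj V x) = sym_proj V x" "sym_proj V x = 0 \<longleftrightarrow> x \<in> rel_span V"
proof -
  note * = quot_map_props[OF vector_space_fscl fs.subspace_span[of "sym_relators V"], folded sym_proj_def]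
  show "flin (sym_proj V)" "sym_proj V (sym_proj V x) = sym_proj V x"
    using * by blast+
  have "{x. sym_proj V x = 0} = rel_span V"
    using * by blast
  then show "sym_proj V x = 0 \<longleftrightarrow> x \<in> rel_span V"
    by blast
qed

lemmas sym_proj_simps [simp] = lin_simps[OF sym_proj_props(1)] sym_proj_props(2) lin_sg[OF sym_proj_props(1)]

text \<open>The projection is idempotent, so x and its projection differ by an element of the
  relator span, which h kills.\<close>

lemma linear_sym_proj:
  assumes h: "Vector_Spaces.linear fscl s h" and "sym_fun V s (\<lambda>w. h (sgl w))"
  shows "h (sym_proj V x) = h x"
proof -
  have "sym_proj V (x - sym_proj V x) = 0" by simp
  then have "h (x - sym_proj V x) = 0"
    by (intro linear_kills_rel_span[OF assms]) (simp only: sym_proj_props(3))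
  then show ?thesis by (simp add: lin_simps[OF h])
qed

text \<open>Converse to \<open>linear_sym_proj\<close>: relators project to 0, so each family of
  relators yields one of the three laws.\<close>

lemma sym_fun_linear:
  assumes h: "Vector_Spaces.linear fscl s h" and *: "\<And>x. h (sym_proj V x) = h x"
  shows "sym_fun V s (\<lambda>w. h (sgl w))"
proof -
  interpret h: Vector_Spaces.linear fscl s h by fact
  have h0: "h z = 0" if "z \<in> sym_relators V" for z
  proof -
    have "sym_proj V z = 0"
      using that by (simp add: sym_proj_props(3) fs.span_base)
    then show ?thesis using *[of z] by (simp add: h.zero)
  qed
  show ?thesis
    unfolding sym_fun_def
  proof (intro conjI allI impI)
    fix w assume "\<not> valid_word V w"
    then show "h (sgl w) = 0" by (intro h0) (auto simp: sym_relators_def)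
  next
    fix u n x y t a b assume "x \<in> part V n" "y \<in> part V n"
    then have *: "h (sgl (u @ (n, scl V a x + scl V b y) # t) - fscl a (sgl (u @ (n, x) # t)) - fscl b (sgl (u @ (n, y) # t))) = 0"
      by (intro h0, unfold sym_relators_def) (rule UnI1, rule UnI2, blast)
    then show "h (sgl (u @ (n, scl V a x + scl V b y) # t)) = s a (h (sgl (u @ (n, x) # t))) + s b (h (sgl (u @ (n, y) # t)))"
      using * unfolding h.diff h.scale by (simp add: algebra_simps)
  next
    fix u m x n y t assume "x \<in> part V m" "y \<in> part V n"
    then have "h (sgl (u @ (m, x) # (n, y) # t) - fscl ((-1) powi (m * n)) (sgl (u @ (n, y) # (m, x) # t))) = 0"
      by (intro h0, unfold sym_relators_def) (rule UnI2, blast)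
    then show "h (sgl (u @ (m, x) # (n, y) # t)) = sg (m * n) (h (sgl (u @ (n, y) # (m, x) # t)))"
      by (simp add: h.diff h.scale scale_powi[OF h.vs2.vector_space_axioms])
  qed
qed

lemma sym_fun_sym_proj: "sym_fun V fscl (\<lambda>w. sym_proj V (sgl w))"
  by (rule sym_fun_linear[OF sym_proj_props(1)]) simp

lemma sym_fun_compose:
  assumes "sym_fun V s f" "Vector_Spaces.linear s s' h"
  shows "sym_fun V s' (\<lambda>w. h (f w))"
  unfolding sym_fun_def
proof (intro conjI allI impI)
  fix u n x y t b c assume "x \<in> part V n" "y \<in> part V n"
  then show "h (f (u @ (n, scl V b x + scl V c y) # t)) = s' b (h (f (u @ (n, x) # t))) + s' c (h (f (u @ (n, y) # t)))"
    by (simp add: sym_funD(2)[OF assms(1)] lin_simps[OF assms(2)])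
next
  fix u m x n y t assume "x \<in> part V m" "y \<in> part V n"
  then show "h (f (u @ (m, x) # (n, y) # t)) = sg (m * n) (h (f (u @ (n, y) # (m, x) # t)))"
    using sym_funD(3)[OF assms(1), of x m y n u t] by (simp add: lin_sg[OF assms(2)])
qed (simp add: sym_funD(1)[OF assms(1)] lin_simps[OF assms(2)])

lemma flin_scale: "flin (fscl a)"
  by (rule flinI) (simp_all add: fs.scale_right_distrib mult.commute)

lemma spl_fscl: "spl w (\<lambda>u v. fscl a (F u v)) = fscl a (spl w F)"
  by (rule spl_linear[symmetric, OF flin_scale])

text \<open>The words within one relator carry the same multiset of degree labels, so a factor that
  depends only on this multiset respects all three laws.\<close>

lemma sym_fun_scale:
  assumes "sym_fun V s f" "vector_space s"
    and k: "\<And>w w'. mset (map fst w) = mset (map fst w') \<Longrightarrow> k w = k w'"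
  shows "sym_fun V s (\<lambda>w. s (k w) (f w))"
proof -
  interpret vector_space s by fact
  show ?thesis
    unfolding sym_fun_def
  proof (intro conjI allI impI)
    fix u n x y t a b assume "x \<in> part V n" "y \<in> part V n"
    moreover define c where "c = k (u @ (n, x) # t)"
    moreover have "k (u @ (n, z) # t) = c" for z
      unfolding c_def by (rule k) simp
    ultimately show "s (k (u @ (n, scl V a x + scl V b y) # t)) (f (u @ (n, scl V a x + scl V b y) # t)) =
        s a (s (k (u @ (n, x) # t)) (f (u @ (n, x) # t))) + s b (s (k (u @ (n, y) # t)) (f (u @ (n, y) # t)))"
      using sym_funD(2)[OF assms(1), of x n y u a b t] by (simp add: scale_right_distrib mult.commute)
  next
    fix u m x n y t assume "x \<in> part V m" "y \<in> part V n"
    moreover have "k (u @ (m, x) # (n, y) # t) = k (u @ (n, y) # (m, x) # t)"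
      by (rule k) simp
    ultimately show "s (k (u @ (m, x) # (n, y) # t)) (f (u @ (m, x) # (n, y) # t)) =
        sg (m * n) (s (k (u @ (n, y) # (m, x) # t)) (f (u @ (n, y) # (m, x) # t)))"
      using sym_funD(3)[OF assms(1), of x m y n u t] by (simp add: sg_def)
  qed (simp add: sym_funD(1)[OF assms(1)])
qed

text \<open>If both letters land in the same half, the sign comes from the hypotheses on G. If they
  are separated, exchanging them changes the crossing signs of the splitting by the same
  factor.\<close>

lemma spl_swap:
  assumes "\<And>p q. G (a # b # p) q = sg (fst a * fst b) (G (b # a # p) q)"
    and "\<And>p q. G p (a # b # q) = sg (fst a * fst b) (G p (b # a # q))"
  shows "spl (a # b # t) G = sg (fst a * fst b) (spl (b # a # t) G)"
proof -
  have "spl (a # b # t) G = spl t (\<lambda>p q. G (a # b # p) q) + spl t (\<lambda>p q. sg (fst b * wdeg p) (G (a # p) (b # q))) +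
     (spl t (\<lambda>p q. sg (fst a * (fst b + wdeg p)) (G (b # p) (a # q))) +
      spl t (\<lambda>p q. sg (fst b * wdeg p) (sg (fst a * wdeg p) (G p (a # b # q)))))"
    by simp
  also have "\<dots> = sg (fst a * fst b) (spl t (\<lambda>p q. G (b # a # p) q)) +
     sg (fst a * fst b) (spl t (\<lambda>p q. sg (fst b * (fst a + wdeg p)) (G (a # p) (b # q)))) +
     (sg (fst a * fst b) (spl t (\<lambda>p q. sg (fst a * wdeg p) (G (b # p) (a # q)))) +
      sg (fst a * fst b) (spl t (\<lambda>p q. sg (fst a * wdeg p) (sg (fst b * wdeg p) (G p (b # a # q))))))"
    unfolding spl_sg[symmetric] assms sg_sg
    by (intro arg_cong2[where f = "(+)"] spl_cong sg_cong refl) auto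
  also have "\<dots> = sg (fst a * fst b) (spl (b # a # t) G)"
    by (simp add: sg_add)
  finally show ?thesis .
qed

text \<open>This makes the coproduct, and later the convolution that extends cochains to
  coderivations, well defined on the quotient.\<close>

lemma sym_fun_spl:
  fixes F :: "'v::ab_group_add word \<Rightarrow> 'v word \<Rightarrow> ('c \<Rightarrow>\<^sub>0 'k::field)"
  assumes "\<And>v. sym_fun V fscl (\<lambda>u. F u v)" "\<And>u. sym_fun V fscl (F u)"
  shows "sym_fun V fscl (\<lambda>w. spl w F)"
  unfolding sym_fun_def
proof (intro conjI allI impI)
  fix w assume *: "\<not> valid_word V w"
  have "spl w F = spl w (\<lambda>u v. 0)"
  proof (rule spl_cong)
    fix u v assume "set u \<union> set v = set w"
    then have "\<not> valid_word V u \<or> \<not> valid_word V v"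
      using valid_word_set[of u v w V] * by blast
    then show "F u v = 0"
      using sym_funD(1)[OF assms(1)[of v], of u] sym_funD(1)[OF assms(2)[of u], of v] by blast
  qed
  then show "spl w F = 0" by (simp add: spl_zero)
next
  fix u n x y t a b assume xy: "x \<in> part V n" "y \<in> part V n"
  have r: "F (p @ (n, scl V a x + scl V b y) # q) v = fscl a (F (p @ (n, x) # q) v) + fscl b (F (p @ (n, y) # q) v)"
    "F v (p @ (n, scl V a x + scl V b y) # q) = fscl a (F v (p @ (n, x) # q)) + fscl b (F v (p @ (n, y) # q))" for p q v
    by (rule sym_funD(2)[OF assms(1)[of v] xy]) (rule sym_funD(2)[OF assms(2)[of v] xy])
  show "spl (u @ (n, scl V a x + scl V b y) # t) F = fscl a (spl (u @ (n, x) # t) F) + fscl b (spl (u @ (n, y) # t) F)"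
    by (simp add: spl_append r sg_add spl_add sg_fscl fs.scale_right_distrib flip: spl_fscl)
next
  fix u m x n y t assume xy: "x \<in> part V m" "y \<in> part V n"
  have r: "F (p @ (m, x) # (n, y) # q) v = sg (m * n) (F (p @ (n, y) # (m, x) # q) v)"
    "F v (p @ (m, x) # (n, y) # q) = sg (m * n) (F v (p @ (n, y) # (m, x) # q))" for p q v
    by (rule sym_funD(3)[OF assms(1)[of v] xy]) (rule sym_funD(3)[OF assms(2)[of v] xy])
  show "spl (u @ (m, x) # (n, y) # t) F = sg (m * n) (spl (u @ (n, y) # (m, x) # t) F)"
  proof -
    have "spl ((m, x) # (n, y) # t) (\<lambda>p q. sg (wdeg v * wdeg p) (F (u' @ p) (v @ q))) =
        sg (m * n) (spl ((n, y) # (m, x) # t) (\<lambda>p q. sg (wdeg v * wdeg p) (F (u' @ p) (v @ q))))" for u' v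
      by (rule spl_swap[of "\<lambda>p q. sg (wdeg v * wdeg p) (F (u' @ p) (v @ q))" "(m, x)" "(n, y)" t, simplified fst_conv])
        (simp_all add: r sg_sg add_ac)
    then show ?thesis
      by (simp only: spl_append spl_sg)
  qed
qed

text \<open>All 2^n splittings reassemble to the same monomial, because the symmetry of F undoes the
  Koszul sign of each.\<close>

lemma spl_mult:
  assumes "sym_fun V fscl F"
  shows "spl w (\<lambda>u v. F (u @ v)) = fscl (2 ^ length w) (F w)"
  using assms
proof (induction w arbitrary: F)
  case (Cons a w)
  have move: "F (u @ a # v) = sg (fst a * wdeg u) (F (a # u @ v))" for u v
  proof (cases "valid_word V (u @ a # v)")
    case True
    \<comment> \<open>The prefix p absorbs the letters of u one by one, so that the induction
      hypothesis applies behind them.\<close>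
    have "F (p @ u @ a # v) = sg (fst a * wdeg u) (F (p @ a # u @ v))" for p
      using True
    proof (induction u arbitrary: p)
      case (Cons b u)
      have "F (p @ b # u @ a # v) = sg (fst a * wdeg u) (F ((p @ [b]) @ a # u @ v))"
        using Cons.IH[of "p @ [b]"] Cons.prems by simp
      also have "F ((p @ [b]) @ a # u @ v) = sg (fst b * fst a) (F (p @ a # b # u @ v))"
        using sym_funD(3)[OF \<open>sym_fun V fscl F\<close>, of "snd b" "fst b" "snd a" "fst a" p "u @ v"] Cons.prems
        by simp
      finally show ?case by (simp add: sg_sg algebra_simps)
    qed simp
    from this[of "[]"] show ?thesis by simp
  next
    case False
    then have "\<not> valid_word V (a # u @ v)" by simp
    then show ?thesis using False sym_funD(1)[OF Cons.prems] by simp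
  qed
  have "spl w (\<lambda>u v. F (a # u @ v)) = fscl (2 ^ length w) (F (a # w))"
    using Cons.IH[OF sym_fun_Cons[OF Cons.prems]] by simp
  then show ?case
    by (simp add: move flip: fs.scale_left_distrib)
qed simp


section \<open>The symmetric coalgebra\<close>

lemma sym_coalg_iff: "x \<in> sym_coalg V \<longleftrightarrow> sym_proj V x = x"
  unfolding sym_coalg_def using sym_proj_props(2)[of V] by (metis rangeE rangeI)

subsection \<open>Homogeneous components\<close>

definition word_proj :: "('a \<Rightarrow> bool) \<Rightarrow> ('a \<Rightarrow>\<^sub>0 'k::field) \<Rightarrow> ('a \<Rightarrow>\<^sub>0 'k)" where
  "word_proj A = linext fscl (\<lambda>w. if A w then sgl w else 0)"

text \<open>Length and total degree are read off the degree labels, which the relators preserve as a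
  multiset. This is why truncations by such predicates descend to the quotient
  (\<open>sym_proj_word_proj\<close>).\<close>

definition label_pred :: "('v word \<Rightarrow> bool) \<Rightarrow> bool" where
  "label_pred A \<longleftrightarrow> (\<forall>w w'. mset (map fst w) = mset (map fst w') \<longrightarrow> A w = A w')"

lemma label_predI [intro]:
  "label_pred (\<lambda>w. wdeg w = n)" "label_pred (\<lambda>w. length w = k)"
  "label_pred A \<Longrightarrow> label_pred B \<Longrightarrow> label_pred (\<lambda>w. A w \<and> B w)"
proof -
  show "label_pred (\<lambda>w. wdeg w = n)"
    unfolding label_pred_def wdeg_def by (metis sum_mset_sum_list)
  show "label_pred (\<lambda>w. length w = k)"
    unfolding label_pred_def by (metis length_map size_mset)
  show "label_pred A \<Longrightarrow> label_pred B \<Longrightarrow> label_pred (\<lambda>w. A w \<and> B w)"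
    unfolding label_pred_def by blast
qed

lemma flin_word_proj [simp]: "flin (word_proj A)"
  by (simp add: word_proj_def)

lemmas word_proj_simps = lin_simps[OF flin_word_proj]

lemma word_proj_sgl [simp]: "word_proj A (sgl w) = (if A w then sgl w else 0)"
  by (simp add: word_proj_def)

lemma sym_fun_if:
  fixes V :: "('b::field, 'v::ab_group_add) graded_space" and f :: "'v word \<Rightarrow> ('a \<Rightarrow>\<^sub>0 'b)"
  assumes "sym_fun V fscl f" "label_pred A"
  shows "sym_fun V fscl (\<lambda>w. if A w then f w else 0)"
proof -
  have "(if A w then 1 else 0 :: 'b) = (if A w' then 1 else 0)"
    if "mset (map fst w) = mset (map fst w')" for w w'
    using that assms(2) unfolding label_pred_def by metis
  then have "sym_fun V fscl (\<lambda>w. fscl (if A w then 1 else 0) (f w))"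
    by (rule sym_fun_scale[OF assms(1) vector_space_fscl])
  moreover have "fscl (if A w then 1 else 0) (f w) = (if A w then f w else 0)" for w
    by simp
  ultimately show ?thesis by simp
qed

lemma sym_proj_word_proj:
  assumes "label_pred A"
  shows "sym_proj V (word_proj A (sym_proj V x)) = sym_proj V (word_proj A x)"
proof (rule linear_sym_proj[where h = "\<lambda>x. sym_proj V (word_proj A x)"])
  show "flin (\<lambda>x. sym_proj V (word_proj A x))"
    by (intro flin_comp[OF _ sym_proj_props(1)]) simp
  have "sym_fun V fscl (\<lambda>w. if A w then sym_proj V (sgl w) else 0)"
    by (intro sym_fun_if sym_fun_sym_proj assms)
  then show "sym_fun V fscl (\<lambda>w. sym_proj V (word_proj A (sgl w)))"
    by (simp add: if_distrib[of "sym_proj V"] cong: if_cong)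
qed

lemma word_proj_in_span:
  assumes "\<And>w. \<lbrakk>A w; valid_word V w\<rbrakk> \<Longrightarrow> sym_proj V (sgl w) \<in> S" "fs.subspace S"
  shows "sym_proj V (word_proj A x) \<in> S"
proof -
  have "sym_proj V (word_proj A x) = linext fscl (\<lambda>w. sym_proj V (word_proj A (sgl w))) x"
    by (rule linear_expand[OF flin_comp[OF flin_word_proj sym_proj_props(1)]])
  also have "\<dots> \<in> S"
    unfolding linext_def
  proof (intro fs.subspace_sum fs.subspace_scale assms(2))
    fix w
    show "sym_proj V (word_proj A (sgl w)) \<in> S"
      using assms sym_funD(1)[OF sym_fun_sym_proj, of V w] fs.subspace_0[OF assms(2)]
      by (cases "valid_word V w") auto
  qed
  finally show ?thesis .
qed

text \<open>Turns membership in a span into one equation, since truncating and projecting fixes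
  exactly the chosen monomials and what they span.\<close>

lemma sym_span_iff:
  assumes "label_pred A"
  shows "x \<in> fs.span {smono V w | w. valid_word V w \<and> A w} \<longleftrightarrow> sym_proj V (word_proj A x) = x"
proof
  assume "x \<in> fs.span {smono V w | w. valid_word V w \<and> A w}"
  then show "sym_proj V (word_proj A x) = x"
  proof (induction rule: fs.span_induct)
    case (base)
    show ?case
      by (auto simp: fs.subspace_def word_proj_simps)
  next
    case (step z)
    then show ?case by (auto simp: smono_def sym_proj_word_proj[OF assms])
  qed
next
  assume *: "sym_proj V (word_proj A x) = x"
  have "sym_proj V (word_proj A x) \<in> fs.span {smono V w | w. valid_word V w \<and> A w}"
    by (rule word_proj_in_span) (auto simp: smono_def intro: fs.span_base)
  then show "x \<in> fs.span {smono V w | w. valid_word V w \<and> A w}" by (simp add: *)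
qed

lemma sym_degree_iff: "x \<in> sym_degree V n \<longleftrightarrow> sym_proj V (word_proj (\<lambda>w. wdeg w = n) x) = x"
  unfolding sym_degree_def by (rule sym_span_iff) auto

lemma subspace_sym_degree: "fs.subspace (sym_degree V n)"
  by (simp add: sym_degree_def)

lemma sym_proj_sgl_in_degree: "sym_proj V (sgl w) \<in> sym_degree V (wdeg w)"
  by (simp add: sym_degree_iff sym_proj_word_proj[OF label_predI(1)])

lemma sym_proj_invalid: "\<not> valid_word V w \<Longrightarrow> sym_proj V (sgl w) = 0"
  by (rule sym_funD(1)[OF sym_fun_sym_proj])


subsection \<open>Tensors and the coproduct\<close>

lemma lookup_tensor: "Poly_Mapping.lookup (tensor x y) (a, b) = Poly_Mapping.lookup x a * Poly_Mapping.lookup y b"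
proof -
  have "Poly_Mapping.lookup (tensor x y) (a, b) =
     (\<Sum>a'\<in>Poly_Mapping.keys x. \<Sum>b'\<in>Poly_Mapping.keys y.
        if a' = a then if b' = b then Poly_Mapping.lookup x a' * Poly_Mapping.lookup y b' else 0 else 0)"
    by (auto simp: tensor_def lookup_sum lookup_single when_def intro!: sum.cong)
  also have "\<dots> = (\<Sum>a'\<in>Poly_Mapping.keys x. if a' = a then Poly_Mapping.lookup x a * Poly_Mapping.lookup y b else 0)"
    by (intro sum.cong refl) (auto simp: in_keys_iff)
  also have "\<dots> = Poly_Mapping.lookup x a * Poly_Mapping.lookup y b"
    by (auto simp: in_keys_iff)
  finally show ?thesis .
qed

lemma flin_tensor [simp]: "flin (\<lambda>x. tensor x y)" "flin (\<lambda>y. tensor x y)"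
  by (auto intro!: flinI poly_mapping_eqI simp: lookup_tensor lookup_add algebra_simps)

lemmas tensor_simps = lin_simps[OF flin_tensor(1)] lin_simps[OF flin_tensor(2)]

lemma tensor_sg: "tensor (sg m x) y = sg m (tensor x y)" "tensor x (sg m y) = sg m (tensor x y)"
  by (auto simp: sg_def tensor_simps)

lemma tensor_sgl [simp]: "tensor (sgl u) (sgl v) = sgl (u, v)"
  by (simp add: tensor_def)

lemma tensor_zero [simp]: "tensor 0 y = 0" "tensor x 0 = 0"
  by (simp_all add: tensor_simps)

lemma bilinear_ext:
  assumes "\<And>y. flin (\<lambda>x. f x y)" "\<And>y. flin (\<lambda>x. g x y)" "\<And>x. flin (f x)" "\<And>x. flin (g x)"
    and "\<And>u v. f (sgl u) (sgl v) = g (sgl u) (sgl v)"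
  shows "f x y = g x y"
proof -
  have "f (sgl u) y = g (sgl u) y" for u
    by (rule linear_ext_sgl'[OF assms(3,4,5)])
  then show ?thesis
    by (rule linear_ext_sgl'[OF assms(1,2)])
qed

lemma coprod_eq: "coprod V = linext fscl (\<lambda>w. spl w (\<lambda>u v. tensor (sym_proj V (sgl u)) (sym_proj V (sgl v))))"
  unfolding coprod_def smono_def
  by (subst sum_shuffles[where F = "\<lambda>u v. tensor (sym_proj V (sgl u)) (sym_proj V (sgl v))"]) simp

lemma flin_coprod [simp]: "flin (coprod V)"
  by (simp add: coprod_eq)

lemma coprod_sgl: "coprod V (sgl w) = spl w (\<lambda>u v. tensor (sym_proj V (sgl u)) (sym_proj V (sgl v)))"
  by (simp add: coprod_eq)

lemma coprod_sym_proj [simp]: "coprod V (sym_proj V x) = coprod V x"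
proof (rule linear_sym_proj[OF flin_coprod])
  show "sym_fun V fscl (\<lambda>w. coprod V (sgl w))"
    unfolding coprod_sgl
    by (intro sym_fun_spl sym_fun_compose[OF sym_fun_sym_proj]) simp_all
qed

text \<open>The sign in \<open>tensor_map\<close> as an operator on the first tensor factor, so that
  tensors of arbitrary elements can be handled.\<close>

definition parity :: "int \<Rightarrow> ('k::field, 'v) free \<Rightarrow> ('k, 'v) free" where
  "parity e = linext fscl (\<lambda>w. sg (e * wdeg w) (sgl w))"

lemma flin_parity [simp]: "flin (parity e)"
  by (simp add: parity_def)

lemma parity_sgl [simp]: "parity e (sgl w) = sg (e * wdeg w) (sgl w)"
  by (simp add: parity_def)

lemma flin_tensor_map [simp]: "flin (tensor_map e f g)"
  by (simp add: tensor_map_def)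

lemma tensor_map_tensor:
  assumes "flin f" "flin g"
  shows "tensor_map e f g (tensor x y) = tensor (f (parity e x)) (g y)"
proof (rule bilinear_ext[where f = "\<lambda>x y. tensor_map e f g (tensor x y)" and g = "\<lambda>x y. tensor (f (parity e x)) (g y)"])
  fix u v
  show "tensor_map e f g (tensor (sgl u) (sgl v)) = tensor (f (parity e (sgl u))) (g (sgl v))"
    by (simp add: tensor_map_def fscl_powi lin_sg[OF assms(1)] tensor_sg)
qed (intro flin_comp[OF _ flin_tensor_map] flin_comp[OF _ flin_tensor(1)] flin_comp[OF _ flin_tensor(2)]
    flin_tensor flin_comp[OF flin_parity] assms)+

lemma sym_proj_parity: "sym_proj V (parity e (sym_proj V x)) = sym_proj V (parity e x)"
proof (rule linear_sym_proj[where h = "\<lambda>x. sym_proj V (parity e x)"])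
  show "flin (\<lambda>x. sym_proj V (parity e x))"
    by (intro flin_comp[OF _ sym_proj_props(1)]) simp
  have "sym_fun V fscl (\<lambda>w. fscl ((-1) powi (e * wdeg w)) (sym_proj V (sgl w)))"
    by (rule sym_fun_scale[OF sym_fun_sym_proj vector_space_fscl]) (metis wdeg_def sum_mset_sum_list)
  then show "sym_fun V fscl (\<lambda>w. sym_proj V (parity e (sgl w)))"
    by (simp add: fscl_powi)
qed

lemma parity_word_proj:
  assumes "\<And>w. A w \<Longrightarrow> wdeg w = n"
  shows "parity e (word_proj A x) = sg (e * n) (word_proj A x)"
  by (rule linear_ext_sgl'[OF flin_comp[OF flin_word_proj flin_parity] flin_sg[OF flin_word_proj]])
    (auto simp: assms lin_simps[OF flin_parity])

lemma sym_proj_parity_degree: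
  assumes "x \<in> sym_degree V n"
  shows "sym_proj V (parity e x) = sg (e * n) x"
proof -
  let ?p = "word_proj (\<lambda>w. wdeg w = n)"
  have x: "sym_proj V (?p x) = x" using assms by (simp add: sym_degree_iff)
  have "sym_proj V (parity e (sym_proj V (?p x))) = sg (e * n) (sym_proj V (?p x))"
    by (simp add: sym_proj_parity parity_word_proj)
  then show ?thesis by (simp add: x)
qed

lemma tensor_map_degree:
  assumes "flin f" "flin g" "\<And>x. f (sym_proj V x) = f x" "x \<in> sym_degree V n"
  shows "tensor_map e f g (tensor x y) = sg (e * n) (tensor (f x) (g y))"
proof -
  have "f (parity e x) = f (sym_proj V (parity e x))" by (simp add: assms)
  also have "\<dots> = sg (e * n) (f x)" by (simp add: sym_proj_parity_degree[OF assms(4)] lin_sg[OF assms(1)])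
  finally show ?thesis by (simp add: tensor_map_tensor assms(1,2) tensor_sg)
qed

lemma tensor_map_coprod:
  assumes "flin f" "flin g" "\<And>x. f (sym_proj V x) = f x" "\<And>x. g (sym_proj V x) = g x"
  shows "tensor_map e f g (coprod V (sgl w)) =
    spl w (\<lambda>u v. sg (e * wdeg u) (tensor (f (sgl u)) (g (sgl v))))"
  unfolding coprod_sgl spl_linear[OF flin_tensor_map]
  by (simp add: tensor_map_degree[OF assms(1,2,3) sym_proj_sgl_in_degree] assms(3,4))


subsection \<open>Maps of symmetric coalgebras\<close>

lemma sym_homD:
  assumes "f \<in> sym_hom V W d"
  shows "flin f" "f (sym_proj V x) = f x" "sym_proj W (f x) = f x"
    "x \<in> sym_degree V n \<Longrightarrow> f x \<in> sym_degree W (n + d)" "f (sgl w) \<in> sym_degree W (wdeg w + d)"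
    "\<not> valid_word V w \<Longrightarrow> f (sgl w) = 0"
proof -
  show 1: "flin f" "f (sym_proj V x) = f x" "sym_proj W (f x) = f x" for x
    using assms unfolding sym_hom_def sym_coalg_iff[symmetric] by blast+
  show 2: "x \<in> sym_degree V n \<Longrightarrow> f x \<in> sym_degree W (n + d)" for n x
    using assms unfolding sym_hom_def by blast
  show "f (sgl w) \<in> sym_degree W (wdeg w + d)"
    using 2[OF sym_proj_sgl_in_degree[of V w]] by (simp add: 1)
  show "\<not> valid_word V w \<Longrightarrow> f (sgl w) = 0"
    using 1(2)[of "sgl w"] by (simp add: sym_proj_invalid lin_simps[OF 1(1)])
qed

lemma sym_homI:
  assumes "flin f" "\<And>x. f (sym_proj V x) = f x" "\<And>w. valid_word V w \<Longrightarrow> f (sgl w) \<in> sym_degree W (wdeg w + d)"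
  shows "f \<in> sym_hom V W d"
proof -
  have inv: "f (sgl w) = 0" if "\<not> valid_word V w" for w
    using assms(2)[of "sgl w"] sym_proj_invalid[OF that] by (simp add: lin_simps[OF assms(1)])
  have P: "sym_proj W x = x" if "x \<in> sym_degree W n" for x n
    using that unfolding sym_degree_iff by (metis sym_proj_props(2))
  have "sym_proj W (f x) = f x" for x
  proof (rule linear_ext_sgl'[OF flin_comp[OF assms(1) sym_proj_props(1)] assms(1)])
    fix w show "sym_proj W (f (sgl w)) = f (sgl w)"
      using inv[of w] P[OF assms(3)[of w]] by (cases "valid_word V w") auto
  qed
  then have 1: "range f \<subseteq> sym_coalg W" by (auto simp: sym_coalg_iff)
  have "f x \<in> sym_degree W (n + d)" if "x \<in> sym_degree V n" for x n
    using that unfolding sym_degree_def[of V]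
  proof (induction rule: fs.span_induct)
    case base
    show ?case
      using subspace_sym_degree[of W "n + d"] by (simp add: fs.subspace_def lin_simps[OF assms(1)])
  next
    case (step x)
    then show ?case using assms(3) by (auto simp: smono_def assms(2))
  qed
  then show ?thesis
    using assms(1,2) 1 by (auto simp: sym_hom_def)
qed

text \<open>By linearity the coderivation rule can be tested on single words, where the coproduct is
  a split sum.\<close>

lemma Coder_iff:
  "\<alpha> \<in> Coder V d \<longleftrightarrow> \<alpha> \<in> sym_hom V V d \<and> (\<forall>w. coprod V (\<alpha> (sgl w)) =
     spl w (\<lambda>u v. tensor (\<alpha> (sgl u)) (sym_proj V (sgl v)) +
       sg (d * wdeg u) (tensor (sym_proj V (sgl u)) (\<alpha> (sgl v)))))" (is "_ \<longleftrightarrow> _ \<and> ?R")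
proof -
  have "(\<forall>x\<in>sym_coalg V. coprod V (\<alpha> x) =
     tensor_map 0 \<alpha> (sym_proj V) (coprod V x) + tensor_map d (sym_proj V) \<alpha> (coprod V x)) \<longleftrightarrow> ?R" (is "?L \<longleftrightarrow> _")
    if "\<alpha> \<in> sym_hom V V d"
  proof -
    note a = sym_homD(1,2)[OF that]
    have *: "tensor_map 0 \<alpha> (sym_proj V) (coprod V (sgl w)) + tensor_map d (sym_proj V) \<alpha> (coprod V (sgl w)) =
        spl w (\<lambda>u v. tensor (\<alpha> (sgl u)) (sym_proj V (sgl v)) +
       sg (d * wdeg u) (tensor (sym_proj V (sgl u)) (\<alpha> (sgl v))))" for w
      by (simp add: tensor_map_coprod a sym_proj_props(1) spl_add)
    show ?thesis
    proof
      assume ?L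
      then have "coprod V (\<alpha> (sym_proj V (sgl w))) = tensor_map 0 \<alpha> (sym_proj V) (coprod V (sym_proj V (sgl w))) +
        tensor_map d (sym_proj V) \<alpha> (coprod V (sym_proj V (sgl w)))" for w
        by (rule bspec) (simp add: sym_coalg_iff)
      then show ?R by (simp add: * a)
    next
      assume R: ?R
      have "coprod V (\<alpha> x) =
         tensor_map 0 \<alpha> (sym_proj V) (coprod V x) + tensor_map d (sym_proj V) \<alpha> (coprod V x)" for x
        by (rule linear_ext_sgl'[OF flin_comp[OF a(1) flin_coprod]
              flin_intros(1)[OF flin_comp[OF flin_coprod flin_tensor_map] flin_comp[OF flin_coprod flin_tensor_map]]])
          (simp add: R *)
      then show ?L by blast
    qed
  qed
  then show ?thesis unfolding Coder_def by blast
qed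

lemma coalg_morphism_coprod:
  assumes "coalg_morphism V W f"
  shows "coprod W (f (sgl w)) = spl w (\<lambda>u v. tensor (f (sgl u)) (f (sgl v)))"
proof -
  have f: "f \<in> sym_hom V W 0" using assms by (simp add: coalg_morphism_def)
  note a = sym_homD(1,2)[OF f]
  have "coprod W (f (sym_proj V (sgl w))) = tensor_map 0 f f (coprod V (sym_proj V (sgl w)))"
    using assms unfolding coalg_morphism_def by (elim conjE) (erule bspec, simp add: sym_coalg_iff)
  then show ?thesis by (simp add: a tensor_map_coprod)
qed

lemma coalg_morphism_hom: "coalg_morphism V W f \<Longrightarrow> f \<in> sym_hom V W 0"
  by (simp add: coalg_morphism_def)

lemma Coder_hom: "\<alpha> \<in> Coder V d \<Longrightarrow> \<alpha> \<in> sym_hom V V d"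
  by (simp add: Coder_def)

lemma Coder_coprod:
  assumes "\<alpha> \<in> Coder V d" "sym_proj V x = x"
  shows "coprod V (\<alpha> x) = tensor_map 0 \<alpha> (sym_proj V) (coprod V x) + tensor_map d (sym_proj V) \<alpha> (coprod V x)"
  using assms by (simp add: Coder_def sym_coalg_iff)

text \<open>The mixed terms, with Q on one tensor factor and \<alpha> on the other, occur in the
  coproducts of Q \<alpha> and of \<alpha> Q with signs differing by (-1)^n, so they cancel in the
  commutator.\<close>

lemma CE_diff_Coder:
  assumes Q: "Q \<in> Coder V 1" and a: "\<alpha> \<in> Coder V n"
  shows "CE_diff Q n \<alpha> \<in> Coder V (n + 1)"
proof -
  note hQ = sym_homD[OF Coder_hom[OF Q]] and ha = sym_homD[OF Coder_hom[OF a]]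
  have lin: "flin (CE_diff Q n \<alpha>)"
    unfolding CE_diff_def by (intro flin_intros(2)[OF flin_comp[OF ha(1) hQ(1)] flin_comp[OF flin_comp[OF hQ(1) ha(1)] flin_scale]])
  have h: "CE_diff Q n \<alpha> \<in> sym_hom V V (n + 1)"
  proof (rule sym_homI[OF lin])
    fix w
    show "CE_diff Q n \<alpha> (sgl w) \<in> sym_degree V (wdeg w + (n + 1))"
      unfolding CE_diff_def
      using hQ(4)[OF ha(5)[of w]] ha(4)[OF hQ(5)[of w]] subspace_sym_degree
      by (intro fs.subspace_diff fs.subspace_scale subspace_sym_degree) (simp_all add: algebra_simps)
  qed (simp add: CE_diff_def hQ(2) ha(2))
  have 1: "coprod V (Q (\<alpha> (sgl w))) = spl w (\<lambda>u v. tensor (Q (\<alpha> (sgl u))) (sym_proj V (sgl v)) +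
      sg (n * wdeg u) (tensor (Q (sgl u)) (\<alpha> (sgl v))) + sg (wdeg u + n) (tensor (\<alpha> (sgl u)) (Q (sgl v))) +
      sg ((n + 1) * wdeg u) (tensor (sym_proj V (sgl u)) (Q (\<alpha> (sgl v)))))" for w
  proof -
    have "coprod V (Q (\<alpha> (sgl w))) = tensor_map 0 Q (sym_proj V) (coprod V (\<alpha> (sgl w))) +
        tensor_map 1 (sym_proj V) Q (coprod V (\<alpha> (sgl w)))"
      by (rule Coder_coprod[OF Q ha(3)])
    also have "coprod V (\<alpha> (sgl w)) = spl w (\<lambda>u v. tensor (\<alpha> (sgl u)) (sym_proj V (sgl v)) +
       sg (n * wdeg u) (tensor (sym_proj V (sgl u)) (\<alpha> (sgl v))))"
      using a by (simp add: Coder_iff)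
    finally show ?thesis
      unfolding spl_linear[OF flin_tensor_map] spl_add[symmetric]
      by (simp add: lin_simps[OF flin_tensor_map] lin_sg[OF flin_tensor_map] sg_sg
          tensor_map_degree[OF hQ(1) sym_proj_props(1) hQ(2) ha(5)]
          tensor_map_degree[OF hQ(1) sym_proj_props(1) hQ(2) sym_proj_sgl_in_degree]
          tensor_map_degree[OF sym_proj_props(1) hQ(1) _ ha(5)]
          tensor_map_degree[OF sym_proj_props(1) hQ(1) _ sym_proj_sgl_in_degree] hQ(2) ha(3) algebra_simps)
  qed
  have 2: "coprod V (\<alpha> (Q (sgl w))) = spl w (\<lambda>u v. tensor (\<alpha> (Q (sgl u))) (sym_proj V (sgl v)) +
      sg (wdeg u) (tensor (\<alpha> (sgl u)) (Q (sgl v))) + sg (n * (wdeg u + 1)) (tensor (Q (sgl u)) (\<alpha> (sgl v))) +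
      sg ((n + 1) * wdeg u) (tensor (sym_proj V (sgl u)) (\<alpha> (Q (sgl v)))))" for w
  proof -
    have "coprod V (\<alpha> (Q (sgl w))) = tensor_map 0 \<alpha> (sym_proj V) (coprod V (Q (sgl w))) +
        tensor_map n (sym_proj V) \<alpha> (coprod V (Q (sgl w)))"
      by (rule Coder_coprod[OF a hQ(3)])
    also have "coprod V (Q (sgl w)) = spl w (\<lambda>u v. tensor (Q (sgl u)) (sym_proj V (sgl v)) +
       sg (1 * wdeg u) (tensor (sym_proj V (sgl u)) (Q (sgl v))))"
      using Q by (simp add: Coder_iff)
    finally show ?thesis
      unfolding spl_linear[OF flin_tensor_map] spl_add[symmetric]
      by (simp add: lin_simps[OF flin_tensor_map] lin_sg[OF flin_tensor_map] sg_sg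
          tensor_map_degree[OF ha(1) sym_proj_props(1) ha(2) hQ(5)]
          tensor_map_degree[OF ha(1) sym_proj_props(1) ha(2) sym_proj_sgl_in_degree]
          tensor_map_degree[OF sym_proj_props(1) ha(1) _ hQ(5)]
          tensor_map_degree[OF sym_proj_props(1) ha(1) _ sym_proj_sgl_in_degree] ha(2) hQ(3) algebra_simps)
  qed
  have "coprod V (CE_diff Q n \<alpha> (sgl w)) = spl w (\<lambda>u v. tensor (CE_diff Q n \<alpha> (sgl u)) (sym_proj V (sgl v)) +
       sg ((n + 1) * wdeg u) (tensor (sym_proj V (sgl u)) (CE_diff Q n \<alpha> (sgl v))))" for w
  proof -
    have "coprod V (CE_diff Q n \<alpha> (sgl w)) = coprod V (Q (\<alpha> (sgl w))) - sg n (coprod V (\<alpha> (Q (sgl w))))"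
      by (simp add: CE_diff_def fscl_powi lin_simps[OF flin_coprod] lin_sg[OF flin_coprod])
    also have "\<dots> = spl w (\<lambda>u v. tensor (CE_diff Q n \<alpha> (sgl u)) (sym_proj V (sgl v)) +
       sg ((n + 1) * wdeg u) (tensor (sym_proj V (sgl u)) (CE_diff Q n \<alpha> (sgl v))))"
      unfolding 1 2 spl_sg[symmetric] spl_diff[symmetric]
      by (rule spl_cong) (auto simp: CE_diff_def fscl_powi tensor_simps sg_def)
    finally show ?thesis .
  qed
  with h show ?thesis by (simp add: Coder_iff)
qed

text \<open>The conjugate is a coderivation over f g, that is, one factor of its coproduct carries f
  g; the hypothesis turns this into the identity.\<close>

lemma conj_Coder:
  assumes f: "coalg_morphism V W f" and g: "coalg_morphism W V g" and fg: "\<And>x. f (g x) = sym_proj W x"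
    and a: "\<alpha> \<in> Coder V n"
  shows "(\<lambda>x. f (\<alpha> (g x))) \<in> Coder W n"
proof -
  note hf = sym_homD[OF coalg_morphism_hom[OF f]] and hg = sym_homD[OF coalg_morphism_hom[OF g]]
    and ha = sym_homD[OF Coder_hom[OF a]]
  have h: "(\<lambda>x. f (\<alpha> (g x))) \<in> sym_hom W W n"
  proof (rule sym_homI)
    show "flin (\<lambda>x. f (\<alpha> (g x)))"
      by (intro flin_comp[OF flin_comp[OF hg(1) ha(1)] hf(1)])
    show "f (\<alpha> (g (sgl w))) \<in> sym_degree W (wdeg w + n)" for w
      using hf(4)[OF ha(4)[OF hg(5)[of w]]] by simp
  qed (simp add: hg)
  have "coprod W (f (\<alpha> (g (sgl w)))) = spl w (\<lambda>u v. tensor (f (\<alpha> (g (sgl u)))) (sym_proj W (sgl v)) +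
       sg (n * wdeg u) (tensor (sym_proj W (sgl u)) (f (\<alpha> (g (sgl v))))))" for w
  proof -
    have "coprod W (f (\<alpha> (g (sgl w)))) = tensor_map 0 f f (coprod V (\<alpha> (g (sgl w))))"
      using f ha(3) by (simp add: coalg_morphism_def sym_coalg_iff)
    also have "coprod V (\<alpha> (g (sgl w))) = tensor_map 0 \<alpha> (sym_proj V) (coprod V (g (sgl w))) +
        tensor_map n (sym_proj V) \<alpha> (coprod V (g (sgl w)))"
      by (rule Coder_coprod[OF a hg(3)])
    also have "\<dots> = spl w (\<lambda>u v. tensor (\<alpha> (g (sgl u))) (g (sgl v)) + sg (n * wdeg u) (tensor (g (sgl u)) (\<alpha> (g (sgl v)))))"
      unfolding coalg_morphism_coprod[OF g] spl_linear[OF flin_tensor_map] spl_add[symmetric]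
      by (simp add: tensor_map_degree[OF ha(1) sym_proj_props(1) ha(2) hg(5)]
          tensor_map_degree[OF sym_proj_props(1) ha(1) _ hg(5)] hg(3))
    also have "tensor_map 0 f f \<dots> = spl w (\<lambda>u v. tensor (f (\<alpha> (g (sgl u)))) (sym_proj W (sgl v)) +
       sg (n * wdeg u) (tensor (sym_proj W (sgl u)) (f (\<alpha> (g (sgl v))))))"
      unfolding spl_linear[OF flin_tensor_map]
      by (simp add: lin_simps[OF flin_tensor_map] lin_sg[OF flin_tensor_map] fg
          tensor_map_degree[OF hf(1) hf(1) hf(2) hg(5)] tensor_map_degree[OF hf(1) hf(1) hf(2) ha(4)[OF hg(5)]])
    finally show ?thesis .
  qed
  with h show ?thesis by (simp add: Coder_iff)
qed


subsection \<open>The product\<close>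

text \<open>Concatenation on the free space. Only after \<open>sym_proj\<close> does it become the
  commutative product, and there both arguments may be replaced by their projections.\<close>

definition smult :: "('k::field, 'v) free \<Rightarrow> ('k, 'v) free \<Rightarrow> ('k, 'v) free" where
  "smult x y = linext fscl (\<lambda>u. linext fscl (\<lambda>v. sgl (u @ v)) y) x"

lemma flin_smult: "flin (\<lambda>x. smult x y)" "flin (\<lambda>y. smult x y)"
proof -
  show "flin (\<lambda>x. smult x y)" by (simp add: smult_def)
  show "flin (\<lambda>y. smult x y)"
    unfolding smult_def
    by (rule flinI)
      (simp_all add: lin_simps[OF flin_linext] linext_def[where x = x] fs.scale_right_distrib sum.distrib
        fs.scale_sum_right mult.commute)
qed

lemmas smult_simps = lin_simps[OF flin_smult(1)] lin_simps[OF flin_smult(2)]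

lemma smult_sgl [simp]: "smult (sgl u) (sgl v) = sgl (u @ v)"
  by (simp add: smult_def)

lemma sym_fun_prefix: "sym_fun V s f \<Longrightarrow> sym_fun V s (\<lambda>w. f (u @ w))"
proof (induction u arbitrary: f)
  case (Cons a u)
  from Cons.IH[OF sym_fun_Cons[OF Cons.prems, of a]] show ?case by simp
qed simp

lemma sym_fun_suffix:
  assumes "sym_fun V s f"
  shows "sym_fun V s (\<lambda>w. f (w @ v))"
  unfolding sym_fun_def
proof (intro conjI allI impI)
  fix w assume "\<not> valid_word V w"
  then show "f (w @ v) = 0" by (intro sym_funD(1)[OF assms]) simp
next
  fix u n x y t b c assume "x \<in> part V n" "y \<in> part V n"
  then show "f ((u @ (n, scl V b x + scl V c y) # t) @ v) = s b (f ((u @ (n, x) # t) @ v)) + s c (f ((u @ (n, y) # t) @ v))"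
    using sym_funD(2)[OF assms, of x n y u b c "t @ v"] by simp
next
  fix u m x n y t assume "x \<in> part V m" "y \<in> part V n"
  then show "f ((u @ (m, x) # (n, y) # t) @ v) = sg (m * n) (f ((u @ (n, y) # (m, x) # t) @ v))"
    using sym_funD(3)[OF assms, of x m y n u "t @ v"] by simp
qed

lemma sym_proj_smult [simp]:
  "sym_proj V (smult (sym_proj V x) y) = sym_proj V (smult x y)"
  "sym_proj V (smult x (sym_proj V y)) = sym_proj V (smult x y)"
proof -
  have 1: "sym_proj V (smult (sym_proj V x) (sgl v)) = sym_proj V (smult x (sgl v))" for x v
  proof (rule linear_sym_proj[where h = "\<lambda>x. sym_proj V (smult x (sgl v))"])
    show "sym_fun V fscl (\<lambda>w. sym_proj V (smult (sgl w) (sgl v)))"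
      using sym_fun_suffix[OF sym_fun_sym_proj[of V]] by simp
  qed (rule flin_comp[OF flin_smult(1) sym_proj_props(1)])
  show "sym_proj V (smult (sym_proj V x) y) = sym_proj V (smult x y)"
    by (rule linear_ext_sgl'[OF flin_comp[OF flin_smult(2) sym_proj_props(1)] flin_comp[OF flin_smult(2) sym_proj_props(1)] 1])
  have 2: "sym_proj V (smult (sgl u) (sym_proj V y)) = sym_proj V (smult (sgl u) y)" for y u
  proof (rule linear_sym_proj[where h = "\<lambda>y. sym_proj V (smult (sgl u) y)"])
    show "sym_fun V fscl (\<lambda>w. sym_proj V (smult (sgl u) (sgl w)))"
      using sym_fun_prefix[OF sym_fun_sym_proj[of V]] by simp
  qed (rule flin_comp[OF flin_smult(2) sym_proj_props(1)])
  show "sym_proj V (smult x (sym_proj V y)) = sym_proj V (smult x y)"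
    by (rule linear_ext_sgl'[OF flin_comp[OF flin_smult(1) sym_proj_props(1)] flin_comp[OF flin_smult(1) sym_proj_props(1)] 2])
qed

definition tensor_mult :: "('v word \<times> 'v word \<Rightarrow>\<^sub>0 'k::field) \<Rightarrow> ('k, 'v) free" where
  "tensor_mult = linext fscl (\<lambda>(u, v). sgl (u @ v))"

lemma flin_tensor_mult [simp]: "flin tensor_mult"
  by (simp add: tensor_mult_def)

lemma tensor_mult_tensor [simp]: "tensor_mult (tensor x y) = smult x y"
proof (rule bilinear_ext[where f = "\<lambda>x y. tensor_mult (tensor x y)" and g = smult])
  show "tensor_mult (tensor (sgl u) (sgl v)) = smult (sgl u) (sgl v)" for u v
    by (simp add: tensor_mult_def)
qed (intro flin_comp[OF _ flin_tensor_mult] flin_tensor flin_smult)+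


subsection \<open>Components of fixed word length\<close>

definition lcomp :: "('k::field, 'v::ab_group_add) graded_space \<Rightarrow> nat \<Rightarrow> ('k, 'v) free \<Rightarrow> ('k, 'v) free" where
  "lcomp V n x = sym_proj V (word_proj (\<lambda>w. length w = n) x)"

lemma flin_lcomp [simp]: "flin (lcomp V n)"
  unfolding lcomp_def by (rule flin_comp[OF flin_word_proj sym_proj_props(1)])

lemmas lcomp_simps = lin_simps[OF flin_lcomp]

lemma lcomp_sym_proj [simp]: "lcomp V n (sym_proj V x) = lcomp V n x" "sym_proj V (lcomp V n x) = lcomp V n x"
  unfolding lcomp_def by (simp_all add: sym_proj_word_proj[OF label_predI(2)])

lemma lcomp_sgl: "lcomp V n (sgl w) = (if length w = n then sym_proj V (sgl w) else 0)"
  by (simp add: lcomp_def)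

lemma word_proj_word_proj: "word_proj A (word_proj B x) = word_proj (\<lambda>w. A w \<and> B w) x"
  by (rule linear_ext_sgl'[OF flin_comp[OF flin_word_proj flin_word_proj] flin_word_proj])
    (auto simp: word_proj_simps)

lemma lookup_word_proj: "Poly_Mapping.lookup (word_proj A x) w = (if A w then Poly_Mapping.lookup x w else 0)"
proof -
  have *: "Poly_Mapping.lookup x a * Poly_Mapping.lookup (if A a then sgl a else 0) w =
      (if a = w then (if A w then Poly_Mapping.lookup x w else 0) else 0)" for a
    by (auto simp: lookup_single when_def)
  show ?thesis
    unfolding word_proj_def linext_def lookup_sum lookup_fscl * by (auto simp: in_keys_iff)
qed

lemma sym_proj_eq_sum_lcomp: "\<exists>N. \<forall>n\<ge>N. sym_proj V x = (\<Sum>m<n. lcomp V m x)"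
proof -
  define N where "N = Suc (Max (insert 0 (length ` Poly_Mapping.keys x)))"
  have "sym_proj V x = (\<Sum>m<n. lcomp V m x)" if "n \<ge> N" for n
  proof -
    have len: "length w < n" if "w \<in> Poly_Mapping.keys x" for w
    proof -
      have "length w \<le> Max (insert 0 (length ` Poly_Mapping.keys x))"
        using that by (intro Max_ge) auto
      then show ?thesis using \<open>n \<ge> N\<close> unfolding N_def by linarith
    qed
    have "x = (\<Sum>m<n. word_proj (\<lambda>w. length w = m) x)"
    proof (rule poly_mapping_eqI)
      fix w
      show "Poly_Mapping.lookup x w = Poly_Mapping.lookup (\<Sum>m<n. word_proj (\<lambda>w. length w = m) x) w"
        using len[of w] by (auto simp: lookup_sum lookup_word_proj in_keys_iff)
    qed
    then have "sym_proj V x = sym_proj V (\<Sum>m<n. word_proj (\<lambda>w. length w = m) x)" by simp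
    then show ?thesis by (simp add: lcomp_def)
  qed
  then show ?thesis by blast
qed

text \<open>The increasing filtration by word length. Vanishing of components, rather than a
  condition on the support, makes it depend only on the class of x.\<close>

definition lenle :: "('k::field, 'v::ab_group_add) graded_space \<Rightarrow> nat \<Rightarrow> ('k, 'v) free \<Rightarrow> bool" where
  "lenle V n x \<longleftrightarrow> (\<forall>m>n. lcomp V m x = 0)"

lemma lenle_sum:
  assumes "lenle V n x"
  shows "sym_proj V x = (\<Sum>m\<le>n. lcomp V m x)"
proof -
  obtain N where N: "\<And>k. k \<ge> N \<Longrightarrow> sym_proj V x = (\<Sum>m<k. lcomp V m x)"
    using sym_proj_eq_sum_lcomp[of V x] by blast
  have "sym_proj V x = (\<Sum>m<max N (Suc n). lcomp V m x)"
    by (rule N) simp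
  also have "\<dots> = (\<Sum>m\<le>n. lcomp V m x)"
    using assms by (intro sum.mono_neutral_right) (auto simp: lenle_def)
  finally show ?thesis .
qed

lemma lcomp_only:
  assumes "\<And>m. m \<noteq> n \<Longrightarrow> lcomp V m x = 0"
  shows "sym_proj V x = lcomp V n x"
proof -
  have "sym_proj V x = (\<Sum>m\<le>n. lcomp V m x)"
    by (rule lenle_sum) (simp add: lenle_def assms)
  also have "\<dots> = (\<Sum>m\<le>n. if m = n then lcomp V n x else 0)"
    by (intro sum.cong) (auto simp: assms)
  finally show ?thesis by simp
qed

lemma word_proj_smult:
  "word_proj (\<lambda>w. length w = m) (smult (word_proj (\<lambda>w. length w = i) x) (word_proj (\<lambda>w. length w = j) y)) =
      (if m = i + j then smult (word_proj (\<lambda>w. length w = i) x) (word_proj (\<lambda>w. length w = j) y) else 0)"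
  (is "?f x y = ?g x y")
proof (rule bilinear_ext[where f = ?f and g = ?g])
  show "flin (\<lambda>x. ?g x y)" for y
    by (cases "m = i + j") (simp_all add: flin_zero flin_comp[OF flin_word_proj flin_smult(1)])
  show "flin (?g x)" for x
    by (cases "m = i + j") (simp_all add: flin_zero flin_comp[OF flin_word_proj flin_smult(2)])
  show "flin (\<lambda>x. ?f x y)" for y
    by (rule flin_comp[OF flin_comp[OF flin_word_proj flin_smult(1)] flin_word_proj])
  show "flin (?f x)" for x
    by (rule flin_comp[OF flin_comp[OF flin_word_proj flin_smult(2)] flin_word_proj])
  show "?f (sgl u) (sgl v) = ?g (sgl u) (sgl v)" for u v
    by (auto simp: smult_simps word_proj_simps)
qed

lemma lcomp_smult_lcomp:
  "lcomp V m (smult (lcomp V i x) (lcomp V j y)) = (if m = i + j then sym_proj V (smult (lcomp V i x) (lcomp V j y)) else 0)"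
proof -
  let ?x = "word_proj (\<lambda>w. length w = i) x" and ?y = "word_proj (\<lambda>w. length w = j) y"
  have "lcomp V m (smult (lcomp V i x) (lcomp V j y)) = lcomp V m (sym_proj V (smult (sym_proj V ?x) (sym_proj V ?y)))"
    by (simp only: lcomp_def[of V i] lcomp_def[of V j] lcomp_sym_proj)
  also have "\<dots> = sym_proj V (word_proj (\<lambda>w. length w = m) (smult ?x ?y))"
    by (simp only: sym_proj_smult lcomp_sym_proj) (simp only: lcomp_def)
  finally show ?thesis by (simp add: word_proj_smult lcomp_def[of V i] lcomp_def[of V j])
qed

lemma lcomp_smult_sym_proj [simp]:
  "lcomp V m (smult (sym_proj V x) y) = lcomp V m (smult x y)"
  "lcomp V m (smult x (sym_proj V y)) = lcomp V m (smult x y)"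
  using arg_cong[OF sym_proj_smult(1)[of V x y], of "lcomp V m"]
    arg_cong[OF sym_proj_smult(2)[of V x y], of "lcomp V m"]
  by (simp_all only: lcomp_sym_proj)

lemma lcomp_smult:
  assumes "lenle V a x" "lenle V b y"
  shows "lcomp V m (smult x y) = (\<Sum>i\<le>a. \<Sum>j\<le>b. if m = i + j then sym_proj V (smult (lcomp V i x) (lcomp V j y)) else 0)"
proof -
  have "lcomp V m (smult x y) = lcomp V m (sym_proj V (smult (sym_proj V x) (sym_proj V y)))"
    by (simp only: sym_proj_smult lcomp_sym_proj)
  also have "\<dots> = lcomp V m (\<Sum>i\<le>a. \<Sum>j\<le>b. smult (lcomp V i x) (lcomp V j y))"
    unfolding lenle_sum[OF assms(1)] lenle_sum[OF assms(2)]
    by (simp only: lcomp_sym_proj smult_simps) (subst sum.swap, rule refl)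
  finally show ?thesis by (simp add: lcomp_simps lcomp_smult_lcomp)
qed

lemma lenle_smult: "lenle V a x \<Longrightarrow> lenle V b y \<Longrightarrow> lenle V (a + b) (smult x y)"
  unfolding lenle_def[of V "a + b"] by (auto simp: lcomp_smult intro!: sum.neutral)

text \<open>Among component lengths i up to a and j up to b, only i = a and j = b add up to a +
  b.\<close>

lemma lcomp_smult_top:
  assumes "lenle V a x" "lenle V b y"
  shows "lcomp V (a + b) (smult x y) = sym_proj V (smult (lcomp V a x) (lcomp V b y))"
proof -
  have "lcomp V (a + b) (smult x y) = (\<Sum>i\<le>a. \<Sum>j\<le>b. if i = a then if j = b then sym_proj V (smult (lcomp V a x) (lcomp V b y)) else 0 else 0)"
    unfolding lcomp_smult[OF assms] by (intro sum.cong) auto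
  also have "\<dots> = (\<Sum>i\<le>a. if i = a then sym_proj V (smult (lcomp V a x) (lcomp V b y)) else 0)"
    by (intro sum.cong) auto
  finally show ?thesis by simp
qed

lemma lenle_sgl: "length w \<le> n \<Longrightarrow> lenle V n (sgl w)"
  by (simp add: lenle_def lcomp_sgl)

lemma lenle_mono: "lenle V n x \<Longrightarrow> n \<le> m \<Longrightarrow> lenle V m x"
  by (simp add: lenle_def)

text \<open>A map that kills shorter words sees only the leading component. All leading-term
  arguments go through this lemma.\<close>

lemma linear_lenle:
  assumes h: "flin h" "\<And>x. h (sym_proj V x) = h x" and x: "lenle V n x"
    and 0: "\<And>w. \<lbrakk>valid_word V w; length w < n\<rbrakk> \<Longrightarrow> h (sgl w) = 0"
  shows "h x = h (lcomp V n x)"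
proof -
  have inv: "h (sgl w) = 0" if "\<not> valid_word V w" for w
    using h(2)[of "sgl w"] by (simp add: sym_proj_invalid[OF that] lin_simps[OF h(1)])
  have z: "h (lcomp V m x) = 0" if "m < n" for m x
    unfolding lcomp_def h(2)
    by (rule linear_ext_sgl'[OF flin_comp[OF flin_word_proj h(1)] flin_zero])
      (use 0 inv that in \<open>auto simp: lin_simps[OF h(1)]\<close>)
  have "h x = h (sym_proj V x)" by (simp add: h)
  also have "\<dots> = (\<Sum>m\<le>n. h (lcomp V m x))"
    by (simp add: lenle_sum[OF x] lin_simps[OF h(1)])
  also have "\<dots> = (\<Sum>m\<le>n. if m = n then h (lcomp V n x) else 0)"
    by (intro sum.cong) (auto simp: z)
  finally show ?thesis by simp
qed

lemma linear_lenle_0: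
  assumes h: "flin h" "\<And>x. h (sym_proj V x) = h x" and x: "lenle V n x"
    and 0: "\<And>w. \<lbrakk>valid_word V w; length w \<le> n\<rbrakk> \<Longrightarrow> h (sgl w) = 0"
  shows "h x = 0"
proof -
  have "h x = h (lcomp V (Suc n) x)"
    by (rule linear_lenle[OF h]) (use x 0 in \<open>auto intro: lenle_mono\<close>)
  also have "lcomp V (Suc n) x = 0"
    using x by (simp add: lenle_def)
  finally show ?thesis by (simp add: lin_simps[OF h(1)])
qed

lemma lenle_image:
  assumes h: "flin h" "\<And>x. h (sym_proj V x) = h x" and x: "lenle V n x"
    and le: "\<And>w. \<lbrakk>valid_word V w; length w \<le> n\<rbrakk> \<Longrightarrow> lenle W n (h (sgl w))"
  shows "lenle W n (h x)"
  unfolding lenle_def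
proof (intro allI impI)
  fix m assume "n < m"
  then show "lcomp W m (h x) = 0"
    using le by (intro linear_lenle_0[where h = "\<lambda>x. lcomp W m (h x)", OF flin_comp[OF h(1) flin_lcomp] _ x])
      (auto simp: h(2) lenle_def)
qed

text \<open>Multiplying the two factors of the coproduct scales \<open>V\<^sup>\<odot>\<^sup>m\<close> by \<open>2\<^sup>m\<close>. Applied to \<open>f w\<close> or \<open>\<alpha> w\<close>
  this expresses each component, up to the factor \<open>2\<^sup>m - 2\<close>, through shorter words.\<close>

lemma lcomp_mult_coprod: "lcomp V m (tensor_mult (coprod V x)) = fscl (2 ^ m) (lcomp V m x)"
proof (rule linear_ext_sgl'[OF flin_comp[OF flin_comp[OF flin_coprod flin_tensor_mult] flin_lcomp]
        flin_comp[OF flin_lcomp flin_scale]])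
  fix w
  have "sym_proj V (tensor_mult (coprod V (sgl w))) = spl w (\<lambda>u v. sym_proj V (sgl (u @ v)))"
    unfolding coprod_sgl spl_linear[OF flin_tensor_mult] spl_linear[OF sym_proj_props(1)] by simp
  also have "\<dots> = fscl (2 ^ length w) (sym_proj V (sgl w))"
    by (rule spl_mult[OF sym_fun_sym_proj])
  finally have *: "sym_proj V (tensor_mult (coprod V (sgl w))) = fscl (2 ^ length w) (sym_proj V (sgl w))" .
  have "lcomp V m (tensor_mult (coprod V (sgl w))) = lcomp V m (fscl (2 ^ length w) (sym_proj V (sgl w)))"
    unfolding *[symmetric] by simp
  then show "lcomp V m (tensor_mult (coprod V (sgl w))) = fscl (2 ^ m) (lcomp V m (sgl w))"
    by (simp add: lcomp_simps lcomp_sgl)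
qed

lemma coalg_morphism_lcomp:
  assumes "coalg_morphism V W f"
  shows "fscl (2 ^ m) (lcomp W m (f (sgl w))) = spl w (\<lambda>u v. lcomp W m (smult (f (sgl u)) (f (sgl v))))"
  unfolding lcomp_mult_coprod[symmetric] coalg_morphism_coprod[OF assms]
  by (simp add: spl_linear[OF flin_tensor_mult] spl_linear[OF flin_lcomp])

lemma Coder_lcomp:
  assumes "\<alpha> \<in> Coder V d"
  shows "fscl (2 ^ m) (lcomp V m (\<alpha> (sgl w))) = spl w (\<lambda>u v. lcomp V m (smult (\<alpha> (sgl u)) (sgl v)) +
     sg (d * wdeg u) (lcomp V m (smult (sgl u) (\<alpha> (sgl v)))))"
proof -
  have "fscl (2 ^ m) (lcomp V m (\<alpha> (sgl w))) = spl w (\<lambda>u v. lcomp V m (smult (\<alpha> (sgl u)) (sym_proj V (sgl v))) +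
     sg (d * wdeg u) (lcomp V m (smult (sym_proj V (sgl u)) (\<alpha> (sgl v)))))"
    using assms unfolding lcomp_mult_coprod[symmetric] Coder_iff
    by (simp add: spl_linear[OF flin_tensor_mult] spl_linear[OF flin_lcomp] lcomp_simps lin_sg[OF flin_lcomp]
        lin_simps[OF flin_tensor_mult] lin_sg[OF flin_tensor_mult])
  then show ?thesis by simp
qed

text \<open>Both elements solve the same linear equation with coefficient 2^m - 2, which vanishes in
  characteristic 0 only for m = 1, the length at which components are free.\<close>

lemma fscl_double_cancel:
  fixes x :: "'a \<Rightarrow>\<^sub>0 'k::field_char_0"
  assumes "fscl (2 ^ m) x = x + x + y" "fscl (2 ^ m) x' = x' + x' + y" "m \<noteq> 1"
  shows "x = x'"
proof -
  have ne: "(2 :: 'k) ^ m \<noteq> 2"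
  proof
    assume "(2 :: 'k) ^ m = 2"
    then have "of_nat (2 ^ m) = (of_nat 2 :: 'k)" by simp
    then have "(2::nat) ^ m = 2 ^ 1" unfolding of_nat_eq_iff by simp
    with assms(3) show False by (simp only: power_inject_exp)
  qed
  have two: "fscl 2 z = z + z" for z :: "'a \<Rightarrow>\<^sub>0 'k"
    using fs.scale_left_distrib[of 1 1 z] by simp
  have "fscl (2 ^ m - 2) (x - x') = 0"
    unfolding fs.scale_left_diff_distrib fs.scale_right_diff_distrib assms(1,2) two by simp
  then show ?thesis using ne by simp
qed

lemma smult_Nil: "sym_proj V (smult x (sgl [])) = sym_proj V x" "sym_proj V (smult (sgl []) x) = sym_proj V x"
proof -
  show "sym_proj V (smult x (sgl [])) = sym_proj V x"
    by (rule linear_ext_sgl'[OF flin_comp[OF flin_smult(1) sym_proj_props(1)] sym_proj_props(1)]) simp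
  show "sym_proj V (smult (sgl []) x) = sym_proj V x"
    by (rule linear_ext_sgl'[OF flin_comp[OF flin_smult(2) sym_proj_props(1)] sym_proj_props(1)]) simp
qed

lemma lcomp_smult_Nil [simp]:
  "lcomp V m (smult x (sgl [])) = lcomp V m x" "lcomp V m (smult (sgl []) x) = lcomp V m x"
  using arg_cong[OF smult_Nil(1)[of V x], of "lcomp V m"] arg_cong[OF smult_Nil(2)[of V x], of "lcomp V m"]
  by (simp_all only: lcomp_sym_proj)


subsection \<open>Homogeneous elements of word length one\<close>

text \<open>The degree m part of V as it sits inside the symmetric coalgebra. It lets the tangent
  complex be treated with linear maps of the coalgebra.\<close>

definition letters :: "('k::field, 'v::ab_group_add) graded_space \<Rightarrow> int \<Rightarrow> ('k, 'v) free set" where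
  "letters V m = (\<lambda>v. sym_proj V (sgl [(m, v)])) ` part V m"

lemma sym_proj_letter_linear:
  assumes "x \<in> part V m" "y \<in> part V m"
  shows "sym_proj V (sgl [(m, scl V a x + scl V b y)]) =
    fscl a (sym_proj V (sgl [(m, x)])) + fscl b (sym_proj V (sgl [(m, y)]))"
  using sym_funD(2)[OF sym_fun_sym_proj[of V], OF assms, of "[]" a b "[]"] by simp

context
  fixes V :: "('k::field, 'v::ab_group_add) graded_space"
  assumes gvs: "graded_vector_space V"
begin

lemma vector_space_scl: "vector_space (scl V)"
  using gvs by (simp add: graded_vector_space_def)

lemma subspace_part: "module.subspace (scl V) (part V n)"
  using gvs by (simp add: graded_vector_space_def)

interpretation vs: vector_space "scl V"
  by (rule vector_space_scl)

lemma subspace_letters: "fs.subspace (letters V m)"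
proof (rule fs.subspaceI)
  note sub = subspace_part[of m]
  have 0: "0 \<in> part V m" by (rule vs.subspace_0[OF sub])
  have "sym_proj V (sgl [(m, 0)]) = 0"
    using sym_proj_letter_linear[OF 0 0, of 0 0] by simp
  then show "0 \<in> letters V m"
    unfolding letters_def by (intro image_eqI[OF _ 0]) (rule sym)
  fix x assume "x \<in> letters V m"
  then obtain v where v: "v \<in> part V m" "x = sym_proj V (sgl [(m, v)])"
    unfolding letters_def by blast
  have "fscl c x = sym_proj V (sgl [(m, scl V c v)])" for c
    using sym_proj_letter_linear[OF v(1) 0, of c 0] by (simp add: v(2))
  then show "fscl c x \<in> letters V m" for c
    unfolding letters_def by (rule image_eqI[OF _ vs.subspace_scale[OF sub v(1)]])
  fix y assume "y \<in> letters V m"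
  then obtain u where u: "u \<in> part V m" "y = sym_proj V (sgl [(m, u)])"
    unfolding letters_def by blast
  have "x + y = sym_proj V (sgl [(m, v + u)])"
    using sym_proj_letter_linear[OF v(1) u(1), of 1 1] by (simp add: v(2) u(2))
  then show "x + y \<in> letters V m"
    unfolding letters_def by (rule image_eqI[OF _ vs.subspace_add[OF sub v(1) u(1)]])
qed

lemma length_one_word: "length w = 1 \<longleftrightarrow> (\<exists>n v. w = [(n, v)])"
  by (cases w) auto

lemma letters_iff: "x \<in> letters V m \<longleftrightarrow> sym_proj V (word_proj (\<lambda>w. length w = 1 \<and> wdeg w = m) x) = x"
proof
  assume "x \<in> letters V m"
  then obtain v where v: "v \<in> part V m" "x = sym_proj V (sgl [(m, v)])" by (auto simp: letters_def)
  have "label_pred (\<lambda>w::'v word. length w = 1 \<and> wdeg w = m)" by (intro label_predI)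
  then show "sym_proj V (word_proj (\<lambda>w. length w = 1 \<and> wdeg w = m) x) = x"
    by (simp add: v sym_proj_word_proj)
next
  assume *: "sym_proj V (word_proj (\<lambda>w. length w = 1 \<and> wdeg w = m) x) = x"
  have "sym_proj V (word_proj (\<lambda>w. length w = 1 \<and> wdeg w = m) x) \<in> letters V m"
  proof (rule word_proj_in_span[OF _ subspace_letters])
    fix w :: "'v word" assume "length w = 1 \<and> wdeg w = m" "valid_word V w"
    then show "sym_proj V (sgl w) \<in> letters V m"
      unfolding length_one_word letters_def by auto
  qed
  then show "x \<in> letters V m" by (simp only: *)
qed

lemma lettersI:
  assumes "x \<in> sym_degree V m" "\<And>k. k \<noteq> 1 \<Longrightarrow> lcomp V k x = 0"
  shows "x \<in> letters V m"
proof -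
  let ?p = "word_proj (\<lambda>w. wdeg w = m)"
  have x: "sym_proj V (?p x) = x" using assms(1) by (simp add: sym_degree_iff)
  have Px: "sym_proj V x = x" by (metis x sym_proj_props(2))
  have "x = lcomp V 1 x"
    using lcomp_only[of 1 V x] assms(2) Px by simp
  also have "\<dots> = lcomp V 1 (sym_proj V (?p x))" by (simp only: x)
  also have "\<dots> = sym_proj V (word_proj (\<lambda>w. length w = 1 \<and> wdeg w = m) x)"
    unfolding lcomp_def sym_proj_word_proj[OF label_predI(2)] word_proj_word_proj ..
  finally show ?thesis unfolding letters_iff ..
qed

end

lemma lettersE:
  assumes "x \<in> letters V m"
  obtains v where "v \<in> part V m" "x = sym_proj V (sgl [(m, v)])"
  using assms by (auto simp: letters_def)

lemma letters_degree: "x \<in> letters V m \<Longrightarrow> x \<in> sym_degree V m"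
  using sym_proj_sgl_in_degree[of V "[(m, _)]"] by (auto simp: letters_def)

lemma letters_sym_proj: "x \<in> letters V m \<Longrightarrow> sym_proj V x = x"
  by (auto simp: letters_def)

lemma letters_lcomp: "x \<in> letters V m \<Longrightarrow> lcomp V k x = (if k = 1 then x else 0)"
  by (auto simp: letters_def lcomp_sgl)

subsection \<open>Coalgebra morphisms and coderivations on short words\<close>

lemma fscl_double_zero:
  fixes x :: "'a \<Rightarrow>\<^sub>0 'k::field_char_0"
  assumes "fscl (2 ^ m) x = x + x" "m \<noteq> 1"
  shows "x = 0"
  by (rule fscl_double_cancel[of m x 0 0]) (use assms in simp_all)

lemma coalg_morphism_Nil:
  assumes "coalg_morphism V W f"
  shows "f (sgl []) = sym_proj W (sgl [])"
proof -
  have "f (sym_proj V (sgl [])) = sym_proj W (sgl [])"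
    using assms unfolding coalg_morphism_def smono_def by blast
  then show ?thesis by (simp only: sym_homD(2)[OF coalg_morphism_hom[OF assms]])
qed

text \<open>As f preserves the unit, each of the two trivial splittings contributes f w
  itself.\<close>

lemma coalg_morphism_lcomp_nonempty:
  assumes "coalg_morphism V W f" "w \<noteq> []"
  shows "fscl (2 ^ m) (lcomp W m (f (sgl w))) = lcomp W m (f (sgl w)) + lcomp W m (f (sgl w)) +
    spl w (\<lambda>u v. if u = [] \<or> v = [] then 0 else lcomp W m (smult (f (sgl u)) (f (sgl v))))"
  unfolding coalg_morphism_lcomp[OF assms(1)]
  by (subst spl_nonempty[OF assms(2)]) (simp add: coalg_morphism_Nil[OF assms(1)])

lemma spl_zero_cong:
  assumes "\<And>u v. \<lbrakk>length u + length v = length w; wdeg u + wdeg v = wdeg w; set u \<union> set v = set w\<rbrakk>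
     \<Longrightarrow> F u v = 0"
  shows "spl w F = 0"
  by (rule trans[OF spl_cong spl_zero]) (rule assms)

text \<open>For m above the length of w, all nontrivial splittings contribute 0 by induction,
  leaving 2^m x = 2 x for the component x.\<close>

lemma coalg_morphism_lenle:
  fixes f :: "('k::field_char_0, 'v::ab_group_add) free \<Rightarrow> ('k, 'w::ab_group_add) free"
  assumes f: "coalg_morphism V W f"
  shows "lenle W (length w) (f (sgl w))"
proof (induction "length w" arbitrary: w rule: less_induct)
  case less
  show ?case
  proof (cases "w = []")
    case True
    then show ?thesis by (simp add: coalg_morphism_Nil[OF f] lenle_def lcomp_sgl)
  next
    case False
    show ?thesis
      unfolding lenle_def
    proof (intro allI impI)
      fix m assume m: "length w < m"
      then have m1: "m \<noteq> 1" using False by (cases w) auto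
      have "lcomp W m (smult (f (sgl u)) (f (sgl v))) = 0"
        if "length u + length v = length w" "u \<noteq> []" "v \<noteq> []" for u v
      proof -
        have "length u < length w" "length v < length w"
          using that by (cases u; cases v; simp)+
        then have "lenle W (length u + length v) (smult (f (sgl u)) (f (sgl v)))"
          by (intro lenle_smult less)
        then show ?thesis using m that by (simp add: lenle_def)
      qed
      then have "spl w (\<lambda>u v. if u = [] \<or> v = [] then 0 else lcomp W m (smult (f (sgl u)) (f (sgl v)))) = 0"
        by (intro spl_zero_cong) simp
      with coalg_morphism_lcomp_nonempty[OF f False, of m] show "lcomp W m (f (sgl w)) = 0"
        using m1 by (intro fscl_double_zero[where m = m]) simp_all
    qed
  qed
qed

text \<open>A single letter has no nontrivial splitting, so every component of length other than 1
  satisfies 2^k x = 2 x.\<close>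

lemma coalg_morphism_letter:
  fixes f :: "('k::field_char_0, 'v::ab_group_add) free \<Rightarrow> ('k, 'w::ab_group_add) free"
  assumes f: "coalg_morphism V W f" and W: "graded_vector_space W"
  shows "f (sgl [(n, v)]) \<in> letters W n"
proof (rule lettersI[OF W])
  show "f (sgl [(n, v)]) \<in> sym_degree W n"
    using sym_homD(5)[OF coalg_morphism_hom[OF f], of "[(n, v)]"] by simp
  fix k :: nat assume "k \<noteq> 1"
  then show "lcomp W k (f (sgl [(n, v)])) = 0"
    using coalg_morphism_lcomp_nonempty[OF f, of "[(n, v)]" k]
    by (intro fscl_double_zero[where m = k]) simp_all
qed

lemma coalg_morphism_letters:
  fixes f :: "('k::field_char_0, 'v::ab_group_add) free \<Rightarrow> ('k, 'w::ab_group_add) free"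
  assumes f: "coalg_morphism V W f" and W: "graded_vector_space W" and "x \<in> letters V n"
  shows "f x \<in> letters W n"
  using assms(3) coalg_morphism_letter[OF f W] sym_homD(2)[OF coalg_morphism_hom[OF f]]
  by (auto simp: letters_def[of V])

lemma coalg_morphism_lenle_image:
  fixes f :: "('k::field_char_0, 'v::ab_group_add) free \<Rightarrow> ('k, 'w::ab_group_add) free"
  assumes f: "coalg_morphism V W f" and x: "lenle V n x"
  shows "lenle W n (f x)"
  by (rule lenle_image[OF sym_homD(1,2)[OF coalg_morphism_hom[OF f]] x]) (rule lenle_mono[OF coalg_morphism_lenle[OF f]])

lemma spl_map:
  assumes "\<And>a. fst (h a) = fst a"
  shows "spl (map h w) F = spl w (\<lambda>u v. F (map h u) (map h v))"
proof -
  have "wdeg (map h u) = wdeg u" for u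
    by (induction u) (auto simp: assms)
  then show ?thesis
    by (induction w arbitrary: F) (simp_all add: assms)
qed

lemma spl_mult_nonempty:
  assumes "w \<noteq> []" "sym_fun V fscl F"
  shows "fscl (2 ^ length w) (F w) = F w + F w + spl w (\<lambda>u v. if u = [] \<or> v = [] then 0 else F (u @ v))"
  unfolding spl_mult[OF assms(2), symmetric] by (subst spl_nonempty[OF assms(1)]) simp

text \<open>The leading component is the symmetric power of the linear part, here given letterwise
  by h: both satisfy the same recursion over splittings and agree on letters.\<close>

lemma coalg_morphism_leading:
  fixes f :: "('k::field_char_0, 'v::ab_group_add) free \<Rightarrow> ('k, 'w::ab_group_add) free"
  assumes f: "coalg_morphism V W f" and W: "graded_vector_space W"
    and h: "\<And>a. fst (h a) = fst a" and w: "\<And>a. a \<in> set w \<Longrightarrow> f (sgl [a]) = sym_proj W (sgl [h a])"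
  shows "lcomp W (length w) (f (sgl w)) = sym_proj W (sgl (map h w))"
  using w
proof (induction "length w" arbitrary: w rule: less_induct)
  case less
  consider "w = []" | a where "w = [a]" | "w \<noteq> []" "length w \<noteq> 1" by (cases w) auto
  then show ?case
  proof cases
    case 1
    then show ?thesis by (simp add: coalg_morphism_Nil[OF f] lcomp_sgl)
  next
    case (2 a)
    have "f (sgl [a]) \<in> letters W (fst a)"
      using coalg_morphism_letter[OF f W, of "fst a" "snd a"] by simp
    then show ?thesis using 2 less.prems by (simp add: lcomp_sgl)
  next
    case 3
    let ?G = "\<lambda>u v. if u = [] \<or> v = [] then 0 else sym_proj W (sgl (map h u @ map h v))"
    have 1: "fscl (2 ^ length w) (lcomp W (length w) (f (sgl w))) =
        lcomp W (length w) (f (sgl w)) + lcomp W (length w) (f (sgl w)) + spl w ?G"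
      unfolding coalg_morphism_lcomp_nonempty[OF f 3(1)]
    proof (intro arg_cong2[where f = "(+)"] refl spl_cong)
      fix u v assume *: "length u + length v = length w" "set u \<union> set v = set w"
      have "lcomp W (length w) (smult (f (sgl u)) (f (sgl v))) = sym_proj W (sgl (map h u @ map h v))"
        if "u \<noteq> []" "v \<noteq> []"
      proof -
        have "length u < length w" "length v < length w" "set u \<subseteq> set w" "set v \<subseteq> set w"
          using that * by (cases u; cases v; auto)+
        then have IH: "lcomp W (length u) (f (sgl u)) = sym_proj W (sgl (map h u))"
          "lcomp W (length v) (f (sgl v)) = sym_proj W (sgl (map h v))"
          using less.prems by (intro less.hyps; blast)+
        show ?thesis
          unfolding *(1)[symmetric] lcomp_smult_top[OF coalg_morphism_lenle[OF f] coalg_morphism_lenle[OF f]] IH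
          by simp
      qed
      then show "(if u = [] \<or> v = [] then 0 else lcomp W (length w) (smult (f (sgl u)) (f (sgl v)))) = ?G u v"
        by simp
    qed
    have 2: "fscl (2 ^ length w) (sym_proj W (sgl (map h w))) =
        sym_proj W (sgl (map h w)) + sym_proj W (sgl (map h w)) + spl w ?G"
      using spl_mult_nonempty[of "map h w", OF _ sym_fun_sym_proj[of W]] 3(1) by (simp add: spl_map[OF h])
    show ?thesis by (rule fscl_double_cancel[OF 1 2 3(2)])
  qed
qed

lemma Coder_lcomp_nonempty:
  assumes "\<alpha> \<in> Coder V d" "w \<noteq> []" "\<alpha> (sgl []) = 0"
  shows "fscl (2 ^ m) (lcomp V m (\<alpha> (sgl w))) = lcomp V m (\<alpha> (sgl w)) + lcomp V m (\<alpha> (sgl w)) +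
    spl w (\<lambda>u v. if u = [] \<or> v = [] then 0 else lcomp V m (smult (\<alpha> (sgl u)) (sgl v)) +
     sg (d * wdeg u) (lcomp V m (smult (sgl u) (\<alpha> (sgl v)))))"
  unfolding Coder_lcomp[OF assms(1)]
  by (subst spl_nonempty[OF assms(2)]) (simp add: assms(3) smult_simps lcomp_simps)

lemma Coder_lenle:
  fixes \<alpha> :: "('k::field_char_0, 'v::ab_group_add) endo"
  assumes a: "\<alpha> \<in> Coder V d" and Nil: "\<alpha> (sgl []) = 0"
  shows "lenle V (length w) (\<alpha> (sgl w))"
proof (induction "length w" arbitrary: w rule: less_induct)
  case less
  show ?case
  proof (cases "w = []")
    case True
    then show ?thesis by (simp add: Nil lenle_def lcomp_simps)
  next
    case False
    show ?thesis
      unfolding lenle_def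
    proof (intro allI impI)
      fix m assume m: "length w < m"
      then have m1: "m \<noteq> 1" using False by (cases w) auto
      have "lcomp V m (smult (\<alpha> (sgl u)) (sgl v)) = 0 \<and> lcomp V m (smult (sgl u) (\<alpha> (sgl v))) = 0"
        if "length u + length v = length w" "u \<noteq> []" "v \<noteq> []" for u v
      proof -
        have "length u < length w" "length v < length w"
          using that by (cases u; cases v; simp)+
        then have "lenle V (length u + length v) (smult (\<alpha> (sgl u)) (sgl v))"
          "lenle V (length u + length v) (smult (sgl u) (\<alpha> (sgl v)))"
          by (simp_all add: lenle_smult less lenle_sgl)
        then show ?thesis using m that by (simp add: lenle_def)
      qed
      then have "spl w (\<lambda>u v. if u = [] \<or> v = [] then 0 else lcomp V m (smult (\<alpha> (sgl u)) (sgl v)) +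
         sg (d * wdeg u) (lcomp V m (smult (sgl u) (\<alpha> (sgl v))))) = 0"
        by (intro spl_zero_cong) simp
      with Coder_lcomp_nonempty[OF a False Nil, of m] show "lcomp V m (\<alpha> (sgl w)) = 0"
        using m1 by (intro fscl_double_zero[where m = m]) simp_all
    qed
  qed
qed

lemma Coder_lenle_image:
  fixes \<alpha> :: "('k::field_char_0, 'v::ab_group_add) endo"
  assumes a: "\<alpha> \<in> Coder V d" and Nil: "\<alpha> (sgl []) = 0" and x: "lenle V n x"
  shows "lenle V n (\<alpha> x)"
  by (rule lenle_image[OF sym_homD(1,2)[OF Coder_hom[OF a]] x]) (rule lenle_mono[OF Coder_lenle[OF a Nil]])

text \<open>A nontrivial splitting of w has only shorter halves, on which \<alpha> vanishes; so
  components of length k \<noteq> 1 satisfy 2^k x = 2 x. The empty word obeys the same equation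
  because both of its terms are \<alpha> 1.\<close>

lemma Coder_letters:
  fixes \<alpha> :: "('k::field_char_0, 'v::ab_group_add) endo"
  assumes a: "\<alpha> \<in> Coder V d" and V: "graded_vector_space V"
    and 0: "\<And>u. \<lbrakk>valid_word V u; length u < length w\<rbrakk> \<Longrightarrow> \<alpha> (sgl u) = 0"
  shows "\<alpha> (sgl w) \<in> letters V (wdeg w + d)"
proof (rule lettersI[OF V])
  show "\<alpha> (sgl w) \<in> sym_degree V (wdeg w + d)"
    by (rule sym_homD(5)[OF Coder_hom[OF a]])
  fix k :: nat assume k: "k \<noteq> 1"
  have z: "\<alpha> (sgl u) = 0" if "length u < length w" for u
    using 0[OF _ that] sym_homD(6)[OF Coder_hom[OF a]] by blast
  show "lcomp V k (\<alpha> (sgl w)) = 0"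
  proof (cases "w = []")
    case True
    show ?thesis
      using Coder_lcomp[OF a, of k w] k True by (intro fscl_double_zero[where m = k]) simp_all
  next
    case False
    have "spl w (\<lambda>u v. if u = [] \<or> v = [] then 0 else lcomp V k (smult (\<alpha> (sgl u)) (sgl v)) +
         sg (d * wdeg u) (lcomp V k (smult (sgl u) (\<alpha> (sgl v))))) = 0"
    proof (rule spl_zero_cong)
      fix u v :: "'v word" assume "length u + length v = length w"
      then show "(if u = [] \<or> v = [] then 0 else lcomp V k (smult (\<alpha> (sgl u)) (sgl v)) +
         sg (d * wdeg u) (lcomp V k (smult (sgl u) (\<alpha> (sgl v))))) = 0"
        using z[of u] z[of v] by (cases "u = [] \<or> v = []") (auto simp: smult_simps lcomp_simps simp flip: length_greater_0_conv)
    qed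
    with Coder_lcomp_nonempty[OF a False, of k] k z[of "[]"] False show ?thesis
      by (intro fscl_double_zero[where m = k]) simp_all
  qed
qed

text \<open>A coderivation acts on leading terms as a derivation, so eigenvalues on letters add up.
  The condition on d admits two uses: the homotopy operator E of degree 0, and the minimal
  differential, which is odd but has zero linear part.\<close>

lemma Coder_leading:
  fixes \<alpha> :: "('k::field_char_0, 'v::ab_group_add) endo"
  assumes a: "\<alpha> \<in> Coder V d" and Nil: "\<alpha> (sgl []) = 0"
    and d: "even d \<or> (\<forall>a. c a = 0)"
    and w: "\<And>a. a \<in> set w \<Longrightarrow> \<alpha> (sgl [a]) = fscl (c a) (sym_proj V (sgl [a]))"
  shows "lcomp V (length w) (\<alpha> (sgl w)) = fscl (sum_list (map c w)) (sym_proj V (sgl w))"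
  using w
proof (induction "length w" arbitrary: w rule: less_induct)
  case less
  consider "w = []" | a where "w = [a]" | "w \<noteq> []" "length w \<noteq> 1" by (cases w) auto
  then show ?case
  proof cases
    case 1
    then show ?thesis by (simp add: Nil lcomp_simps)
  next
    case (2 a)
    then show ?thesis using less.prems by (simp add: lcomp_simps lcomp_sgl)
  next
    case 3
    let ?c = "\<lambda>w. sum_list (map c w)"
    let ?G = "\<lambda>u v. fscl (?c w) (if u = [] \<or> v = [] then 0 else sym_proj V (sgl (u @ v)))"
    have 1: "fscl (2 ^ length w) (lcomp V (length w) (\<alpha> (sgl w))) =
        lcomp V (length w) (\<alpha> (sgl w)) + lcomp V (length w) (\<alpha> (sgl w)) + spl w ?G"
      unfolding Coder_lcomp_nonempty[OF a 3(1) Nil]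
    \<comment> \<open>The sum of eigenvalues counts repeated letters, so the multiset form of the
      congruence rule is required here.\<close>
    proof (intro arg_cong2[where f = "(+)"] refl spl_cong_mset)
      fix u v assume m: "mset u + mset v = mset w"
      have len: "length u + length v = length w"
        using arg_cong[OF m, of size] by simp
      have set: "set u \<union> set v = set w"
        using arg_cong[OF m, of set_mset] by simp
      have c: "?c w = ?c u + ?c v"
      proof -
        have sm: "?c x = sum_mset (image_mset c (mset x))" for x
          by (simp add: sum_mset_sum_list flip: mset_map)
        show ?thesis unfolding sm m[symmetric] by simp
      qed
      have "lcomp V (length w) (smult (\<alpha> (sgl u)) (sgl v)) + sg (d * wdeg u) (lcomp V (length w) (smult (sgl u) (\<alpha> (sgl v)))) =
          fscl (?c w) (sym_proj V (sgl (u @ v)))" if "u \<noteq> []" "v \<noteq> []"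
      proof -
        have "length u < length w" "length v < length w" "set u \<subseteq> set w" "set v \<subseteq> set w"
          using that len set by (cases u; cases v; auto)+
        then have IH: "lcomp V (length u) (\<alpha> (sgl u)) = fscl (?c u) (sym_proj V (sgl u))"
          "lcomp V (length v) (\<alpha> (sgl v)) = fscl (?c v) (sym_proj V (sgl v))"
          using less.prems by (intro less.hyps; blast)+
        have "lcomp V (length w) (smult (\<alpha> (sgl u)) (sgl v)) = fscl (?c u) (sym_proj V (sgl (u @ v)))"
          unfolding len[symmetric] lcomp_smult_top[OF Coder_lenle[OF a Nil] lenle_sgl[OF order_refl]] IH
          by (simp add: lcomp_sgl smult_simps)
        moreover have "lcomp V (length w) (smult (sgl u) (\<alpha> (sgl v))) = fscl (?c v) (sym_proj V (sgl (u @ v)))"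
          unfolding len[symmetric] lcomp_smult_top[OF lenle_sgl[OF order_refl] Coder_lenle[OF a Nil]] IH
          by (simp add: lcomp_sgl smult_simps)
        \<comment> \<open>For odd d all eigenvalues vanish, so the sign acts on 0.\<close>
        moreover have "sg (d * wdeg u) (fscl (?c v) z) = fscl (?c v) z" for z :: "('k, 'v) free"
        proof (cases "even d")
          case False
          with d have "c a = 0" for a by blast
          then have "?c v = 0" by (induction v) simp_all
          then show ?thesis by simp
        qed (simp add: sg_def)
        ultimately show ?thesis by (simp add: c fs.scale_left_distrib)
      qed
      then show "(if u = [] \<or> v = [] then 0 else lcomp V (length w) (smult (\<alpha> (sgl u)) (sgl v)) +
          sg (d * wdeg u) (lcomp V (length w) (smult (sgl u) (\<alpha> (sgl v))))) = ?G u v"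
        by simp
    qed
    have 2: "fscl (2 ^ length w) (fscl (?c w) (sym_proj V (sgl w))) =
        fscl (?c w) (sym_proj V (sgl w)) + fscl (?c w) (sym_proj V (sgl w)) + spl w ?G"
      using arg_cong[OF spl_mult_nonempty[OF 3(1) sym_fun_sym_proj[of V]], of "fscl (?c w)"]
      by (simp only: spl_fscl fs.scale_right_distrib fs.scale_scale mult.commute)
    show ?thesis by (rule fscl_double_cancel[OF 1 2 3(2)])
  qed
qed

lemma CE_filt_iff:
  assumes a: "\<alpha> \<in> sym_hom V V d"
  shows "\<alpha> \<in> CE_filt V p \<longleftrightarrow> (\<forall>w. valid_word V w \<longrightarrow> int (length w) < p \<longrightarrow> \<alpha> (sgl w) = 0)"
proof (intro iffI allI impI)
  fix w assume "\<alpha> \<in> CE_filt V p" "valid_word V w" "int (length w) < p"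
  moreover from this have "smono V w \<in> sym_power V (length w)"
    unfolding sym_power_def by (intro fs.span_base) blast
  ultimately have "\<alpha> (smono V w) = 0"
    unfolding CE_filt_def by blast
  then show "\<alpha> (sgl w) = 0" by (simp add: smono_def sym_homD(2)[OF a])
next
  assume *: "\<forall>w. valid_word V w \<longrightarrow> int (length w) < p \<longrightarrow> \<alpha> (sgl w) = 0"
  have "\<alpha> x = 0" if "int i < p" "x \<in> sym_power V i" for i x
    using that(2) unfolding sym_power_def
  proof (induction rule: fs.span_induct)
    case base
    show ?case by (simp add: fs.subspace_def lin_simps[OF sym_homD(1)[OF a]])
  next
    case (step x)
    then show ?case using * that(1) by (auto simp: smono_def sym_homD(2)[OF a])
  qed
  then show "\<alpha> \<in> CE_filt V p" unfolding CE_filt_def by blast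
qed


subsection \<open>Extension to coderivations\<close>

text \<open>A letter is primitive, so it joins one of the two halves of a splitting of v. Writing z
  as a truncation of an arbitrary x makes the claim linear in x and reduces it to one
  letter.\<close>

lemma coprod_letter_smult:
  assumes "z = word_proj (\<lambda>w. length w = 1 \<and> wdeg w = m) x"
  shows "coprod V (smult z (sgl v)) = spl v (\<lambda>v1 v2. tensor (sym_proj V (smult z (sgl v1))) (sym_proj V (sgl v2)) +
     sg (m * wdeg v1) (tensor (sym_proj V (sgl v1)) (sym_proj V (smult z (sgl v2)))))"
proof -
  let ?p = "word_proj (\<lambda>w::'a word. length w = 1 \<and> wdeg w = m)"
  let ?R = "\<lambda>z. spl v (\<lambda>v1 v2. tensor (sym_proj V (smult z (sgl v1))) (sym_proj V (sgl v2)) +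
     sg (m * wdeg v1) (tensor (sym_proj V (sgl v1)) (sym_proj V (smult z (sgl v2)))))"
  have "coprod V (smult (?p x) (sgl v)) = ?R (?p x)"
  proof (rule linear_ext_sgl'[of fscl "\<lambda>x. coprod V (smult (?p x) (sgl v))" "\<lambda>x. ?R (?p x)"])
    show "flin (\<lambda>x. coprod V (smult (?p x) (sgl v)))"
      by (intro flin_comp[OF flin_comp[OF flin_word_proj flin_smult(1)] flin_coprod])
    show "flin (\<lambda>x. ?R (?p x))"
    proof (rule flin_comp[OF flin_word_proj, where g = ?R], rule flinI)
      show "?R (x + y) = ?R x + ?R y" for x y
        unfolding spl_add[symmetric] by (intro spl_cong) (simp add: smult_simps tensor_simps sg_add)
      show "?R (fscl c x) = fscl c (?R x)" for c x
        unfolding spl_fscl[symmetric] by (intro spl_cong) (simp add: smult_simps tensor_simps sg_fscl fs.scale_right_distrib)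
    qed
    fix w :: "'a word"
    show "coprod V (smult (?p (sgl w)) (sgl v)) = ?R (?p (sgl w))"
    proof (cases "length w = 1 \<and> wdeg w = m")
      case True
      then obtain a where w: "w = [a]" "fst a = m" by (cases w) auto
      then show ?thesis by (simp add: coprod_sgl spl_add)
    next
      case False
      then have z: "?p (sgl w) = 0" by (simp only: word_proj_sgl if_False)
      show ?thesis unfolding z by (simp add: smult_simps lin_simps[OF flin_coprod] spl_zero)
    qed
  qed
  then show ?thesis by (simp only: assms)
qed

text \<open>The coderivation is the convolution of \<open>\<phi>\<close>, the part of \<open>\<psi>\<close> on words of length \<open>p\<close>, with the identity.\<close>

lemma Coder_extension:
  fixes \<psi> :: "('k::field_char_0, 'v::ab_group_add) endo"
  assumes lin: "flin \<psi>" and P: "\<And>x. \<psi> (sym_proj V x) = \<psi> x"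
    and letters: "\<And>w. \<lbrakk>valid_word V w; length w = p\<rbrakk> \<Longrightarrow> \<psi> (sgl w) \<in> letters V (wdeg w + d)"
    and V: "graded_vector_space V"
  shows "\<exists>\<beta>\<in>Coder V d. (\<forall>w. length w < p \<longrightarrow> \<beta> (sgl w) = 0) \<and> (\<forall>w. length w = p \<longrightarrow> \<beta> (sgl w) = \<psi> (sgl w))"
proof -
  \<comment> \<open>The truncation picks an unprojected representative supported on one-letter
    words, as \<open>coprod_letter_smult\<close> requires; by the hypothesis on letters, projecting
    it gives \<psi> back.\<close>
  define \<phi> where "\<phi> w = word_proj (\<lambda>u. length u = 1 \<and> wdeg u = wdeg w + d) (if length w = p then \<psi> (sgl w) else 0)" for w
  define F where "F u v = sym_proj V (smult (\<phi> u) (sgl v))" for u v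
  define \<beta> where "\<beta> = linext fscl (\<lambda>w. spl w F)"
  have inv: "\<psi> (sgl w) = 0" if "\<not> valid_word V w" for w
    using P[of "sgl w"] by (simp add: sym_proj_invalid[OF that] lin_simps[OF lin])
  have P\<phi>: "sym_proj V (\<phi> w) = (if length w = p then \<psi> (sgl w) else 0)" for w
  proof (cases "length w = p \<and> valid_word V w")
    case True
    then show ?thesis
      using letters[of w] by (simp add: \<phi>_def letters_iff[OF V] del: length_greater_0_conv)
  next
    case False
    then have "(if length w = p then \<psi> (sgl w) else 0) = 0" using inv by auto
    then show ?thesis by (simp only: \<phi>_def word_proj_simps sym_proj_simps)
  qed
  have sym\<phi>: "sym_fun V fscl (\<lambda>w. sym_proj V (\<phi> w))"
    unfolding P\<phi> by (intro sym_fun_if sym_fun_linear[OF lin P] label_predI)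
  have F1: "sym_fun V fscl (\<lambda>u. F u v)" for v
    using sym_fun_compose[OF sym\<phi> flin_comp[OF flin_smult(1)[of "sgl v"] sym_proj_props(1)[of V]]]
    by (simp add: F_def)
  have F2: "sym_fun V fscl (F u)" for u
    unfolding F_def
    by (rule sym_fun_linear[OF flin_comp[OF flin_smult(2) sym_proj_props(1)]]) simp
  have lin\<beta>: "flin \<beta>" by (simp add: \<beta>_def)
  have \<beta>: "\<beta> (sgl w) = spl w F" for w by (simp add: \<beta>_def)
  have P\<beta>: "\<beta> (sym_proj V x) = \<beta> x" for x
    by (rule linear_sym_proj[OF lin\<beta>]) (unfold \<beta>, rule sym_fun_spl[OF F1 F2])
  have deg: "F u v \<in> sym_degree V (wdeg u + wdeg v + d)" for u v
  proof -
    have "sym_proj V (smult (word_proj (\<lambda>a. length a = 1 \<and> wdeg a = wdeg u + d) x) (sgl v)) \<in> sym_degree V (wdeg u + wdeg v + d)" (is "?h x \<in> _") for x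
    proof -
      have "sym_proj V (word_proj (\<lambda>w. wdeg w = wdeg u + wdeg v + d) (?h x)) = ?h x"
        unfolding sym_proj_word_proj[OF label_predI(1)]
        by (rule linear_ext_sgl'[of fscl])
          (auto intro!: flin_comp[OF _ sym_proj_props(1)] flin_comp[OF _ flin_word_proj] flin_comp[OF flin_word_proj flin_smult(1)]
            simp: smult_simps word_proj_simps)
      then show ?thesis by (simp only: sym_degree_iff)
    qed
    then show ?thesis by (simp only: F_def \<phi>_def)
  qed
  have hom: "\<beta> \<in> sym_hom V V d"
  proof (rule sym_homI[OF lin\<beta> P\<beta>])
    fix w
    have "sym_proj V (word_proj (\<lambda>x. wdeg x = wdeg w + d) (spl w F)) = spl w (\<lambda>u v. sym_proj V (word_proj (\<lambda>x. wdeg x = wdeg w + d) (F u v)))"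
      by (simp only: spl_linear[OF flin_word_proj] spl_linear[OF sym_proj_props(1)])
    also have "\<dots> = spl w F"
      using deg by (intro spl_cong) (metis sym_degree_iff)
    finally show "\<beta> (sgl w) \<in> sym_degree V (wdeg w + d)"
      by (simp add: \<beta> sym_degree_iff)
  qed
  have coprodF: "coprod V (F u v) = spl v (\<lambda>v1 v2. tensor (F u v1) (sym_proj V (sgl v2)) +
     sg ((wdeg u + d) * wdeg v1) (tensor (sym_proj V (sgl v1)) (F u v2)))" for u v
    unfolding F_def coprod_sym_proj by (rule coprod_letter_smult[OF \<phi>_def])
  have "coprod V (\<beta> (sgl w)) = spl w (\<lambda>u v. tensor (\<beta> (sgl u)) (sym_proj V (sgl v)) +
       sg (d * wdeg u) (tensor (sym_proj V (sgl u)) (\<beta> (sgl v))))" for w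
  proof -
    have "coprod V (\<beta> (sgl w)) = spl w (\<lambda>u y. spl y (\<lambda>v1 v2. tensor (F u v1) (sym_proj V (sgl v2)))) +
       spl w (\<lambda>u y. spl y (\<lambda>v1 v2. sg ((wdeg u + d) * wdeg v1) (tensor (sym_proj V (sgl v1)) (F u v2))))"
      unfolding \<beta> spl_linear[OF flin_coprod] coprodF spl_add ..
    also have "spl w (\<lambda>u y. spl y (\<lambda>v1 v2. tensor (F u v1) (sym_proj V (sgl v2)))) =
        spl w (\<lambda>x v. tensor (spl x F) (sym_proj V (sgl v)))"
      unfolding spl_coassoc[symmetric] spl_linear[OF flin_tensor(1)] ..
    also have "spl w (\<lambda>u y. spl y (\<lambda>v1 v2. sg ((wdeg u + d) * wdeg v1) (tensor (sym_proj V (sgl v1)) (F u v2)))) =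
        spl w (\<lambda>x v2. spl x (\<lambda>u v1. sg ((wdeg u + d) * wdeg v1) (tensor (sym_proj V (sgl v1)) (F u v2))))"
      unfolding spl_coassoc ..
    \<comment> \<open>Cocommutativity puts v1 in front of u. Its sign cancels the part
      \<open>wdeg u * wdeg v1\<close> of the sign for moving the value of \<phi>, which has degree
      \<open>wdeg u + d\<close>, past v1, and leaves the sign of a coderivation of degree d.\<close>
    also have "\<dots> = spl w (\<lambda>x v2. spl x (\<lambda>v1 u. sg (d * wdeg v1) (tensor (sym_proj V (sgl v1)) (F u v2))))"
    proof (rule spl_cong)
      fix x v2 :: "'v word"
      show "spl x (\<lambda>u v1. sg ((wdeg u + d) * wdeg v1) (tensor (sym_proj V (sgl v1)) (F u v2))) =
          spl x (\<lambda>v1 u. sg (d * wdeg v1) (tensor (sym_proj V (sgl v1)) (F u v2)))"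
        by (subst spl_cocomm, intro spl_cong) (auto simp: sg_sg intro!: sg_cong)
    qed
    also have "\<dots> = spl w (\<lambda>v1 y. spl y (\<lambda>u v2. sg (d * wdeg v1) (tensor (sym_proj V (sgl v1)) (F u v2))))"
      unfolding spl_coassoc ..
    also have "\<dots> = spl w (\<lambda>v1 y. sg (d * wdeg v1) (tensor (sym_proj V (sgl v1)) (spl y F)))"
      unfolding spl_sg spl_linear[OF flin_tensor(2)] ..
    finally show ?thesis by (simp only: \<beta> spl_add)
  qed
  with hom have "\<beta> \<in> Coder V d" by (simp add: Coder_iff)
  \<comment> \<open>Since \<phi> is supported on length p, a shorter word has no contributing
    splitting, and a word of length p only the one with empty second half.\<close>
  moreover have F0: "F u v = 0" if "length u \<noteq> p" for u v
    using that by (simp add: F_def \<phi>_def word_proj_simps smult_simps)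
  have "\<beta> (sgl w) = 0" if "length w < p" for w
    unfolding \<beta> using that by (intro spl_zero_cong F0) auto
  moreover have "\<beta> (sgl w) = \<psi> (sgl w)" if len: "length w = p" for w
  proof -
    have FN: "F w [] = \<psi> (sgl w)"
      by (simp add: F_def smult_Nil P\<phi> len)
    show ?thesis
    proof (cases "w = []")
      case False
      have "spl w (\<lambda>u v. if u = [] \<or> v = [] then 0 else F u v) = 0"
      proof (rule spl_zero_cong)
        fix u v :: "'v word" assume *: "length u + length v = length w"
        have "F u v = 0" if "v \<noteq> []"
          using that * len by (intro F0) (cases v; simp)
        then show "(if u = [] \<or> v = [] then 0 else F u v) = 0" by simp
      qed
      moreover have "F [] w = 0" using False len by (intro F0) auto
      ultimately show ?thesis by (simp add: \<beta> spl_nonempty[OF False, of F] FN)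
    qed (use FN in \<open>simp add: \<beta>\<close>)
  qed
  ultimately show ?thesis by blast
qed


section \<open>Spectral sequences of filtered complexes\<close>

lemma quot_map_facts:
  assumes "vector_space s" "module.subspace s N"
  shows "quot_map s N (x + y) = quot_map s N x + quot_map s N y" "quot_map s N (s c x) = s c (quot_map s N x)"
    "quot_map s N x = quot_map s N y \<longleftrightarrow> x - y \<in> N" "quot_map s N x - x \<in> N"
    "quot_map s N (quot_map s N x) = quot_map s N x" "quot_map s N x = 0 \<longleftrightarrow> x \<in> N"
proof -
  note p = quot_map_props[OF assms]
  have l: "Vector_Spaces.linear s s (quot_map s N)" using p by blast
  show id: "quot_map s N (quot_map s N x) = quot_map s N x" for x using p by blast
  have "{x. quot_map s N x = 0} = N" using p by blast
  then show k: "quot_map s N x = 0 \<longleftrightarrow> x \<in> N" for x by blast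
  show "quot_map s N (x + y) = quot_map s N x + quot_map s N y" "quot_map s N (s c x) = s c (quot_map s N x)"
    by (rule lin_simps[OF l])+
  show e: "quot_map s N x = quot_map s N y \<longleftrightarrow> x - y \<in> N" for x y
    unfolding k[symmetric] by (simp add: lin_simps(2)[OF l])
  show "quot_map s N x - x \<in> N"
    unfolding e[symmetric] by (rule id)
qed

section \<open>Pages and differentials of the spectral sequence of a filtered complex\<close>

locale filtered_complex = vector_space s for s :: "'k::field \<Rightarrow> 'a::ab_group_add \<Rightarrow> 'a" +
  fixes C F :: "int \<Rightarrow> 'a set" and d :: "int \<Rightarrow> 'a \<Rightarrow> 'a"
  assumes subspace_C: "subspace (C n)" and subspace_F: "subspace (F p)"
    and F_antimono: "p \<le> p' \<Longrightarrow> F p' \<subseteq> F p"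
    and d_add: "d n (x + y) = d n x + d n y" and d_scale: "d n (s c x) = s c (d n x)"
    and d_C: "x \<in> C n \<Longrightarrow> d n x \<in> C (n + 1)"
    and d_F: "x \<in> C n \<Longrightarrow> x \<in> F p \<Longrightarrow> d n x \<in> F p"
    and d_d: "x \<in> C n \<Longrightarrow> d (n + 1) (d n x) = 0"
begin

text \<open>The second index is the total degree.\<close>

definition Z :: "int \<Rightarrow> int \<Rightarrow> int \<Rightarrow> 'a set" where
  "Z r p n = {x \<in> C n. x \<in> F p \<and> d n x \<in> F (p + r)}"

definition B :: "nat \<Rightarrow> int \<Rightarrow> int \<Rightarrow> 'a set" where
  "B r p n = {x + d (n - 1) y | x y. x \<in> Z (int r - 1) (p + 1) n \<and> y \<in> Z (int r - 1) (p - int r + 1) (n - 1)}"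

definition cls :: "nat \<Rightarrow> int \<Rightarrow> int \<Rightarrow> 'a \<Rightarrow> 'a" where
  "cls r p n = quot_map s (B r p n)"

definition E :: "nat \<Rightarrow> int \<Rightarrow> int \<Rightarrow> 'a set" where
  "E r p n = cls r p n ` Z (int r) p n"

definition D :: "nat \<Rightarrow> int \<Rightarrow> int \<Rightarrow> 'a \<Rightarrow> 'a" where
  "D r p n x = cls r (p + int r) (n + 1) (d n x)"

definition page :: "nat \<Rightarrow> int \<Rightarrow> int \<Rightarrow> 'a \<Rightarrow> 'a" where
  "page r p n = quot_map s (D r (p - int r) (n - 1) ` E r (p - int r) (n - 1))"

lemma d_simps: "d n 0 = 0" "d n (x - y) = d n x - d n y"
proof -
  show 0: "d n 0 = 0" using d_add[of n 0 0] by simp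
  show "d n (x - y) = d n x - d n y" using d_add[of n "x - y" y] by (simp add: algebra_simps)
qed

lemma subspace_Z: "subspace (Z r p n)"
  unfolding Z_def
  by (rule subspaceI)
    (auto simp: d_simps d_add d_scale intro: subspace_add subspace_scale subspace_0 subspace_C subspace_F)

lemma ZD: "x \<in> Z r p n \<Longrightarrow> x \<in> C n" "x \<in> Z r p n \<Longrightarrow> x \<in> F p" "x \<in> Z r p n \<Longrightarrow> d n x \<in> F (p + r)"
  by (auto simp: Z_def)

lemma Z_mono: "x \<in> Z r p n \<Longrightarrow> p' \<le> p \<Longrightarrow> p' + r' \<le> p + r \<Longrightarrow> x \<in> Z r' p' n"
  using F_antimono unfolding Z_def by blast

lemma d_Z_closed: "x \<in> C n \<Longrightarrow> d n x \<in> F p \<Longrightarrow> d n x \<in> Z r p (n + 1)"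
  unfolding Z_def by (simp add: d_C d_d subspace_0 subspace_F)

lemma BI:
  assumes "x \<in> Z (int r - 1) (p + 1) n" "y \<in> Z (int r - 1) (p - int r + 1) (n - 1)"
  shows "x + d (n - 1) y \<in> B r p n"
  using assms unfolding B_def by blast

lemma BI1: "x \<in> Z (int r - 1) (p + 1) n \<Longrightarrow> x \<in> B r p n"
  using BI[of x r p n 0] subspace_0[OF subspace_Z] by (simp add: d_simps)

lemma BI2: "y \<in> Z (int r - 1) (p - int r + 1) (n - 1) \<Longrightarrow> d (n - 1) y \<in> B r p n"
  using BI[of 0 r p n y] subspace_0[OF subspace_Z] by simp

lemma BE:
  assumes "b \<in> B r p n"
  obtains x y where "x \<in> Z (int r - 1) (p + 1) n" "y \<in> Z (int r - 1) (p - int r + 1) (n - 1)" "b = x + d (n - 1) y"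
  using assms unfolding B_def by blast

lemma subspace_B: "subspace (B r p n)"
proof (rule subspaceI)
  show "0 \<in> B r p n" using BI1 subspace_0[OF subspace_Z] by blast
  fix b assume "b \<in> B r p n"
  then obtain x y where b: "x \<in> Z (int r - 1) (p + 1) n" "y \<in> Z (int r - 1) (p - int r + 1) (n - 1)"
    "b = x + d (n - 1) y" by (rule BE)
  show "s c b \<in> B r p n" for c
    using BI[OF subspace_scale[OF subspace_Z b(1), of c] subspace_scale[OF subspace_Z b(2), of c]]
    by (simp add: b(3) d_scale scale_right_distrib)
  fix b' assume "b' \<in> B r p n"
  then obtain x' y' where b': "x' \<in> Z (int r - 1) (p + 1) n" "y' \<in> Z (int r - 1) (p - int r + 1) (n - 1)"
    "b' = x' + d (n - 1) y'" by (rule BE)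
  show "b + b' \<in> B r p n"
    using BI[OF subspace_add[OF subspace_Z b(1) b'(1)] subspace_add[OF subspace_Z b(2) b'(2)]]
    by (simp add: b(3) b'(3) d_add algebra_simps)
qed

lemma d_d': "y \<in> C (n - 1) \<Longrightarrow> d n (d (n - 1) y) = 0"
  using d_d[of y "n - 1"] by simp

lemma B_subset_Z: "B r p n \<subseteq> Z (int r) p n"
proof
  fix b assume "b \<in> B r p n"
  then obtain x y where b: "x \<in> Z (int r - 1) (p + 1) n" "y \<in> Z (int r - 1) (p - int r + 1) (n - 1)"
    "b = x + d (n - 1) y" by (rule BE)
  have "x \<in> Z (int r) p n" by (rule Z_mono[OF b(1)]) simp_all
  moreover have "d (n - 1) y \<in> Z (int r) p n"
    using d_Z_closed[OF ZD(1)[OF b(2)], of p "int r"] ZD(3)[OF b(2)] by simp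
  ultimately show "b \<in> Z (int r) p n"
    unfolding b(3) by (rule subspace_add[OF subspace_Z])
qed

lemma d_B:
  assumes "b \<in> B r p n"
  shows "d n b \<in> B r (p + int r) (n + 1)"
proof -
  obtain x y where b: "x \<in> Z (int r - 1) (p + 1) n" "y \<in> Z (int r - 1) (p - int r + 1) (n - 1)"
    "b = x + d (n - 1) y" by (rule BE[OF assms])
  have "d n b = d n x"
    by (simp add: b(3) d_add d_d'[OF ZD(1)[OF b(2)]])
  then show ?thesis
    using BI2[of x r "p + int r" "n + 1"] b(1) by simp
qed

lemmas cls_facts = quot_map_facts[OF vector_space_axioms subspace_B, folded cls_def]

text \<open>A chosen representative differs from a given one by an element of B, which lies in Z; so
  classes are again elements of Z.\<close>

lemma E_subset_Z: "x \<in> E r p n \<Longrightarrow> x \<in> Z (int r) p n"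
  and cls_E: "x \<in> E r p n \<Longrightarrow> cls r p n x = x"
proof -
  assume "x \<in> E r p n"
  then obtain z where z: "z \<in> Z (int r) p n" "x = cls r p n z" by (auto simp: E_def)
  have "cls r p n z - z \<in> Z (int r) p n" using cls_facts(4) B_subset_Z by blast
  then have "z + (cls r p n z - z) \<in> Z (int r) p n" by (rule subspace_add[OF subspace_Z z(1)])
  then show "x \<in> Z (int r) p n" by (simp add: z(2))
  show "cls r p n x = x" by (simp add: z(2) cls_facts)
qed

lemma d_Z: "x \<in> Z r p n \<Longrightarrow> d n x \<in> Z r' (p + r) (n + 1)"
  by (rule d_Z_closed) (auto dest: ZD)

lemma subspace_E: "subspace (E r p n)"
proof (rule subspaceI)
  show "0 \<in> E r p n"
    using subspace_0[OF subspace_Z] cls_facts(6)[of r p n 0] subspace_0[OF subspace_B] unfolding E_def by force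
  fix x assume x: "x \<in> E r p n"
  show "s c x \<in> E r p n" for c
    using subspace_scale[OF subspace_Z E_subset_Z[OF x], of c] cls_facts(2)[of r p n c x]
    unfolding E_def cls_E[OF x] by (metis imageI)
  fix y assume y: "y \<in> E r p n"
  show "x + y \<in> E r p n"
    using subspace_add[OF subspace_Z E_subset_Z[OF x] E_subset_Z[OF y]] cls_facts(1)[of r p n x y]
    unfolding E_def cls_E[OF x] cls_E[OF y] by (metis imageI)
qed

text \<open>Required for \<open>page\<close> to be a genuine class map, because
  \<open>quot_map\<close> is specified only for subspaces.\<close>

lemma subspace_D_image: "subspace (D r p n ` E r p n)"
proof (rule subspaceI)
  have D: "D r p n (x + y) = D r p n x + D r p n y" "D r p n (s c x) = s c (D r p n x)" for x y c
    by (simp_all add: D_def d_add d_scale cls_facts)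
  have "D r p n 0 = 0" using D(2)[of 0 0] by simp
  then show "0 \<in> D r p n ` E r p n"
    using subspace_0[OF subspace_E] by (metis imageI)
  fix x assume "x \<in> D r p n ` E r p n"
  then obtain x' where x: "x' \<in> E r p n" "x = D r p n x'" by blast
  show "s c x \<in> D r p n ` E r p n" for c
    unfolding x(2) D(2)[symmetric] by (intro imageI subspace_scale[OF subspace_E x(1)])
  fix y assume "y \<in> D r p n ` E r p n"
  then obtain y' where y: "y' \<in> E r p n" "y = D r p n y'" by blast
  show "x + y \<in> D r p n ` E r p n"
    unfolding x(2) y(2) D(1)[symmetric] by (intro imageI subspace_add[OF subspace_E x(1) y(1)])
qed

lemmas page_facts =
  quot_map_facts[OF vector_space_axioms subspace_D_image[of r "p - int r" "n - 1"], folded page_def] for r p n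

end

section \<open>Maps of filtered complexes and the induced maps of pages\<close>

locale filtered_complex_map =
  A: filtered_complex s C F d + A': filtered_complex s' C' F' d'
  for s :: "'k::field \<Rightarrow> 'a::ab_group_add \<Rightarrow> 'a" and C F d
    and s' :: "'k \<Rightarrow> 'b::ab_group_add \<Rightarrow> 'b" and C' F' d' +
  fixes \<Phi> :: "'a \<Rightarrow> 'b"
  assumes Phi_add: "\<Phi> (x + y) = \<Phi> x + \<Phi> y" and Phi_scale: "\<Phi> (s c x) = s' c (\<Phi> x)"
    and Phi_C: "x \<in> C n \<Longrightarrow> \<Phi> x \<in> C' n" and Phi_F: "x \<in> C n \<Longrightarrow> x \<in> F p \<Longrightarrow> \<Phi> x \<in> F' p"
    and Phi_d: "x \<in> C n \<Longrightarrow> \<Phi> (d n x) = d' n (\<Phi> x)"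
begin

lemma Phi_diff: "\<Phi> (x - y) = \<Phi> x - \<Phi> y"
  using Phi_add[of "x - y" y] by (simp add: algebra_simps)

lemma Phi_Z: "x \<in> A.Z r p n \<Longrightarrow> \<Phi> x \<in> A'.Z r p n"
  unfolding A.Z_def A'.Z_def using Phi_C Phi_F Phi_d A.d_C by auto metis

lemma Phi_B:
  assumes "b \<in> A.B r p n"
  shows "\<Phi> b \<in> A'.B r p n"
proof -
  obtain x y where b: "x \<in> A.Z (int r - 1) (p + 1) n" "y \<in> A.Z (int r - 1) (p - int r + 1) (n - 1)"
    "b = x + d (n - 1) y" by (rule A.BE[OF assms])
  show ?thesis
    using A'.BI[OF Phi_Z[OF b(1)] Phi_Z[OF b(2)]] by (simp add: b(3) Phi_add Phi_d[OF A.ZD(1)[OF b(2)]])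
qed

definition \<phi> :: "nat \<Rightarrow> int \<Rightarrow> int \<Rightarrow> 'a \<Rightarrow> 'b" where
  "\<phi> r p n x = A'.cls r p n (\<Phi> x)"

lemma phi_cls: "\<phi> r p n (A.cls r p n x) = A'.cls r p n (\<Phi> x)"
  unfolding \<phi>_def A'.cls_facts(3) using Phi_B[OF A.cls_facts(4)] by (simp add: Phi_diff)

lemma phi_linear_between: "linear_between s (A.E r p n) s' (A'.E r p n) (\<phi> r p n)"
  unfolding linear_between_def
proof (intro conjI ballI allI image_subsetI)
  fix x assume "x \<in> A.E r p n"
  then show "\<phi> r p n x \<in> A'.E r p n"
    unfolding \<phi>_def A'.E_def by (intro imageI Phi_Z A.E_subset_Z)
qed (simp_all add: \<phi>_def Phi_add Phi_scale A'.cls_facts)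

lemma phi_D:
  assumes x: "x \<in> A.E r p n"
  shows "\<phi> r (p + int r) (n + 1) (A.D r p n x) = A'.D r p n (\<phi> r p n x)"
proof -
  have "\<phi> r (p + int r) (n + 1) (A.D r p n x) = A'.cls r (p + int r) (n + 1) (d' n (\<Phi> x))"
    unfolding A.D_def phi_cls by (simp add: Phi_d[OF A.ZD(1)[OF A.E_subset_Z[OF x]]])
  also have "\<dots> = A'.D r p n (\<phi> r p n x)"
    unfolding A'.D_def A'.cls_facts(3) \<phi>_def A'.d_simps(2)[symmetric]
  proof (rule A'.d_B)
    have "A'.cls r p n (\<Phi> x) - \<Phi> x \<in> A'.B r p n" by (rule A'.cls_facts(4))
    then have "s' (- 1) (A'.cls r p n (\<Phi> x) - \<Phi> x) \<in> A'.B r p n"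
      by (rule A'.subspace_scale[OF A'.subspace_B])
    then show "\<Phi> x - A'.cls r p n (\<Phi> x) \<in> A'.B r p n" by simp
  qed
  finally show ?thesis .
qed

text \<open>The representatives chosen on page r + 1 are off by a + d b. On page r the summand a
  lies in deeper filtration and has class 0, while d b becomes a d_r-boundary, invisible in the
  cohomology of the page.\<close>

lemma phi_next:
  assumes x: "x \<in> A.E (Suc r) p n"
  shows "A'.page r p n (A'.cls r p n (\<phi> (Suc r) p n x)) = A'.page r p n (\<phi> r p n (A.page r p n (A.cls r p n x)))"
proof -
  have "A'.cls (Suc r) p n (\<Phi> x) - \<Phi> x \<in> A'.B (Suc r) p n"
    by (rule A'.cls_facts(4))
  then obtain a b where ab: "a \<in> A'.Z (int (Suc r) - 1) (p + 1) n"
    "b \<in> A'.Z (int (Suc r) - 1) (p - int (Suc r) + 1) (n - 1)"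
    "A'.cls (Suc r) p n (\<Phi> x) - \<Phi> x = a + d' (n - 1) b" by (rule A'.BE)
  \<comment> \<open>The index p - (r + 1) + 1 is p - r, so b defines a class on page r and the class
    of d b is its image under the page differential.\<close>
  have b: "b \<in> A'.Z (int r) (p - int r) (n - 1)" using ab(2) by (simp add: algebra_simps)
  have "A'.cls r p n a = 0"
    unfolding A'.cls_facts(6) by (rule A'.BI1[OF A'.Z_mono[OF ab(1)]]) simp_all
  moreover have "A'.cls r p n (d' (n - 1) b) \<in> A'.D r (p - int r) (n - 1) ` A'.E r (p - int r) (n - 1)"
  proof -
    let ?b = "A'.cls r (p - int r) (n - 1) b"
    have "b - ?b \<in> A'.B r (p - int r) (n - 1)"
      by (simp add: A'.cls_facts flip: A'.cls_facts(3))
    from A'.d_B[OF this] have "A'.cls r p n (d' (n - 1) b) = A'.D r (p - int r) (n - 1) ?b"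
      by (simp add: A'.D_def A'.cls_facts(3) A'.d_simps)
    moreover have "?b \<in> A'.E r (p - int r) (n - 1)"
      unfolding A'.E_def using b by blast
    ultimately show ?thesis by blast
  qed
  moreover have "A'.cls r p n (\<phi> (Suc r) p n x) - A'.cls r p n (\<Phi> x) = A'.cls r p n a + A'.cls r p n (d' (n - 1) b)"
  proof -
    have "\<phi> (Suc r) p n x = \<Phi> x + (a + d' (n - 1) b)"
      unfolding \<phi>_def ab(3)[symmetric] by simp
    then show ?thesis by (simp add: A'.cls_facts(1))
  qed
  ultimately have 1: "A'.page r p n (A'.cls r p n (\<phi> (Suc r) p n x)) = A'.page r p n (A'.cls r p n (\<Phi> x))"
    by (simp add: A'.page_facts(3))
  have "A.page r p n (A.cls r p n x) - A.cls r p n x \<in> A.D r (p - int r) (n - 1) ` A.E r (p - int r) (n - 1)"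
    by (rule A.page_facts(4))
  then obtain y where y: "y \<in> A.E r (p - int r) (n - 1)"
    "A.page r p n (A.cls r p n x) = A.cls r p n x + A.D r (p - int r) (n - 1) y"
    by (auto simp: algebra_simps)
  have "\<phi> r p n (A.page r p n (A.cls r p n x)) = \<phi> r p n (A.cls r p n x) + \<phi> r p n (A.D r (p - int r) (n - 1) y)"
    unfolding y(2) by (simp add: \<phi>_def Phi_add A'.cls_facts)
  also have "\<phi> r p n (A.D r (p - int r) (n - 1) y) = A'.D r (p - int r) (n - 1) (\<phi> r (p - int r) (n - 1) y)"
    using phi_D[OF y(1)] by simp
  also have "\<phi> r p n (A.cls r p n x) = A'.cls r p n (\<Phi> x)" by (rule phi_cls)
  finally have "\<phi> r p n (A.page r p n (A.cls r p n x)) - A'.cls r p n (\<Phi> x) \<in>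
      A'.D r (p - int r) (n - 1) ` A'.E r (p - int r) (n - 1)"
    using phi_linear_between[of r "p - int r" "n - 1"] y(1) unfolding linear_between_def by auto
  then have "A'.page r p n (\<phi> r p n (A.page r p n (A.cls r p n x))) = A'.page r p n (A'.cls r p n (\<Phi> x))"
    by (simp add: A'.page_facts(3))
  with 1 show ?thesis by simp
qed

text \<open>Surjectivity on page r in terms of representatives, and \<open>monic\<close> likewise
  for injectivity. All bidegrees are quantified together because the passage to page r + 1 uses
  neighbouring ones.\<close>

definition epic :: "nat \<Rightarrow> bool" where
  "epic r \<longleftrightarrow> (\<forall>p n. \<forall>z\<in>A'.Z (int r) p n. \<exists>y\<in>A.Z (int r) p n. z - \<Phi> y \<in> A'.B r p n)"

definition monic :: "nat \<Rightarrow> bool" where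
  "monic r \<longleftrightarrow> (\<forall>p n. \<forall>y\<in>A.Z (int r) p n. \<Phi> y \<in> A'.B r p n \<longrightarrow> y \<in> A.B r p n)"

text \<open>Surjectivity on page r lifts the element b bounding \<Phi> y to some b', up to B_r. Then
  y - d b' maps into B_r, so it lies in B_r by injectivity, and both bounding elements combine into
  one for page r + 1.\<close>

lemma monic_Suc:
  assumes "epic r" "monic r"
  shows "monic (Suc r)"
  unfolding monic_def
proof (intro allI ballI impI)
  fix p n y assume y: "y \<in> A.Z (int (Suc r)) p n" "\<Phi> y \<in> A'.B (Suc r) p n"
  obtain a b where "a \<in> A'.Z (int (Suc r) - 1) (p + 1) n"
    "b \<in> A'.Z (int (Suc r) - 1) (p - int (Suc r) + 1) (n - 1)" and ab: "\<Phi> y = a + d' (n - 1) b"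
    by (rule A'.BE[OF y(2)])
  then have a: "a \<in> A'.Z (int r) (p + 1) n" and b: "b \<in> A'.Z (int r) (p - int r) (n - 1)"
    by (simp_all add: algebra_simps)
  obtain b' where b': "b' \<in> A.Z (int r) (p - int r) (n - 1)" "b - \<Phi> b' \<in> A'.B r (p - int r) (n - 1)"
    using assms(1) b unfolding epic_def by blast
  have "\<Phi> (y - d (n - 1) b') = a + d' (n - 1) (b - \<Phi> b')"
    by (simp add: Phi_diff Phi_d[OF A.ZD(1)[OF b'(1)]] ab A'.d_simps)
  also have "\<dots> \<in> A'.B r p n"
    using A'.BI1[OF A'.Z_mono[OF a]] A'.d_B[OF b'(2)]
    by (intro A'.subspace_add[OF A'.subspace_B]) simp_all
  finally have "\<Phi> (y - d (n - 1) b') \<in> A'.B r p n" .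
  moreover have db': "d (n - 1) b' \<in> A.Z (int r) p n"
    using A.d_Z[OF b'(1), of "int r"] by simp
  have "y - d (n - 1) b' \<in> A.Z (int r) p n"
    by (rule A.subspace_diff[OF A.subspace_Z A.Z_mono[OF y(1)] db']) simp_all
  ultimately have "y - d (n - 1) b' \<in> A.B r p n"
    using assms(2) unfolding monic_def by blast
  then obtain a' e where a': "a' \<in> A.Z (int r - 1) (p + 1) n" and e: "e \<in> A.Z (int r - 1) (p - int r + 1) (n - 1)"
    and eq: "y - d (n - 1) b' = a' + d (n - 1) e" by (rule A.BE)
  have yeq: "y = a' + d (n - 1) (b' + e)"
    using eq by (simp add: A.d_add algebra_simps)
  have be: "b' + e \<in> A.Z (int r) (p - int r) (n - 1)"
    by (rule A.subspace_add[OF A.subspace_Z b'(1) A.Z_mono[OF e]]) simp_all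
  have "d n y = d n a' + d n (d (n - 1) (b' + e))"
    unfolding yeq by (rule A.d_add)
  then have "d n y = d n a'"
    by (simp only: A.d_d'[OF A.ZD(1)[OF be]] add_0_right)
  \<comment> \<open>The boundary part contributes nothing to d y, so d a' = d y inherits the deeper
    filtration of d y.\<close>
  then have "a' \<in> A.Z (int r) (p + 1) n"
    using a' A.ZD(3)[OF y(1)] by (simp add: A.Z_def algebra_simps)
  then show "y \<in> A.B (Suc r) p n"
    unfolding yeq using be by (intro A.BI) (simp_all add: algebra_simps)
qed

text \<open>A lift y of z on page r need not survive to page r + 1. But d y maps into B_r, so by
  injectivity in the target bidegree d y = c + d e with c deep in the filtration; y - e survives,
  and e itself lies in F^(p+1).\<close>

lemma epic_Suc:
  assumes "epic r" "monic r"
  shows "epic (Suc r)"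
  unfolding epic_def
proof (intro allI ballI)
  fix p n z assume z: "z \<in> A'.Z (int (Suc r)) p n"
  then have "z \<in> A'.Z (int r) p n" by (rule A'.Z_mono) simp_all
  then obtain y where y: "y \<in> A.Z (int r) p n" "z - \<Phi> y \<in> A'.B r p n"
    using assms(1) unfolding epic_def by blast
  obtain a b where a: "a \<in> A'.Z (int r - 1) (p + 1) n" and b: "b \<in> A'.Z (int r - 1) (p - int r + 1) (n - 1)"
    and ab: "z - \<Phi> y = a + d' (n - 1) b" by (rule A'.BE[OF y(2)])
  have z_eq: "z = \<Phi> y + (a + d' (n - 1) b)" using ab by (simp add: algebra_simps)
  have dz: "d' n z = \<Phi> (d n y) + d' n a"
    by (simp add: z_eq A'.d_add A'.d_d'[OF A'.ZD(1)[OF b]] Phi_d[OF A.ZD(1)[OF y(1)]])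
  have "d' n z \<in> A'.B r (p + int r) (n + 1)"
    using A'.d_Z[OF z, of "int r - 1"] by (intro A'.BI1) (simp add: algebra_simps)
  moreover have "d' n a \<in> A'.B r (p + int r) (n + 1)"
    using A'.BI2[of a r "p + int r" "n + 1"] a by simp
  ultimately have "d' n z - d' n a \<in> A'.B r (p + int r) (n + 1)"
    by (rule A'.subspace_diff[OF A'.subspace_B])
  then have "\<Phi> (d n y) \<in> A'.B r (p + int r) (n + 1)" by (simp add: dz)
  then have "d n y \<in> A.B r (p + int r) (n + 1)"
    using assms(2) A.d_Z[OF y(1)] unfolding monic_def by blast
  then obtain c e where c: "c \<in> A.Z (int r - 1) (p + int r + 1) (n + 1)"
    and e: "e \<in> A.Z (int r - 1) (p + int r - int r + 1) (n + 1 - 1)"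
    and ce: "d n y = c + d (n + 1 - 1) e" by (rule A.BE)
  have e': "e \<in> A.Z (int r - 1) (p + 1) n" using e by simp
  have dye: "d n (y - e) = c" using ce by (simp add: A.d_simps)
  have y': "y - e \<in> A.Z (int (Suc r)) p n"
    unfolding A.Z_def
  proof (intro CollectI conjI)
    show "y - e \<in> C n" by (rule A.subspace_diff[OF A.subspace_C A.ZD(1)[OF y(1)] A.ZD(1)[OF e']])
    have "e \<in> F p" using A.ZD(2)[OF e'] A.F_antimono[of p "p + 1"] by auto
    then show "y - e \<in> F p" by (rule A.subspace_diff[OF A.subspace_F A.ZD(2)[OF y(1)]])
    show "d n (y - e) \<in> F (p + int (Suc r))"
      using A.ZD(2)[OF c] by (simp add: dye algebra_simps)
  qed
  have ae: "a + \<Phi> e \<in> A'.Z (int r - 1) (p + 1) n"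
    by (rule A'.subspace_add[OF A'.subspace_Z a Phi_Z[OF e']])
  have "d' n (a + \<Phi> e) = d' n z - \<Phi> c"
    by (simp add: dz A'.d_add Phi_d[OF A.ZD(1)[OF e'], symmetric] ce Phi_add)
  also have "\<dots> \<in> F' (p + int r + 1)"
    using A'.ZD(3)[OF z] A'.ZD(2)[OF Phi_Z[OF c]] by (intro A'.subspace_diff[OF A'.subspace_F]) (simp_all add: algebra_simps)
  finally have "a + \<Phi> e \<in> A'.Z (int r) (p + 1) n"
    using ae by (simp add: A'.Z_def ac_simps)
  moreover have "b \<in> A'.Z (int r) (p - int r) (n - 1)"
    by (rule A'.Z_mono[OF b]) simp_all
  ultimately have "(a + \<Phi> e) + d' (n - 1) b \<in> A'.B (Suc r) p n"
    by (intro A'.BI) (simp_all add: algebra_simps)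
  moreover have "z - \<Phi> (y - e) = (a + \<Phi> e) + d' (n - 1) b"
    by (simp add: z_eq Phi_diff)
  ultimately show "\<exists>y\<in>A.Z (int (Suc r)) p n. z - \<Phi> y \<in> A'.B (Suc r) p n"
    using y' by metis
qed

lemma phi_bij:
  assumes "epic 1" "monic 1" "r \<ge> 1"
  shows "bij_betw (\<phi> r p n) (A.E r p n) (A'.E r p n)"
proof -
  have em: "epic r \<and> monic r"
    using assms(3)
  proof (induction r rule: nat_induct_at_least)
    case base
    then show ?case using assms by simp
  next
    case (Suc r)
    then show ?case using monic_Suc epic_Suc by blast
  qed
  show ?thesis
    unfolding bij_betw_def
  proof (intro conjI inj_onI subset_antisym subsetI)
    fix x y assume xy: "x \<in> A.E r p n" "y \<in> A.E r p n" "\<phi> r p n x = \<phi> r p n y"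
    then have "\<Phi> (x - y) \<in> A'.B r p n"
      by (simp add: \<phi>_def A'.cls_facts(3) Phi_diff)
    then have "x - y \<in> A.B r p n"
      using em A.subspace_diff[OF A.subspace_Z A.E_subset_Z[OF xy(1)] A.E_subset_Z[OF xy(2)]]
      unfolding monic_def by blast
    then show "x = y"
      using A.cls_E[OF xy(1)] A.cls_E[OF xy(2)] by (simp flip: A.cls_facts(3))
  next
    fix x assume "x \<in> \<phi> r p n ` A.E r p n"
    then show "x \<in> A'.E r p n"
      using phi_linear_between[of r p n] unfolding linear_between_def by blast
  next
    fix z assume z: "z \<in> A'.E r p n"
    then obtain y where y: "y \<in> A.Z (int r) p n" "z - \<Phi> y \<in> A'.B r p n"
      using em A'.E_subset_Z unfolding epic_def by blast
    have "\<phi> r p n (A.cls r p n y) = z"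
      using y(2) A'.cls_E[OF z] A'.cls_facts(3)[of r p n z "\<Phi> y"] by (simp add: phi_cls)
    moreover have "A.cls r p n y \<in> A.E r p n"
      unfolding A.E_def using y(1) by blast
    ultimately show "z \<in> \<phi> r p n ` A.E r p n" by blast
  qed
qed

end


section \<open>L-infinity[1]-algebras\<close>

subsection \<open>Letters and the tangent complex\<close>

text \<open>Makes \<open>corestr\<close> well defined on the quotient. Reading a letter back from
  its class then shows that V embeds in the coalgebra (\<open>letter_inj\<close>).\<close>

lemma sym_fun_corestr:
  assumes V: "graded_vector_space V"
  shows "sym_fun V (scl V) (\<lambda>w. corestr V m (sgl w))"
proof -
  interpret vs: vector_space "scl V" by (rule vector_space_scl[OF V])
  note sub = subspace_part[OF V]
  define c where "c w = (case w of [(n, v)] \<Rightarrow> (if n = m \<and> v \<in> part V m then v else 0) | _ \<Rightarrow> 0)" for w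
  have c1: "c [(n, v)] = (if n = m \<and> v \<in> part V m then v else 0)" for n v
    by (simp add: c_def)
  have c0: "c w = 0" if "length w \<noteq> 1" for w
    using that by (auto simp: c_def split: list.split)
  have "sym_fun V (scl V) c"
    unfolding sym_fun_def
  proof (intro conjI allI impI)
    fix w assume *: "\<not> valid_word V w"
    show "c w = 0"
    proof (cases "length w = 1")
      case True
      then obtain a where w: "w = [a]" by (cases w) auto
      then show ?thesis using * c1[of "fst a" "snd a"] by auto
    qed (rule c0)
  next
    fix u n x y t a b assume xy: "x \<in> part V n" "y \<in> part V n"
    then have s: "scl V a x + scl V b y \<in> part V n"
      by (intro vs.subspace_add[OF sub] vs.subspace_scale[OF sub])
    show "c (u @ (n, scl V a x + scl V b y) # t) = scl V a (c (u @ (n, x) # t)) + scl V b (c (u @ (n, y) # t))"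
    proof (cases "u = [] \<and> t = []")
      case True
      then show ?thesis using xy s by (cases "n = m") (simp_all add: c1)
    next
      case False
      then have "c (u @ (n, z) # t) = 0" for z by (intro c0) auto
      then show ?thesis by simp
    qed
  next
    fix u m' x n y t
    have "c (u @ z # z' # t) = 0" for z z' by (rule c0) simp
    then show "c (u @ (m', x) # (n, y) # t) = sg (m' * n) (c (u @ (n, y) # (m', x) # t))"
      by simp
  qed
  moreover have "corestr V m (sgl w) = c w" for w
    by (simp add: corestr_def linext_sgl[OF vector_space_scl[OF V]] c_def)
  ultimately show ?thesis by simp
qed

lemma corestr_sym_proj:
  assumes "graded_vector_space V"
  shows "corestr V m (sym_proj V x) = corestr V m x"
  by (rule linear_sym_proj[OF _ sym_fun_corestr[OF assms]])
    (simp add: corestr_def linear_linext[OF vector_space_scl[OF assms]])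

lemma corestr_letter:
  assumes "graded_vector_space V" "v \<in> part V m"
  shows "corestr V m (sym_proj V (sgl [(m, v)])) = v"
  unfolding corestr_sym_proj[OF assms(1)]
  using assms(2) by (simp add: corestr_def linext_sgl[OF vector_space_scl[OF assms(1)]])

lemma letter_inj:
  assumes "graded_vector_space V" "v \<in> part V m" "u \<in> part V m"
  shows "sym_proj V (sgl [(m, v)]) = sym_proj V (sgl [(m, u)]) \<longleftrightarrow> v = u"
  using corestr_letter[OF assms(1,2)] corestr_letter[OF assms(1,3)] by metis

lemma letter_corestr:
  assumes "graded_vector_space V" "x \<in> letters V m"
  shows "corestr V m x \<in> part V m" "x = sym_proj V (sgl [(m, corestr V m x)])"
  using assms(2) by (auto simp: corestr_letter[OF assms(1)] elim!: lettersE)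

lemma lin_part_letter:
  assumes "graded_vector_space W" "f (smono V [(n, v)]) \<in> letters W (n + d)"
  shows "lin_part V W d f n v \<in> part W (n + d)"
    "f (sym_proj V (sgl [(n, v)])) = sym_proj W (sgl [(n + d, lin_part V W d f n v)])"
  using letter_corestr[OF assms] by (simp_all add: lin_part_def smono_def)

lemma part_simps:
  assumes "graded_vector_space V"
  shows "0 \<in> part V n" "x \<in> part V n \<Longrightarrow> y \<in> part V n \<Longrightarrow> x + y \<in> part V n"
    "x \<in> part V n \<Longrightarrow> y \<in> part V n \<Longrightarrow> x - y \<in> part V n" "x \<in> part V n \<Longrightarrow> scl V c x \<in> part V n"
proof -
  interpret vs: vector_space "scl V" by (rule vector_space_scl[OF assms])
  note sub = subspace_part[OF assms]
  show "0 \<in> part V n" "x \<in> part V n \<Longrightarrow> y \<in> part V n \<Longrightarrow> x + y \<in> part V n"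
    "x \<in> part V n \<Longrightarrow> y \<in> part V n \<Longrightarrow> x - y \<in> part V n" "x \<in> part V n \<Longrightarrow> scl V c x \<in> part V n"
    by (rule vs.subspace_0[OF sub] vs.subspace_add[OF sub] vs.subspace_diff[OF sub] vs.subspace_scale[OF sub]; assumption)+
qed

lemma letter_simps:
  assumes V: "graded_vector_space V"
  shows "sym_proj V (sgl [(n, 0)]) = 0"
    "x \<in> part V n \<Longrightarrow> y \<in> part V n \<Longrightarrow> sym_proj V (sgl [(n, x + y)]) = sym_proj V (sgl [(n, x)]) + sym_proj V (sgl [(n, y)])"
    "x \<in> part V n \<Longrightarrow> y \<in> part V n \<Longrightarrow> sym_proj V (sgl [(n, x - y)]) = sym_proj V (sgl [(n, x)]) - sym_proj V (sgl [(n, y)])"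
    "x \<in> part V n \<Longrightarrow> sym_proj V (sgl [(n, scl V c x)]) = fscl c (sym_proj V (sgl [(n, x)]))"
proof -
  interpret vs: vector_space "scl V" by (rule vector_space_scl[OF V])
  note L = sym_proj_letter_linear[of _ V] and p = part_simps[OF V]
  show "sym_proj V (sgl [(n, 0)]) = 0" using L[OF p(1) p(1), of n 0 0] by simp
  show "x \<in> part V n \<Longrightarrow> y \<in> part V n \<Longrightarrow> sym_proj V (sgl [(n, x + y)]) = sym_proj V (sgl [(n, x)]) + sym_proj V (sgl [(n, y)])"
    using L[of x n y 1 1] by simp
  show "x \<in> part V n \<Longrightarrow> y \<in> part V n \<Longrightarrow> sym_proj V (sgl [(n, x - y)]) = sym_proj V (sgl [(n, x)]) - sym_proj V (sgl [(n, y)])"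
    using L[of x n y 1 "- 1"] by simp
  show "x \<in> part V n \<Longrightarrow> sym_proj V (sgl [(n, scl V c x)]) = fscl c (sym_proj V (sgl [(n, x)]))"
    using L[of x n x c 0] by simp
qed

locale Linf =
  fixes V :: "('k::field_char_0, 'v::ab_group_add) graded_space" and Q :: "('k, 'v) endo"
  assumes Linf: "Linf_algebra V Q"
begin

lemma V: "graded_vector_space V" and Q: "Q \<in> Coder V 1"
  using Linf by (auto simp: Linf_algebra_def)

lemmas hQ = sym_homD[OF Coder_hom[OF Q]]

lemma Q_Nil: "Q (sgl []) = 0"
  using Linf hQ(2)[of "sgl []"] by (simp add: Linf_algebra_def smono_def)

lemma Q_Q: "Q (Q x) = 0"
proof -
  have "Q (Q (sym_proj V x)) = 0"
    using Linf unfolding Linf_algebra_def by (elim conjE, elim bspec) (simp add: sym_coalg_iff)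
  then show ?thesis by (simp only: hQ(2))
qed

lemma Q_lenle: "lenle V n x \<Longrightarrow> lenle V n (Q x)"
  by (rule Coder_lenle_image[OF Q Q_Nil])

lemma F1_letters:
  assumes a: "\<alpha> \<in> Coder V d" and 0: "\<alpha> (sgl []) = 0" and x: "x \<in> letters V n"
  shows "\<alpha> x \<in> letters V (n + d)"
proof -
  obtain v where v: "v \<in> part V n" "x = sym_proj V (sgl [(n, v)])" using x by (rule lettersE)
  have "\<alpha> (sgl [(n, v)]) \<in> letters V (wdeg [(n, v)] + d)"
    by (rule Coder_letters[OF a V]) (use 0 in simp)
  then show ?thesis by (simp add: v(2) sym_homD(2)[OF Coder_hom[OF a]])
qed

lemmas Q_letters = F1_letters[OF Q Q_Nil]

lemma lin_part_Q:
  assumes "v \<in> part V n"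
  shows "lin_part V V 1 Q n v \<in> part V (n + 1)"
    "Q (sym_proj V (sgl [(n, v)])) = sym_proj V (sgl [(n + 1, lin_part V V 1 Q n v)])"
proof -
  have "Q (smono V [(n, v)]) \<in> letters V (n + 1)"
    using assms by (intro Q_letters) (auto simp: letters_def smono_def)
  from lin_part_letter[where f = Q and d = 1, OF V this] show "lin_part V V 1 Q n v \<in> part V (n + 1)"
    "Q (sym_proj V (sgl [(n, v)])) = sym_proj V (sgl [(n + 1, lin_part V V 1 Q n v)])" by auto
qed

text \<open>On letters Q coincides with its linear part, so boundaries of the tangent complex can be
  expressed by Q inside the coalgebra.\<close>

lemma coboundaries_iff:
  assumes v: "v \<in> part V n"
  shows "v \<in> coboundaries V Q n \<longleftrightarrow> (\<exists>z\<in>letters V (n - 1). Q z = sym_proj V (sgl [(n, v)]))"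
proof
  assume "v \<in> coboundaries V Q n"
  then obtain u where u: "u \<in> part V (n - 1)" "v = lin_part V V 1 Q (n - 1) u"
    by (auto simp: coboundaries_def)
  have "Q (sym_proj V (sgl [(n - 1, u)])) = sym_proj V (sgl [(n, v)])"
    using lin_part_Q(2)[OF u(1)] by (simp add: u(2))
  then show "\<exists>z\<in>letters V (n - 1). Q z = sym_proj V (sgl [(n, v)])"
    using u(1) unfolding letters_def by blast
next
  assume "\<exists>z\<in>letters V (n - 1). Q z = sym_proj V (sgl [(n, v)])"
  then obtain u where u: "u \<in> part V (n - 1)" "Q (sym_proj V (sgl [(n - 1, u)])) = sym_proj V (sgl [(n, v)])"
    unfolding letters_def by blast
  have "v = lin_part V V 1 Q (n - 1) u"
    using lin_part_Q[OF u(1)] u(2) letter_inj[OF V v] by simp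
  then show "v \<in> coboundaries V Q n"
    using u(1) unfolding coboundaries_def by blast
qed

lemma coboundaries_part: "v \<in> coboundaries V Q n \<Longrightarrow> v \<in> part V n"
  using lin_part_Q(1)[of _ "n - 1"] by (auto simp: coboundaries_def)

lemma subspace_coboundaries: "module.subspace (scl V) (coboundaries V Q n)"
proof -
  interpret vs: vector_space "scl V" by (rule vector_space_scl[OF V])
  note sub = subspace_letters[OF V, of "n - 1"] and p = part_simps[OF V] and l = letter_simps[OF V]
  show ?thesis
  proof (rule vs.subspaceI)
    show "0 \<in> coboundaries V Q n"
      unfolding coboundaries_iff[OF p(1)] l(1)
      using fs.subspace_0[OF sub] lin_simps(4)[OF hQ(1)] by blast
    fix x assume x: "x \<in> coboundaries V Q n"
    note xp = coboundaries_part[OF x]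
    obtain z where z: "z \<in> letters V (n - 1)" "Q z = sym_proj V (sgl [(n, x)])"
      using x coboundaries_iff[OF xp] by blast
    show "scl V c x \<in> coboundaries V Q n" for c
      unfolding coboundaries_iff[OF p(4)[OF xp]] l(4)[OF xp]
      using fs.subspace_scale[OF sub z(1), of c] by (auto simp: lin_simps[OF hQ(1)] z(2) intro!: bexI[of _ "fscl c z"])
    fix y assume y: "y \<in> coboundaries V Q n"
    note yp = coboundaries_part[OF y]
    obtain z' where z': "z' \<in> letters V (n - 1)" "Q z' = sym_proj V (sgl [(n, y)])"
      using y coboundaries_iff[OF yp] by blast
    show "x + y \<in> coboundaries V Q n"
      unfolding coboundaries_iff[OF p(2)[OF xp yp]] l(2)[OF xp yp]
      using fs.subspace_add[OF sub z(1) z'(1)] by (auto simp: lin_simps[OF hQ(1)] z(2) z'(2) intro!: bexI[of _ "z + z'"])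
  qed
qed

lemmas coh_class_facts = quot_map_facts[OF vector_space_scl[OF V] subspace_coboundaries, folded coh_class_def]

text \<open>Elements of the cohomology are chosen representatives; each differs from a cycle by a
  coboundary and is therefore a cycle itself.\<close>

lemma tangent_cohD:
  assumes "h \<in> tangent_coh V Q n"
  shows "h \<in> part V n" "Q (sym_proj V (sgl [(n, h)])) = 0" "coh_class V Q n h = h"
proof -
  obtain v where v: "v \<in> part V n" "lin_part V V 1 Q n v = 0" "h = coh_class V Q n v"
    using assms by (auto simp: tangent_coh_def)
  have b: "h - v \<in> coboundaries V Q n" using coh_class_facts(4) by (simp add: v(3))
  note bp = coboundaries_part[OF b]
  show h: "h \<in> part V n" using part_simps(2)[OF V bp v(1)] by simp
  obtain z where z: "Q z = sym_proj V (sgl [(n, h - v)])" using b coboundaries_iff[OF bp] by blast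
  have "sym_proj V (sgl [(n, h)]) = sym_proj V (sgl [(n, v)]) + Q z"
    using letter_simps(3)[OF V h v(1)] by (simp add: z)
  then show "Q (sym_proj V (sgl [(n, h)])) = 0"
    using lin_part_Q(2)[OF v(1)] by (simp add: lin_simps[OF hQ(1)] Q_Q v(2) letter_simps(1)[OF V])
  show "coh_class V Q n h = h" by (simp add: v(3) coh_class_facts)
qed

lemma coh_class_in_tangent_coh:
  assumes "v \<in> part V n" "Q (sym_proj V (sgl [(n, v)])) = 0"
  shows "coh_class V Q n v \<in> tangent_coh V Q n"
proof -
  have "sym_proj V (sgl [(n + 1, lin_part V V 1 Q n v)]) = sym_proj V (sgl [(n + 1, 0)])"
    using lin_part_Q(2)[OF assms(1)] assms(2) letter_simps(1)[OF V] by metis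
  then have "lin_part V V 1 Q n v = 0"
    using letter_inj[OF V lin_part_Q(1)[OF assms(1)] part_simps(1)[OF V]] by blast
  then show ?thesis unfolding tangent_coh_def using assms(1) by blast
qed


subsection \<open>The Chevalley-Eilenberg complex as a filtered complex\<close>

lemma Coder_zero: "0 \<in> Coder V n"
proof -
  have "(\<lambda>x::('k, 'v) free. 0 :: ('k, 'v) free) \<in> sym_hom V V n"
    by (rule sym_homI) (use fs.subspace_0[OF subspace_sym_degree] in \<open>auto simp: flin_zero\<close>)
  then show ?thesis
    by (simp add: Coder_iff zero_fun_def spl_zero lin_simps[OF flin_coprod])
qed

lemma Coder_add:
  assumes a: "\<alpha> \<in> Coder V n" and b: "\<beta> \<in> Coder V n"
  shows "\<alpha> + \<beta> \<in> Coder V n"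
proof -
  note ha = sym_homD[OF Coder_hom[OF a]] and hb = sym_homD[OF Coder_hom[OF b]]
  have "(\<lambda>x. \<alpha> x + \<beta> x) \<in> sym_hom V V n"
    by (rule sym_homI) (auto intro!: flin_intros(1) ha(1) hb(1) fs.subspace_add[OF subspace_sym_degree] ha(5) hb(5) simp: ha(2) hb(2))
  moreover have "coprod V (\<alpha> (sgl w) + \<beta> (sgl w)) = spl w (\<lambda>u v. tensor (\<alpha> (sgl u) + \<beta> (sgl u)) (sym_proj V (sgl v)) +
       sg (n * wdeg u) (tensor (sym_proj V (sgl u)) (\<alpha> (sgl v) + \<beta> (sgl v))))" for w
    using a b by (simp add: Coder_iff lin_simps[OF flin_coprod] tensor_simps sg_add spl_add algebra_simps)
  ultimately show ?thesis by (simp add: Coder_iff plus_fun_def)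
qed

lemma Coder_scale:
  assumes a: "\<alpha> \<in> Coder V n"
  shows "escl c \<alpha> \<in> Coder V n"
proof -
  note ha = sym_homD[OF Coder_hom[OF a]]
  have "(\<lambda>x. fscl c (\<alpha> x)) \<in> sym_hom V V n"
    by (rule sym_homI) (auto intro!: flin_comp[OF ha(1) flin_scale] fs.subspace_scale[OF subspace_sym_degree] ha(5) simp: ha(2))
  moreover have "coprod V (fscl c (\<alpha> (sgl w))) = spl w (\<lambda>u v. tensor (fscl c (\<alpha> (sgl u))) (sym_proj V (sgl v)) +
       sg (n * wdeg u) (tensor (sym_proj V (sgl u)) (fscl c (\<alpha> (sgl v)))))" for w
    using a by (simp add: Coder_iff lin_simps[OF flin_coprod] tensor_simps fs.scale_right_distrib
        flip: spl_fscl sg_fscl)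
  ultimately show ?thesis by (simp add: Coder_iff pscl_def)
qed

lemma CE_diff_filt:
  assumes a: "\<alpha> \<in> Coder V n" and F: "\<alpha> \<in> CE_filt V p"
  shows "CE_diff Q n \<alpha> \<in> CE_filt V p"
  unfolding CE_filt_iff[OF Coder_hom[OF CE_diff_Coder[OF Q a]]]
proof (intro allI impI)
  note ha = sym_homD[OF Coder_hom[OF a]]
  have 0: "\<alpha> (sgl w) = 0" if "valid_word V w" "int (length w) < p" for w
    using that F CE_filt_iff[OF Coder_hom[OF a]] by blast
  fix w assume w: "valid_word V w" "int (length w) < p"
  have "\<alpha> (Q (sgl w)) = 0"
    by (rule linear_lenle_0[OF ha(1,2) Q_lenle[OF lenle_sgl[OF order_refl[of "length w"]]] 0]) (use w in auto)
  then show "CE_diff Q n \<alpha> (sgl w) = 0"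
    by (simp add: CE_diff_def 0[OF w] lin_simps[OF hQ(1)])
qed

lemma CE_diff_CE_diff:
  assumes a: "\<alpha> \<in> Coder V n"
  shows "CE_diff Q (n + 1) (CE_diff Q n \<alpha>) = 0"
proof -
  note ha = sym_homD[OF Coder_hom[OF a]]
  show ?thesis
    by (rule ext) (simp add: CE_diff_def fscl_powi lin_simps[OF hQ(1)] lin_simps[OF ha(1)] lin_sg[OF hQ(1)]
        Q_Q sg_diff sg_sg sg_def)
qed

sublocale CE: filtered_complex escl "Coder V" "CE_filt V" "CE_diff Q"
proof -
  interpret E: vector_space "escl :: 'k \<Rightarrow> ('k, 'v) endo \<Rightarrow> _"
    by (rule vector_space_pscl[OF vector_space_fscl])
  show "filtered_complex escl (Coder V) (CE_filt V) (CE_diff Q)"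
  proof unfold_locales
    show "E.subspace (Coder V n)" for n
      by (rule E.subspaceI) (auto intro: Coder_zero Coder_add Coder_scale)
    show "E.subspace (CE_filt V p)" for p
      by (rule E.subspaceI) (auto simp: CE_filt_def pscl_def)
    show "CE_filt V p' \<subseteq> CE_filt V p" if "p \<le> p'" for p p'
      using that by (force simp: CE_filt_def)
    show "CE_diff Q n (x + y) = CE_diff Q n x + CE_diff Q n y" for n x y
      by (rule ext) (simp add: CE_diff_def lin_simps[OF hQ(1)] fs.scale_right_distrib algebra_simps)
    show "CE_diff Q n (escl c x) = escl c (CE_diff Q n x)" for n c x
      by (rule ext) (simp add: CE_diff_def pscl_def lin_simps[OF hQ(1)] fs.scale_right_diff_distrib mult.commute)
  qed (simp_all add: CE_diff_Coder[OF Q] CE_diff_filt CE_diff_CE_diff)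
qed

text \<open>Passes from the bidegree (p, q) to the pair (p, p + q) of filtration and total
  degree.\<close>

lemma CE_translate:
  "CE_Z V Q r p q = CE.Z r p (p + q)" "CE_B V Q r' p q = CE.B r' p (p + q)"
  "CE_class V Q r' p q = CE.cls r' p (p + q)" "CE_E V Q r' p q = CE.E r' p (p + q)"
  "CE_d V Q r' p q = CE.D r' p (p + q)" "CE_page_class V Q r' p q = CE.page r' p (p + q)"
proof -
  show Z: "CE_Z V Q r p q = CE.Z r p (p + q)" for r p q
    by (simp add: CE_Z_def CE.Z_def)
  show B: "CE_B V Q r' p q = CE.B r' p (p + q)" for r' p q
    by (simp add: CE_B_def CE.B_def Z add_diff_eq)
  show cls: "CE_class V Q r' p q = CE.cls r' p (p + q)" for r' p q
    by (simp add: CE_class_def CE.cls_def B)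
  show E: "CE_E V Q r' p q = CE.E r' p (p + q)" for r' p q
    by (simp add: CE_E_def CE.E_def Z cls)
  show D: "CE_d V Q r' p q = CE.D r' p (p + q)" for r' p q
    by (rule ext) (simp add: CE_d_def CE.D_def cls add.assoc)
  show "CE_page_class V Q r' p q = CE.page r' p (p + q)"
    by (simp add: CE_page_class_def CE.page_def E D add_diff_eq)
qed

end


subsection \<open>Cochains of word length p\<close>

context Linf
begin

text \<open>What remains of a coderivation in F^p once only words of length at most p are tested.
  The class is larger on purpose: composites such as \<alpha> E need not be coderivations, and
  \<open>Coder_extension\<close> leads back.\<close>

definition coch :: "nat \<Rightarrow> int \<Rightarrow> ('k, 'v) endo \<Rightarrow> bool" where
  "coch p d \<alpha> \<longleftrightarrow> \<alpha> \<in> sym_hom V V d \<and> (\<forall>w. length w < p \<longrightarrow> \<alpha> (sgl w) = 0) \<and>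
     (\<forall>w. length w = p \<longrightarrow> \<alpha> (sgl w) \<in> letters V (wdeg w + d))"

definition closed :: "nat \<Rightarrow> int \<Rightarrow> ('k, 'v) endo \<Rightarrow> bool" where
  "closed p d \<alpha> \<longleftrightarrow> (\<forall>w. length w \<le> p \<longrightarrow> Q (\<alpha> (sgl w)) = sg d (\<alpha> (Q (sgl w))))"

text \<open>The differential of \<beta> of degree d - 1 carries the sign -(-1)^(d - 1) = (-1)^d.
  Testing words up to length p means equality modulo F^(p+1).\<close>

definition exact :: "nat \<Rightarrow> int \<Rightarrow> ('k, 'v) endo \<Rightarrow> bool" where
  "exact p d \<alpha> \<longleftrightarrow> (\<exists>\<beta>. coch p (d - 1) \<beta> \<and>
     (\<forall>w. length w \<le> p \<longrightarrow> \<alpha> (sgl w) = Q (\<beta> (sgl w)) + sg d (\<beta> (Q (sgl w)))))"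

lemma cochD:
  assumes "coch p d \<alpha>"
  shows "\<alpha> \<in> sym_hom V V d" "length w < p \<Longrightarrow> \<alpha> (sgl w) = 0"
    "length w = p \<Longrightarrow> \<alpha> (sgl w) \<in> letters V (wdeg w + d)"
  using assms unfolding coch_def by blast+

lemmas coch_hom = sym_homD[OF cochD(1)]

lemma coch_letters:
  assumes a: "coch p d \<alpha>" and x: "x \<in> sym_degree V m" "lenle V p x"
  shows "\<alpha> x \<in> letters V (m + d)"
proof (rule lettersI[OF V])
  show "\<alpha> x \<in> sym_degree V (m + d)" by (rule coch_hom(4)[OF a x(1)])
  fix k :: nat assume k: "k \<noteq> 1"
  show "lcomp V k (\<alpha> x) = 0"
  proof (rule linear_lenle_0[where h = "\<lambda>x. lcomp V k (\<alpha> x)", OF flin_comp[OF coch_hom(1)[OF a] flin_lcomp] _ x(2)])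
    show "lcomp V k (\<alpha> (sym_proj V y)) = lcomp V k (\<alpha> y)" for y by (simp add: coch_hom(2)[OF a])
    fix w :: "'v word" assume "length w \<le> p"
    then show "lcomp V k (\<alpha> (sgl w)) = 0"
      using cochD(2)[OF a, of w] letters_lcomp[OF cochD(3)[OF a, of w], of k] k
      by (cases "length w = p") (auto simp: lcomp_simps)
  qed
qed

lemma sym_hom_add:
  assumes "\<alpha> \<in> sym_hom V V d" "\<beta> \<in> sym_hom V V d"
  shows "(\<lambda>x. \<alpha> x + fscl c (\<beta> x)) \<in> sym_hom V V d"
  by (rule sym_homI) (auto intro!: flin_intros(1) flin_comp[OF sym_homD(1)[OF assms(2)] flin_scale] sym_homD(1)[OF assms(1)]
      fs.subspace_add[OF subspace_sym_degree] fs.subspace_scale[OF subspace_sym_degree]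
      sym_homD(5)[OF assms(1)] sym_homD(5)[OF assms(2)] simp: sym_homD(2)[OF assms(1)] sym_homD(2)[OF assms(2)])

lemma coch_add:
  assumes "coch p d \<alpha>" "coch p d \<beta>"
  shows "coch p d (\<lambda>x. \<alpha> x + fscl c (\<beta> x))"
  unfolding coch_def
  using sym_hom_add[OF cochD(1)[OF assms(1)] cochD(1)[OF assms(2)]] cochD(2)[OF assms(1)] cochD(2)[OF assms(2)]
  by (auto intro!: fs.subspace_add[OF subspace_letters[OF V]] fs.subspace_scale[OF subspace_letters[OF V]]
      cochD(3)[OF assms(1)] cochD(3)[OF assms(2)])

lemma closed_add:
  "closed p d \<alpha> \<Longrightarrow> closed p d \<beta> \<Longrightarrow> closed p d (\<lambda>x. \<alpha> x + fscl c (\<beta> x))"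
  unfolding closed_def by (simp add: lin_simps[OF hQ(1)] sg_add sg_fscl)

lemma exact_add:
  assumes "exact p d \<alpha>" "exact p d \<beta>"
  shows "exact p d (\<lambda>x. \<alpha> x + fscl c (\<beta> x))"
proof -
  obtain \<alpha>' where a: "coch p (d - 1) \<alpha>'" "\<And>w. length w \<le> p \<Longrightarrow> \<alpha> (sgl w) = Q (\<alpha>' (sgl w)) + sg d (\<alpha>' (Q (sgl w)))"
    using assms(1) unfolding exact_def by blast
  obtain \<beta>' where b: "coch p (d - 1) \<beta>'" "\<And>w. length w \<le> p \<Longrightarrow> \<beta> (sgl w) = Q (\<beta>' (sgl w)) + sg d (\<beta>' (Q (sgl w)))"
    using assms(2) unfolding exact_def by blast
  show ?thesis
    unfolding exact_def
    by (intro exI[of _ "\<lambda>x. \<alpha>' x + fscl c (\<beta>' x)"] conjI coch_add a(1) b(1))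
      (simp add: a(2) b(2) lin_simps[OF hQ(1)] sg_add sg_fscl fs.scale_right_distrib)
qed

lemma exact_zero: "exact p d (\<lambda>x. 0)"
proof -
  have "(\<lambda>x::('k, 'v) free. 0 :: ('k, 'v) free) \<in> sym_hom V V (d - 1)"
    using Coder_hom[OF Coder_zero] by (simp add: zero_fun_def)
  then have "coch p (d - 1) (\<lambda>x. 0)"
    using fs.subspace_0[OF subspace_letters[OF V]] by (simp add: coch_def)
  then show ?thesis
    unfolding exact_def by (intro exI[of _ "\<lambda>x. 0"]) (simp add: lin_simps[OF hQ(1)])
qed

lemma exact_cong: "exact p d \<alpha> \<Longrightarrow> (\<And>w. length w \<le> p \<Longrightarrow> \<alpha> (sgl w) = \<beta> (sgl w)) \<Longrightarrow> exact p d \<beta>"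
  unfolding exact_def by auto

lemma closed_lenle:
  assumes "coch p d \<alpha>" "closed p d \<alpha>" "lenle V p x"
  shows "Q (\<alpha> x) = sg d (\<alpha> (Q x))"
proof -
  note ha = coch_hom[OF assms(1)]
  have "Q (\<alpha> x) - sg d (\<alpha> (Q x)) = 0"
    by (rule linear_lenle_0[where h = "\<lambda>x. Q (\<alpha> x) - sg d (\<alpha> (Q x))", OF _ _ assms(3)])
      (use assms(2) in \<open>auto intro!: flin_intros(2) flin_sg flin_comp[OF ha(1) hQ(1)] flin_comp[OF hQ(1) ha(1)]
        simp: ha(2) hQ(2) closed_def\<close>)
  then show ?thesis by simp
qed

lemma lenle_add: "lenle V n x \<Longrightarrow> lenle V n y \<Longrightarrow> lenle V n (x + y)"
  by (simp add: lenle_def lcomp_simps)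

lemma coch_comp:
  assumes a: "coch p d \<alpha>" and E: "E \<in> Coder V e" "E (sgl []) = 0"
  shows "coch p (d + e) (\<lambda>x. \<alpha> (E x))"
  unfolding coch_def
proof (intro conjI allI impI)
  note ha = coch_hom[OF a] and hE = sym_homD[OF Coder_hom[OF E(1)]]
  show "(\<lambda>x. \<alpha> (E x)) \<in> sym_hom V V (d + e)"
  proof (rule sym_homI[OF flin_comp[OF hE(1) ha(1)]])
    show "\<alpha> (E (sgl w)) \<in> sym_degree V (wdeg w + (d + e))" for w
      using ha(4)[OF hE(5)[of w]] by (simp add: algebra_simps)
  qed (simp add: hE(2))
  fix w :: "'v word"
  show "\<alpha> (E (sgl w)) = 0" if "length w < p"
    by (rule linear_lenle_0[OF ha(1,2) Coder_lenle[OF E, of w]]) (use cochD(2)[OF a] that in auto)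
  show "\<alpha> (E (sgl w)) \<in> letters V (wdeg w + (d + e))" if "length w = p"
    using coch_letters[OF a hE(5)[of w]] Coder_lenle[OF E, of w] that by (simp add: algebra_simps)
qed

text \<open>The coderivation \<open>E = [Q, h]\<close> is homotopic to zero, hence so is \<open>\<alpha> E\<close> for closed \<open>\<alpha>\<close>.\<close>

lemma homotopy:
  assumes a: "coch p d \<alpha>" "closed p d \<alpha>" and h: "h \<in> Coder V (- 1)" "h (sgl []) = 0"
    and E: "\<And>x. E x = Q (h x) + h (Q x)"
  shows "exact p d (\<lambda>x. \<alpha> (E x))" "closed p d (\<lambda>x. \<alpha> (E x))"
proof -
  note ha = coch_hom[OF a(1)] and hh = sym_homD[OF Coder_hom[OF h(1)]]
  have le: "lenle V p (sgl w)" if "length w \<le> p" for w :: "'v word" using that by (rule lenle_sgl)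
  have lh: "lenle V p (h x)" if "lenle V p x" for x by (rule Coder_lenle_image[OF h that])
  \<comment> \<open>The primitive is (-1)^d \<alpha> h: closedness moves Q past \<alpha> at the cost
    of (-1)^d, so both summands of \<alpha> E come out with sign +1. The summand 0 gives it the
    shape of \<open>coch_add\<close>.\<close>
  let ?b = "\<lambda>x. 0 + fscl ((-1) powi d) (\<alpha> (h x))"
  have "coch p (d - 1) (\<lambda>x. \<alpha> (h x))"
    using coch_comp[OF a(1) h] by simp
  moreover have "coch p (d - 1) (\<lambda>x. 0)"
    using Coder_hom[OF Coder_zero] fs.subspace_0[OF subspace_letters[OF V]] by (simp add: coch_def zero_fun_def)
  ultimately have "coch p (d - 1) ?b" by (intro coch_add)
  moreover have "\<alpha> (E (sgl w)) = Q (?b (sgl w)) + sg d (?b (Q (sgl w)))" if "length w \<le> p" for w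
    by (simp add: E fscl_powi lin_simps[OF hQ(1)] lin_sg[OF hQ(1)] closed_lenle[OF a lh[OF le[OF that]]] lin_simps[OF ha(1)])
  ultimately show "exact p d (\<lambda>x. \<alpha> (E x))"
    unfolding exact_def by blast
  show "closed p d (\<lambda>x. \<alpha> (E x))"
    unfolding closed_def
  proof (intro allI impI)
    fix w :: "'v word" assume "length w \<le> p"
    then have "lenle V p (E (sgl w))"
      unfolding E by (intro lenle_add Q_lenle lh le)
    then show "Q (\<alpha> (E (sgl w))) = sg d (\<alpha> (E (Q (sgl w))))"
      by (simp add: closed_lenle[OF a] E Q_Q lin_simps[OF hQ(1)] lin_simps[OF hh(1)])
  qed
qed

text \<open>Here \<beta> is \<alpha> (E - 1) ... (E - k). Modulo exact cochains E acts as 0, so each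
  factor contributes -(i + 1); on words with letters in S it acts through the eigenvalue of the word
  minus i + 1.\<close>

lemma homotopy_iterate:
  assumes a: "coch p d \<alpha>" "closed p d \<alpha>" and h: "h \<in> Coder V (- 1)" "h (sgl []) = 0"
    and E: "\<And>x. E x = Q (h x) + h (Q x)" "E \<in> Coder V 0" "E (sgl []) = 0"
    and c: "\<And>a. a \<in> S \<Longrightarrow> E (sgl [a]) = fscl (c a) (sym_proj V (sgl [a]))"
  shows "\<exists>\<beta>. coch p d \<beta> \<and> closed p d \<beta> \<and> exact p d (\<lambda>x. \<beta> x + fscl (- ((-1) ^ k * fact k)) (\<alpha> x)) \<and>
     (\<forall>w. set w \<subseteq> S \<longrightarrow> length w = p \<longrightarrow> \<beta> (sgl w) = fscl (\<Prod>i<k. sum_list (map c w) - of_nat (Suc i)) (\<alpha> (sgl w)))"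
proof (induction k)
  case 0
  show ?case
    by (rule exI[of _ \<alpha>]) (use a in \<open>simp add: exact_cong[OF exact_zero]\<close>)
next
  case (Suc k)
  then obtain \<beta> where b: "coch p d \<beta>" "closed p d \<beta>" "exact p d (\<lambda>x. \<beta> x + fscl (- ((-1) ^ k * fact k)) (\<alpha> x))"
    "\<And>w. set w \<subseteq> S \<Longrightarrow> length w = p \<Longrightarrow> \<beta> (sgl w) = fscl (\<Prod>i<k. sum_list (map c w) - of_nat (Suc i)) (\<alpha> (sgl w))"
    by blast
  note hb = coch_hom[OF b(1)]
  \<comment> \<open>The next factor: \<beta> (E - (k + 1)).\<close>
  let ?\<gamma> = "\<lambda>x. \<beta> (E x) + fscl (- of_nat (Suc k)) (\<beta> x)"
  have coch: "coch p d (\<lambda>x. \<beta> (E x))"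
    using coch_comp[OF b(1) E(2,3)] by simp
  show ?case
  proof (intro exI[of _ ?\<gamma>] conjI allI impI)
    show "coch p d ?\<gamma>" by (rule coch_add[OF coch b(1)])
    show "closed p d ?\<gamma>" by (rule closed_add[OF homotopy(2)[OF b(1,2) h E(1)] b(2)])
    have ck: "- of_nat (Suc k) * - ((-1) ^ k * fact k) = (- ((-1) ^ Suc k * fact (Suc k)) :: 'k)"
      by (simp add: algebra_simps)
    have "exact p d (\<lambda>x. \<beta> (E x) + fscl (- of_nat (Suc k)) (\<beta> x + fscl (- ((-1) ^ k * fact k)) (\<alpha> x)))"
      by (rule exact_add[OF homotopy(1)[OF b(1,2) h E(1)] b(3)])
    then show "exact p d (\<lambda>x. ?\<gamma> x + fscl (- ((-1) ^ Suc k * fact (Suc k))) (\<alpha> x))"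
      unfolding fs.scale_right_distrib fs.scale_scale ck add.assoc .
    fix w assume w: "set w \<subseteq> S" "length w = p"
    \<comment> \<open>E reproduces w up to shorter words, and \<beta> kills those; hence only the
      eigenvalue on the leading term counts.\<close>
    have "\<beta> (E (sgl w)) = \<beta> (lcomp V p (E (sgl w)))"
      using Coder_lenle[OF E(2,3), of w] cochD(2)[OF b(1)] w(2)
      by (intro linear_lenle[where h = \<beta>, OF hb(1,2)]) auto
    also have "lcomp V p (E (sgl w)) = fscl (sum_list (map c w)) (sym_proj V (sgl w))"
      unfolding w(2)[symmetric] by (rule Coder_leading[OF E(2,3)]) (use c w(1) in auto)
    also have "\<beta> \<dots> = fscl (sum_list (map c w)) (\<beta> (sgl w))"
      by (simp add: lin_simps[OF hb(1)] hb(2))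
    finally have "?\<gamma> (sgl w) = fscl (sum_list (map c w) - of_nat (Suc k)) (\<beta> (sgl w))"
      by (simp add: fs.scale_left_diff_distrib del: of_nat_Suc)
    then show "?\<gamma> (sgl w) = fscl (\<Prod>i<Suc k. sum_list (map c w) - of_nat (Suc i)) (\<alpha> (sgl w))"
      by (simp add: b(4)[OF w] mult.commute)
  qed
qed

subsection \<open>A section of the linear part of \<open>Q\<close>\<close>

text \<open>A homogeneous map shifts homogeneous components. This allows a section of Q chosen
  without regard to degree to be cut down to a graded one.\<close>

lemma sym_hom_degree_proj:
  assumes h: "h \<in> sym_hom V W d"
  shows "h (sym_proj V (word_proj (\<lambda>w. wdeg w = n) x)) = sym_proj W (word_proj (\<lambda>w. wdeg w = n + d) (h x))"
proof -
  note hh = sym_homD[OF h]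
  have "h (word_proj (\<lambda>w. wdeg w = n) x) = sym_proj W (word_proj (\<lambda>w. wdeg w = n + d) (h x))"
  proof (rule linear_ext_sgl'[OF flin_comp[OF flin_word_proj hh(1)]
        flin_comp[OF flin_comp[OF hh(1) flin_word_proj] sym_proj_props(1)]])
    fix w
    let ?p = "\<lambda>m. word_proj (\<lambda>w. wdeg w = m)"
    have hw: "sym_proj W (?p (wdeg w + d) (h (sgl w))) = h (sgl w)"
      using hh(5)[of w] by (simp add: sym_degree_iff)
    show "h (?p n (sgl w)) = sym_proj W (?p (n + d) (h (sgl w)))"
    proof (cases "wdeg w = n")
      case False
      have "sym_proj W (?p (n + d) (sym_proj W (?p (wdeg w + d) (h (sgl w))))) =
         sym_proj W (word_proj (\<lambda>u. wdeg u = n + d \<and> wdeg u = wdeg w + d) (h (sgl w)))"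
        unfolding sym_proj_word_proj[OF label_predI(1)] word_proj_word_proj ..
      also have "(\<lambda>u::'b word. wdeg u = n + d \<and> wdeg u = wdeg w + d) = (\<lambda>u. False)"
        using False by auto
      also have "word_proj (\<lambda>u. False) (h (sgl w)) = 0"
        by (rule linear_ext_sgl'[OF flin_word_proj flin_zero]) simp
      finally show ?thesis using False by (simp add: hw lin_simps[OF hh(1)])
    next
      case True
      then show ?thesis using hw by simp
    qed
  qed
  then show ?thesis by (simp add: hh(2))
qed

text \<open>The total degree is the same for all words of a relator, so the linear map applied may
  depend on it.\<close>

lemma sym_fun_wdeg:
  assumes f: "sym_fun V fscl f" and L: "\<And>n. flin (L n)"
  shows "sym_fun V fscl (\<lambda>w. L (wdeg w) (f w))"
  unfolding sym_fun_def
proof (intro conjI allI impI)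
  fix u n x y t b c assume "x \<in> part V n" "y \<in> part V n"
  then show "L (wdeg (u @ (n, scl V b x + scl V c y) # t)) (f (u @ (n, scl V b x + scl V c y) # t)) =
      fscl b (L (wdeg (u @ (n, x) # t)) (f (u @ (n, x) # t))) + fscl c (L (wdeg (u @ (n, y) # t)) (f (u @ (n, y) # t)))"
    by (simp add: sym_funD(2)[OF f] lin_simps[OF L])
next
  fix u m x n y t assume "x \<in> part V m" "y \<in> part V n"
  then show "L (wdeg (u @ (m, x) # (n, y) # t)) (f (u @ (m, x) # (n, y) # t)) =
      sg (m * n) (L (wdeg (u @ (n, y) # (m, x) # t)) (f (u @ (n, y) # (m, x) # t)))"
    using sym_funD(3)[OF f, of x m y n u t] by (simp add: lin_sg[OF L] add.left_commute)
qed (simp add: sym_funD(1)[OF f] lin_simps[OF L])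

text \<open>A linear right inverse of the linear part of Q on its range. With it, being a boundary
  becomes the linear equation Q (\<sigma> y) = y for letters y, and primitives are chosen
  linearly.\<close>

lemma Q_section:
  "\<exists>\<sigma>\<in>sym_hom V V (- 1). (\<forall>m. \<forall>x\<in>letters V m. \<sigma> x \<in> letters V (m - 1)) \<and>
     (\<forall>m. \<forall>z\<in>letters V (m - 1). Q (\<sigma> (Q z)) = Q z)"
proof -
  define q where "q x = Q (lcomp V 1 x)" for x
  have linq: "flin q" unfolding q_def by (rule flin_comp[OF flin_lcomp hQ(1)])
  obtain s where s: "flin s" "\<And>v. v \<in> range q \<Longrightarrow> q (s v) = v"
    using fsp.linear_exists_right_inverse_on[OF linq fs.subspace_UNIV] by auto
  let ?p = "\<lambda>m. word_proj (\<lambda>u. length u = 1 \<and> wdeg u = m)"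
  \<comment> \<open>The right inverse s respects neither length nor degree. Truncating to letters of
    degree n - 1 repairs this and, as Q is homogeneous, it remains a right inverse on boundaries of
    degree n.\<close>
  define L where "L n x = sym_proj V (?p (n - 1) (s x))" for n x
  define \<sigma> where "\<sigma> = linext fscl (\<lambda>w. if length w = 1 then L (wdeg w) (sym_proj V (sgl w)) else 0)"
  have linL: "flin (L n)" for n
    unfolding L_def by (intro flin_comp[OF flin_comp[OF s(1) flin_word_proj] sym_proj_props(1)])
  have lin\<sigma>: "flin \<sigma>" by (simp add: \<sigma>_def)
  have "sym_fun V fscl (\<lambda>w. if length w = 1 then L (wdeg w) (sym_proj V (sgl w)) else 0)"
    by (rule sym_fun_if[OF sym_fun_wdeg[OF sym_fun_sym_proj linL] label_predI(2)])
  then have "sym_fun V fscl (\<lambda>w. \<sigma> (sgl w))" by (simp add: \<sigma>_def)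
  then have P\<sigma>: "\<sigma> (sym_proj V x) = \<sigma> x" for x
    by (rule linear_sym_proj[OF lin\<sigma>])
  have \<sigma>L: "\<sigma> x = L m x" if x: "x \<in> letters V m" for x m
  proof -
    obtain v where "x = sym_proj V (sgl [(m, v)])" using x unfolding letters_def by blast
    moreover have "\<sigma> (sgl [(m, v)]) = L m (sym_proj V (sgl [(m, v)]))" by (simp add: \<sigma>_def)
    ultimately show ?thesis by (simp add: P\<sigma>)
  qed
  have lab: "label_pred (\<lambda>u::'v word. length u = 1 \<and> wdeg u = m)" for m by (intro label_predI)
  have L: "L m x \<in> letters V (m - 1)" for m x
    unfolding L_def letters_iff[OF V] sym_proj_word_proj[OF lab] word_proj_word_proj by simp
  have "Q (L m (Q z)) = Q z" if z: "z \<in> letters V (m - 1)" for z m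
  proof -
    define y where "y = Q z"
    have y: "y \<in> letters V m" unfolding y_def using Q_letters[OF z] by simp
    have "q z = y" unfolding q_def y_def using letters_lcomp[OF z, of 1] by simp
    then have qs: "Q (lcomp V 1 (s y)) = y"
      using s(2)[of y] by (auto simp: q_def)
    have "L m y = sym_proj V (word_proj (\<lambda>w. wdeg w = m - 1) (lcomp V 1 (s y)))"
      unfolding L_def lcomp_def sym_proj_word_proj[OF label_predI(1)] word_proj_word_proj by (simp add: conj_commute)
    then have "Q (L m y) = sym_proj V (word_proj (\<lambda>w. wdeg w = m - 1 + 1) y)"
      by (simp only: sym_hom_degree_proj[OF Coder_hom[OF Q]] qs)
    also have "\<dots> = y"
      using letters_degree[OF y] by (simp add: sym_degree_iff)
    finally show ?thesis by (simp add: y_def)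
  qed
  moreover have "\<sigma> (Q z) = L m (Q z)" if "z \<in> letters V (m - 1)" for z m
    using Q_letters[OF that] by (intro \<sigma>L) simp
  ultimately have "Q (\<sigma> (Q z)) = Q z" if "z \<in> letters V (m - 1)" for z m
    using that by metis
  moreover have "\<sigma> \<in> sym_hom V V (- 1)"
  proof (rule sym_homI[OF lin\<sigma> P\<sigma>])
    fix w
    show "\<sigma> (sgl w) \<in> sym_degree V (wdeg w + - 1)"
      using letters_degree[OF L[of "wdeg w" "sym_proj V (sgl w)"]] fs.subspace_0[OF subspace_sym_degree[of V "wdeg w - 1"]]
      by (simp add: \<sigma>_def)
  qed
  ultimately show ?thesis
    using \<sigma>L L by (intro bexI[of _ \<sigma>]) simp_all
qed

end


section \<open>Minimal models\<close>

lemma linear_eq_lenle: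
  assumes h: "flin h" "\<And>x. h (sym_proj V x) = h x" and h': "flin h'" "\<And>x. h' (sym_proj V x) = h' x"
    and x: "lenle V n x" and eq: "\<And>w. length w \<le> n \<Longrightarrow> h (sgl w) = h' (sgl w)"
  shows "h x = h' x"
proof -
  have "h x - h' x = 0"
    by (rule linear_lenle_0[where h = "\<lambda>x. h x - h' x", OF flin_intros(2)[OF h(1) h'(1)] _ x])
      (simp_all add: h(2) h'(2) eq)
  then show ?thesis by simp
qed

text \<open>By multilinearity a word is a sum of words with all letters in S, once every letter is a
  sum of two letters of S.\<close>

lemma linear_special_words:
  assumes V: "graded_vector_space V" and h: "flin h" "\<And>x. h (sym_proj V x) = h x"
    and split: "\<And>n x. x \<in> part V n \<Longrightarrow> \<exists>y\<in>part V n. (n, y) \<in> S \<and> (n, x - y) \<in> S"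
    and S: "\<And>w. \<lbrakk>valid_word V w; set w \<subseteq> S; length w = p\<rbrakk> \<Longrightarrow> h (sgl w) = 0"
    and len: "length w = p"
  shows "h (sgl w) = 0"
proof (cases "valid_word V w")
  case True
  interpret vs: vector_space "scl V" by (rule vector_space_scl[OF V])
  note sf = sym_fun_linear[OF h]
  \<comment> \<open>The prefix u holds the letters already split.\<close>
  have "h (sgl (u @ v)) = 0" if "valid_word V (u @ v)" "set u \<subseteq> S" "length (u @ v) = p" for u v
    using that
  proof (induction v arbitrary: u)
    case Nil
    then show ?case using S[of u] by simp
  next
    case (Cons a v)
    obtain n x where a: "a = (n, x)" by (cases a)
    have x: "x \<in> part V n" using Cons.prems a by simp
    obtain y where y: "y \<in> part V n" "(n, y) \<in> S" "(n, x - y) \<in> S" using split[OF x] by blast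
    have xy: "x - y \<in> part V n" by (rule part_simps(3)[OF V x y(1)])
    have "h (sgl (u @ (n, y) # v)) = 0"
      using Cons.IH[of "u @ [(n, y)]"] Cons.prems y by (simp add: a)
    moreover have "h (sgl (u @ (n, x - y) # v)) = 0"
      using Cons.IH[of "u @ [(n, x - y)]"] Cons.prems y xy by (simp add: a)
    moreover have "h (sgl (u @ (n, scl V 1 y + scl V 1 (x - y)) # v)) =
        fscl 1 (h (sgl (u @ (n, y) # v))) + fscl 1 (h (sgl (u @ (n, x - y) # v)))"
      by (rule sym_funD(2)[OF sf y(1) xy])
    ultimately show ?case by (simp add: a)
  qed
  from this[of "[]" w] show ?thesis using True len by simp
next
  case False
  then show ?thesis by (rule sym_funD(1)[OF sym_fun_linear[OF h]])
qed

section \<open>The two morphisms between an algebra and its minimal model\<close>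

locale minimal_model =
  V: Linf V Q + W: Linf W R
  for V :: "('k::field_char_0, 'v::ab_group_add) graded_space" and Q :: "('k, 'v) endo"
    and W :: "('k, 'w::ab_group_add) graded_space" and R :: "('k, 'w) endo" +
  fixes f :: "('k, 'v) free \<Rightarrow> ('k, 'w) free" and g :: "('k, 'w) free \<Rightarrow> ('k, 'v) free"
  assumes min: "minimal_Linf W R" and f_weq: "weak_equivalence V Q W R f"
    and g_mor: "Linf_morphism W R V Q g" and fg_id: "\<forall>x\<in>sym_coalg W. f (g x) = x"
begin

lemma f_mor: "coalg_morphism V W f" and g_mor': "coalg_morphism W V g"
  using f_weq g_mor by (auto simp: weak_equivalence_def Linf_morphism_def)

lemmas hf = sym_homD[OF coalg_morphism_hom[OF f_mor]] and hg = sym_homD[OF coalg_morphism_hom[OF g_mor']]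

lemmas f_lenle = coalg_morphism_lenle_image[OF f_mor] and g_lenle = coalg_morphism_lenle_image[OF g_mor']

lemmas f_letters = coalg_morphism_letters[OF f_mor W.V] and g_letters = coalg_morphism_letters[OF g_mor' V.V]

lemma fg: "f (g x) = sym_proj W x"
proof -
  have "f (g (sym_proj W x)) = sym_proj W x"
    using fg_id by (rule bspec) (simp add: sym_coalg_iff)
  then show ?thesis by (simp only: hg(2))
qed

lemma f_Q: "f (Q x) = R (f x)"
proof -
  have "f (Q (sym_proj V x)) = R (f (sym_proj V x))"
    using f_weq unfolding weak_equivalence_def Linf_morphism_def
    by (elim conjE, elim bspec) (simp add: sym_coalg_iff)
  then show ?thesis by (simp only: hf(2) V.hQ(2))
qed

lemma g_R: "g (R x) = Q (g x)"
proof -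
  have "g (R (sym_proj W x)) = Q (g (sym_proj W x))"
    using g_mor unfolding Linf_morphism_def
    by (elim conjE, elim bspec) (simp add: sym_coalg_iff)
  then show ?thesis by (simp only: hg(2) W.hQ(2))
qed

lemma R_letters:
  assumes "x \<in> letters W n"
  shows "R x = 0"
proof -
  obtain v where v: "v \<in> part W n" "x = sym_proj W (sgl [(n, v)])" using assms unfolding letters_def by blast
  have "lin_part W W 1 R n v = 0" using min v(1) unfolding minimal_Linf_def by blast
  then show ?thesis
    using W.lin_part_Q(2)[OF v(1)] by (simp add: v(2) letter_simps(1)[OF W.V])
qed

text \<open>The linear part of R is zero, so its action on leading terms is a derivation with all
  eigenvalues 0: R strictly lowers word length.\<close>

lemma R_leading: "lcomp W (length w) (R (sgl w)) = 0"
proof -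
  have "R (sgl [a]) = fscl 0 (sym_proj W (sgl [a]))" for a
  proof (cases "valid_word W [a]")
    case True
    then have "sym_proj W (sgl [a]) \<in> letters W (fst a)" by (cases a) (auto simp: letters_def)
    from R_letters[OF this] show ?thesis by (simp add: W.hQ(2))
  qed (simp add: W.hQ(6))
  then have "lcomp W (length w) (R (sgl w)) = fscl (sum_list (map (\<lambda>a. 0) w)) (sym_proj W (sgl w))"
    by (intro Coder_leading[OF W.Q W.Q_Nil]) simp_all
  then show ?thesis by (simp add: sum_list_0)
qed

text \<open>The kernel of the linear part of \<open>f\<close> is acyclic.\<close>

lemma acyclic:
  assumes y: "y \<in> letters V m" "Q y = 0" "f y = 0"
  shows "\<exists>z\<in>letters V (m - 1). Q z = y"
proof -
  obtain v where v: "v \<in> part V m" "y = sym_proj V (sgl [(m, v)])" using y(1) unfolding letters_def by blast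
  let ?m = "\<lambda>h. coh_class W R m (lin_part V W 0 f m h)"
  have lp: "lin_part V W 0 f m h = 0" if "h \<in> part V m" "f (sym_proj V (sgl [(m, h)])) = 0" for h
    using that(2) by (simp add: lin_part_def smono_def corestr_def linext_def)
  define h where "h = coh_class V Q m v"
  have h: "h \<in> tangent_coh V Q m"
    unfolding h_def by (rule V.coh_class_in_tangent_coh[OF v(1)]) (use y v in simp)
  note hp = V.tangent_cohD(1)[OF h]
  have hv: "h - v \<in> coboundaries V Q m" unfolding h_def by (rule V.coh_class_facts(4))
  note hvp = V.coboundaries_part[OF hv]
  obtain z where z: "z \<in> letters V (m - 1)" "Q z = sym_proj V (sgl [(m, h - v)])"
    using hv unfolding V.coboundaries_iff[OF hvp] by blast
  \<comment> \<open>Injectivity on cohomology concerns the chosen representative h, which differs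
    from v by a boundary Q z. As f (Q z) = R (f z) and R vanishes on letters, h is still in the
    kernel of f.\<close>
  have "f (sym_proj V (sgl [(m, h)]) - y) = R (f z)"
    unfolding f_Q[symmetric] z(2) letter_simps(3)[OF V.V hp v(1)] v(2) ..
  also have "\<dots> = 0" by (rule R_letters[OF f_letters[OF z(1)]])
  finally have "f (sym_proj V (sgl [(m, h)])) = 0"
    using y(3) by (simp only: lin_simps[OF hf(1)] diff_0_right)
  then have "lin_part V W 0 f m h = 0" by (rule lp[OF hp])
  moreover have 0: "0 \<in> tangent_coh V Q m"
  proof -
    have "coh_class V Q m 0 \<in> tangent_coh V Q m"
      by (rule V.coh_class_in_tangent_coh[OF part_simps(1)[OF V.V]]) (simp add: letter_simps(1)[OF V.V] lin_simps[OF V.hQ(1)])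
    moreover have "coh_class V Q m 0 = 0"
      using V.coh_class_facts(1)[of m 0 0] by simp
    ultimately show ?thesis by simp
  qed
  have "lin_part V W 0 f m 0 = 0"
    by (rule lp[OF part_simps(1)[OF V.V]]) (simp add: letter_simps(1)[OF V.V] lin_simps[OF hf(1)])
  moreover have "inj_on ?m (tangent_coh V Q m)"
    using f_weq unfolding weak_equivalence_def bij_betw_def by blast
  ultimately have "h = 0"
    using h 0 by (intro inj_onD[of ?m "tangent_coh V Q m" h 0]) simp_all
  then have "v \<in> coboundaries V Q m"
    unfolding h_def by (simp add: V.coh_class_facts(6))
  then show ?thesis
    unfolding V.coboundaries_iff[OF v(1)] v(2) .
qed

section \<open>The induced map of Chevalley-Eilenberg complexes and surjectivity on E_1\<close>

definition \<Phi> :: "('k, 'v) endo \<Rightarrow> ('k, 'w) endo" where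
  "\<Phi> \<alpha> = (\<lambda>x. f (\<alpha> (g x)))"

sublocale CE: filtered_complex_map escl "Coder V" "CE_filt V" "CE_diff Q" escl "Coder W" "CE_filt W" "CE_diff R" \<Phi>
proof unfold_locales
  show "\<Phi> (x + y) = \<Phi> x + \<Phi> y" for x y
    by (rule ext) (simp add: \<Phi>_def lin_simps[OF hf(1)])
  show "\<Phi> (escl c x) = escl c (\<Phi> x)" for c x
    by (rule ext) (simp add: \<Phi>_def pscl_def lin_simps[OF hf(1)])
  fix x n assume x: "x \<in> Coder V n"
  show C: "\<Phi> x \<in> Coder W n"
    unfolding \<Phi>_def by (rule conj_Coder[OF f_mor g_mor' fg x])
  show "\<Phi> (CE_diff Q n x) = CE_diff R n (\<Phi> x)"
    by (rule ext) (simp add: \<Phi>_def CE_diff_def lin_simps[OF hf(1)] f_Q g_R)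
  note hx = sym_homD[OF Coder_hom[OF x]]
  fix p assume "x \<in> CE_filt V p"
  then have F: "x (sgl w) = 0" if "valid_word V w" "int (length w) < p" for w
    using that CE_filt_iff[OF Coder_hom[OF x]] by blast
  show "\<Phi> x \<in> CE_filt W p"
    unfolding CE_filt_iff[OF Coder_hom[OF C]]
  proof (intro allI impI)
    fix w :: "'w word" assume w: "int (length w) < p"
    have "x (g (sgl w)) = 0"
      by (rule linear_lenle_0[where h = x, OF hx(1,2) coalg_morphism_lenle[OF g_mor', of w]]) (use F w in auto)
    then show "\<Phi> x (sgl w) = 0" by (simp add: \<Phi>_def lin_simps[OF hf(1)])
  qed
qed

lemma CE_filt_0: "p \<le> 0 \<Longrightarrow> CE_filt V' p = UNIV"
  by (auto simp: CE_filt_def)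

lemma coder_coch:
  assumes "Linf U P" "\<alpha> \<in> Coder U n" "\<alpha> \<in> CE_filt U (int p)"
  shows "Linf.coch U p n \<alpha>"
proof -
  interpret U: Linf U P by fact
  have 0: "\<alpha> (sgl w) = 0" if "length w < p" for w
    using that assms(3) CE_filt_iff[OF Coder_hom[OF assms(2)]] sym_homD(6)[OF Coder_hom[OF assms(2)], of w]
    by (cases "valid_word U w") auto
  then show ?thesis
    unfolding U.coch_def using Coder_hom[OF assms(2)]
    by (intro conjI allI impI Coder_letters[OF assms(2) U.V]) auto
qed

text \<open>On words of length p, \<beta> takes values in letters, which R kills; and R yields only
  shorter words, which \<beta> kills. So d_0 is zero for a minimal algebra.\<close>

lemma minimal_CE_diff:
  assumes b: "\<beta> \<in> Coder W n" "\<beta> \<in> CE_filt W p"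
  shows "CE_diff R n \<beta> \<in> CE_filt W (p + 1)"
proof (cases "p < 0")
  case False
  note hb = sym_homD[OF Coder_hom[OF b(1)]]
  have 0: "\<beta> (sgl w) = 0" if "valid_word W w" "int (length w) < p" for w
    using that b CE_filt_iff[OF Coder_hom[OF b(1)]] by blast
  show ?thesis
    unfolding CE_filt_iff[OF Coder_hom[OF CE_diff_Coder[OF W.Q b(1)]]]
  proof (intro allI impI)
    fix w assume w: "valid_word W w" "int (length w) < p + 1"
    have "\<beta> (sgl w) \<in> letters W (wdeg w + n)"
      by (rule Coder_letters[OF b(1) W.V]) (use 0 w in auto)
    then have "R (\<beta> (sgl w)) = 0" by (rule R_letters)
    moreover have "\<beta> (R (sgl w)) = \<beta> (lcomp W (length w) (R (sgl w)))"
      by (rule linear_lenle[where h = \<beta>, OF hb(1,2) W.Q_lenle[OF lenle_sgl[OF order_refl]]]) (use 0 w in auto)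
    ultimately show "CE_diff R n \<beta> (sgl w) = 0"
      by (simp add: CE_diff_def R_leading lin_simps[OF hb(1)])
  qed
qed (simp add: CE_filt_0)

text \<open>Together with \<open>B_W_filt\<close> this identifies the denominators of E_1 for W with
  F^(p+1), so classes there are compared by values on words of length p.\<close>

lemma in_B_W:
  assumes "x \<in> Coder W n" "x \<in> CE_filt W (p + 1)"
  shows "x \<in> W.CE.B 1 p n"
  using assms W.CE.d_F[OF assms] by (intro W.CE.BI1) (simp add: W.CE.Z_def)

lemma B_W_filt:
  assumes "x \<in> W.CE.B 1 p n"
  shows "x \<in> CE_filt W (p + 1)"
proof -
  obtain a b where a: "a \<in> W.CE.Z (int 1 - 1) (p + 1) n" and b: "b \<in> W.CE.Z (int 1 - 1) (p - int 1 + 1) (n - 1)"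
    and x: "x = a + CE_diff R (n - 1) b" by (rule W.CE.BE[OF assms])
  show ?thesis
    unfolding x using W.CE.ZD(2)[OF a] minimal_CE_diff[OF W.CE.ZD(1,2)[OF b]]
    by (intro W.CE.subspace_add[OF W.CE.subspace_F]) simp_all
qed

text \<open>Up to length k the constructed \<alpha> agrees with g z f. Its differential is then g (d
  z) f, which vanishes there, and f \<alpha> g agrees with f g z f g, which is z.\<close>

lemma epic_1: "CE.epic 1"
  unfolding CE.epic_def
proof (intro allI ballI)
  fix p n z assume z: "z \<in> W.CE.Z (int 1) p n"
  note zC = W.CE.ZD(1)[OF z] and zF = W.CE.ZD(2)[OF z] and dzF = W.CE.ZD(3)[OF z]
  show "\<exists>y\<in>V.CE.Z (int 1) p n. z - \<Phi> y \<in> W.CE.B 1 p n"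
  \<comment> \<open>For negative p both F^p and F^(p+1) are everything, so the E_1 term is
    zero.\<close>
  proof (cases "p < 0")
    case True
    have "\<Phi> 0 = 0"
      by (rule ext) (simp add: \<Phi>_def lin_simps[OF hf(1)])
    then have "z - \<Phi> 0 \<in> W.CE.B 1 p n"
      using zC True by (intro in_B_W) (simp_all add: CE_filt_0)
    then show ?thesis using V.CE.subspace_0[OF V.CE.subspace_Z] by blast
  next
    case False
    then obtain k where p: "p = int k" by (metis nonneg_int_cases not_less)
    note hz = sym_homD[OF Coder_hom[OF zC]]
    have zcoch: "W.coch k n z"
      by (rule coder_coch[OF W.Linf_axioms zC]) (use zF in \<open>simp add: p\<close>)
    \<comment> \<open>This map is a coderivation over g f and not over the identity, so only its
      part on words of length k is kept and extended.\<close>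
    let ?\<psi> = "\<lambda>x. g (z (f x))"
    have lin: "flin ?\<psi>" by (rule flin_comp[OF flin_comp[OF hf(1) hz(1)] hg(1)])
    have P: "?\<psi> (sym_proj V x) = ?\<psi> x" for x by (simp add: hf(2))
    have let': "?\<psi> (sgl w) \<in> letters V (wdeg w + n)" if "length w = k" for w
      using coalg_morphism_lenle[OF f_mor, of w] hf(5)[of w] that
      by (intro g_letters W.coch_letters[OF zcoch]) simp_all
    have short: "?\<psi> (sgl w) = 0" if "length w < k" for w
    proof -
      have "z (f (sgl w)) = 0"
        by (rule linear_lenle_0[where h = z, OF hz(1,2) coalg_morphism_lenle[OF f_mor]])
          (use W.cochD(2)[OF zcoch] that in auto)
      then show ?thesis by (simp add: lin_simps[OF hg(1)])
    qed
    obtain \<alpha> where \<alpha>: "\<alpha> \<in> Coder V n" "\<And>w. length w < k \<Longrightarrow> \<alpha> (sgl w) = 0" "\<And>w. length w = k \<Longrightarrow> \<alpha> (sgl w) = ?\<psi> (sgl w)"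
      using Coder_extension[OF lin P let' V.V] by blast
    note ha = sym_homD[OF Coder_hom[OF \<alpha>(1)]]
    have eq: "\<alpha> x = ?\<psi> x" if "lenle V k x" for x
    proof (rule linear_eq_lenle[where h = \<alpha> and h' = ?\<psi>, OF ha(1,2) lin P that])
      fix w :: "'v word" assume "length w \<le> k"
      then show "\<alpha> (sgl w) = ?\<psi> (sgl w)"
        using \<alpha>(2,3)[of w] short[of w] by (cases "length w = k") auto
    qed
    have \<alpha>F: "\<alpha> \<in> CE_filt V p"
      unfolding CE_filt_iff[OF Coder_hom[OF \<alpha>(1)]] using \<alpha>(2) by (simp add: p)
    have d\<alpha>: "CE_diff Q n \<alpha> \<in> CE_filt V (p + 1)"
      unfolding CE_filt_iff[OF Coder_hom[OF CE_diff_Coder[OF V.Q \<alpha>(1)]]]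
    proof (intro allI impI)
      fix w :: "'v word" assume "int (length w) < p + 1"
      then have le: "lenle V k (sgl w)" by (intro lenle_sgl) (simp add: p)
      have "CE_diff Q n \<alpha> (sgl w) = g (CE_diff R n z (f (sgl w)))"
        by (simp add: CE_diff_def eq[OF le] eq[OF V.Q_lenle[OF le]] f_Q g_R lin_simps[OF hg(1)])
      also have "CE_diff R n z (f (sgl w)) = 0"
      proof -
        note hd = sym_homD[OF Coder_hom[OF CE_diff_Coder[OF W.Q zC]]]
        have "CE_diff R n z (sgl u) = 0" if "valid_word W u" "length u \<le> k" for u
          using dzF that CE_filt_iff[OF Coder_hom[OF CE_diff_Coder[OF W.Q zC]]] by (simp add: p)
        then show ?thesis
          by (rule linear_lenle_0[where h = "CE_diff R n z", OF hd(1,2) f_lenle[OF le], rotated])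
      qed
      finally show "CE_diff Q n \<alpha> (sgl w) = 0" by (simp add: lin_simps[OF hg(1)])
    qed
    have dC: "z - \<Phi> \<alpha> \<in> Coder W n"
      by (rule W.CE.subspace_diff[OF W.CE.subspace_C zC CE.Phi_C[OF \<alpha>(1)]])
    moreover have "z - \<Phi> \<alpha> \<in> CE_filt W (p + 1)"
      unfolding CE_filt_iff[OF Coder_hom[OF dC]]
    proof (intro allI impI)
      fix w :: "'w word" assume "int (length w) < p + 1"
      then have "lenle W k (sgl w)" by (intro lenle_sgl) (simp add: p)
      then show "(z - \<Phi> \<alpha>) (sgl w) = 0"
        by (simp add: \<Phi>_def eq[OF g_lenle] fg hz(2,3))
    qed
    ultimately have "z - \<Phi> \<alpha> \<in> W.CE.B 1 p n" by (rule in_B_W)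
    then show ?thesis using \<alpha>(1) \<alpha>F d\<alpha> by (auto simp: V.CE.Z_def)
  qed
qed

end


section \<open>Splitting off the kernel of f, and injectivity on E_1\<close>

context minimal_model
begin

text \<open>The linear part of g on labelled letters. A letter outside its graded part represents 0
  in the coalgebra and gets the default 0, so that the formula for g holds for every letter.\<close>

definition g_letter :: "int \<times> 'w \<Rightarrow> int \<times> 'v" where
  "g_letter b = (fst b, if snd b \<in> part W (fst b) then lin_part W V 0 g (fst b) (snd b) else 0)"

lemma g_letter: "g (sgl [b]) = sym_proj V (sgl [g_letter b])" "snd (g_letter b) \<in> part V (fst b)"
proof -
  have "g (sgl [b]) = sym_proj V (sgl [g_letter b]) \<and> snd (g_letter b) \<in> part V (fst b)"
  proof (cases "snd b \<in> part W (fst b)")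
    case True
    have "g (smono W [(fst b, snd b)]) \<in> letters V (fst b + 0)"
      unfolding smono_def using True by (intro g_letters) (cases b, auto simp: letters_def)
    from lin_part_letter[where f = g and d = 0, OF V.V this] show ?thesis
      using True by (simp add: g_letter_def hg(2))
  next
    case False
    then have "\<not> valid_word W [b]" by simp
    then show ?thesis
      using False by (simp add: g_letter_def hg(6) letter_simps(1)[OF V.V] part_simps(1)[OF V.V])
  qed
  then show "g (sgl [b]) = sym_proj V (sgl [g_letter b])" "snd (g_letter b) \<in> part V (fst b)" by auto
qed

lemma fst_g_letter: "fst (g_letter b) = fst b"
  by (simp add: g_letter_def)

text \<open>The idempotent 1 - g f: because f g = 1 it projects onto the kernel of f along the image
  of g.\<close>

definition \<pi> :: "('k, 'v) endo" where
  "\<pi> x = sym_proj V x - g (f x)"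

lemma lin_pi: "flin \<pi>"
  unfolding \<pi>_def by (intro flin_intros(2) sym_proj_props(1) flin_comp[OF hf(1) hg(1)])

lemmas pi_simps = lin_simps[OF lin_pi]

lemma pi_sym_proj: "\<pi> (sym_proj V x) = \<pi> x"
  by (simp add: \<pi>_def hf(2))

lemma f_pi: "f (\<pi> x) = 0"
  by (simp add: \<pi>_def lin_simps[OF hf(1)] fg hf(2,3))

lemma pi_g: "\<pi> (g x) = 0"
  by (simp add: \<pi>_def hg(2,3) fg)

lemma pi_ker_f: "f x = 0 \<Longrightarrow> \<pi> x = sym_proj V x"
  by (simp add: \<pi>_def lin_simps[OF hg(1)])

lemma Q_pi: "Q (\<pi> x) = \<pi> (Q x)"
  by (simp add: \<pi>_def lin_simps[OF V.hQ(1)] V.hQ(2,3) f_Q g_R)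

lemma pi_letters: "x \<in> letters V m \<Longrightarrow> \<pi> x \<in> letters V m"
  unfolding \<pi>_def
  by (intro fs.subspace_diff[OF subspace_letters[OF V.V]] g_letters f_letters) (simp_all add: letters_sym_proj)

text \<open>On letters, the commutator of \<open>Q\<close> with the coderivation \<open>h\<close> is the projection onto the kernel of \<open>f\<close>
  along the image of \<open>g\<close>.\<close>

lemma contraction:
  "\<exists>h\<in>Coder V (- 1). h (sgl []) = 0 \<and> (\<forall>m. \<forall>x\<in>letters V m. Q (h x) + h (Q x) = \<pi> x)"
proof -
  obtain \<sigma> where s: "\<sigma> \<in> sym_hom V V (- 1)" "\<And>m x. x \<in> letters V m \<Longrightarrow> \<sigma> x \<in> letters V (m - 1)"
    "\<And>m z. z \<in> letters V (m - 1) \<Longrightarrow> Q (\<sigma> (Q z)) = Q z"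
    using V.Q_section by blast
  note hs = sym_homD[OF s(1)]
  \<comment> \<open>Composing with \<pi> keeps the section inside the kernel of f, where acyclicity
    is available.\<close>
  define \<tau> where "\<tau> x = \<pi> (\<sigma> x)" for x
  \<comment> \<open>A section inverts Q only on boundaries. So b = \<pi> x is first replaced by b -
    \<tau> (Q b), a cycle in the kernel of f and hence a boundary; the missing \<tau> (Q b) is
    supplied by h (Q x).\<close>
  define \<psi> where "\<psi> x = \<tau> (\<pi> x - \<tau> (Q (\<pi> x)))" for x
  have lint: "flin \<tau>" unfolding \<tau>_def by (rule flin_comp[OF hs(1) lin_pi])
  have tau_letters: "\<tau> x \<in> letters V (m - 1)" if "x \<in> letters V m" for x m
    unfolding \<tau>_def by (rule pi_letters[OF s(2)[OF that]])
  have lin: "flin \<psi>"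
    unfolding \<psi>_def
    by (rule flin_comp[OF flin_intros(2)[OF lin_pi flin_comp[OF flin_comp[OF lin_pi V.hQ(1)] lint]] lint])
  have P: "\<psi> (sym_proj V x) = \<psi> x" for x by (simp add: \<psi>_def pi_sym_proj)
  have b_letters: "\<pi> x - \<tau> (Q (\<pi> x)) \<in> letters V m" if "x \<in> letters V m" for x m
    using tau_letters[OF V.Q_letters[OF pi_letters[OF that]]]
    by (intro fs.subspace_diff[OF subspace_letters[OF V.V]] pi_letters that) simp_all
  have psi_letters: "\<psi> x \<in> letters V (m - 1)" if "x \<in> letters V m" for x m
    unfolding \<psi>_def by (rule tau_letters[OF b_letters[OF that]])
  have psi_word: "\<psi> (sgl w) \<in> letters V (wdeg w + - 1)" if w: "valid_word V w" "length w = 1" for w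
  proof -
    obtain a where "w = [a]" using w(2) by (cases w) auto
    then have "sym_proj V (sgl w) \<in> letters V (wdeg w)" using w(1) by (cases a) (auto simp: letters_def)
    from psi_letters[OF this] show ?thesis by (simp add: P)
  qed
  obtain h where h: "h \<in> Coder V (- 1)" "\<And>w. length w < 1 \<Longrightarrow> h (sgl w) = 0" "\<And>w. length w = 1 \<Longrightarrow> h (sgl w) = \<psi> (sgl w)"
    using Coder_extension[OF lin P psi_word V.V] by blast
  note hh = sym_homD[OF Coder_hom[OF h(1)]]
  have h_psi: "h x = \<psi> x" if "x \<in> letters V m" for x m
  proof -
    obtain v where x: "x = sym_proj V (sgl [(m, v)])" using \<open>x \<in> letters V m\<close> unfolding letters_def by blast
    show ?thesis using h(3)[of "[(m, v)]"] by (simp add: x hh(2) P)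
  qed
  have "Q (h x) + h (Q x) = \<pi> x" if x: "x \<in> letters V m" for x m
  proof -
    define b where "b = \<pi> x"
    define c where "c = b - \<tau> (Q b)"
    have b: "b \<in> letters V m" unfolding b_def by (rule pi_letters[OF x])
    have c: "c \<in> letters V m" unfolding c_def b_def by (rule b_letters[OF x])
    have pib: "\<pi> b = b" unfolding b_def using pi_ker_f[OF f_pi] letters_sym_proj[OF pi_letters[OF x]] by simp
    have "Q (\<tau> (Q b)) = \<pi> (Q (\<sigma> (Q b)))" by (simp add: \<tau>_def Q_pi)
    also have "Q (\<sigma> (Q b)) = Q b" using s(3)[of b "m + 1"] b by simp
    also have "\<pi> (Q b) = Q b" by (simp add: pib flip: Q_pi)
    finally have "Q c = 0" by (simp add: c_def lin_simps[OF V.hQ(1)])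
    moreover have fc: "f c = 0" by (simp add: c_def b_def lin_simps[OF hf(1)] f_pi \<tau>_def)
    ultimately obtain z where z: "z \<in> letters V (m - 1)" "Q z = c" using acyclic[OF c] by blast
    have "Q (\<tau> c) = \<pi> (Q (\<sigma> (Q z)))" by (simp add: \<tau>_def Q_pi z(2))
    also have "\<dots> = c" using s(3)[OF z(1)] pi_ker_f[OF fc] letters_sym_proj[OF c] by (simp add: z(2))
    finally have 1: "Q (h x) = c" by (simp add: h_psi[OF x] \<psi>_def c_def b_def)
    have "\<pi> (Q x) = Q b" by (simp add: b_def Q_pi)
    then have "h (Q x) = \<tau> (Q b)"
      by (simp add: h_psi[OF V.Q_letters[OF x]] \<psi>_def V.Q_Q lin_simps[OF lint])
    with 1 show ?thesis by (simp add: c_def b_def)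
  qed
  then show ?thesis using h(1,2) by (intro bexI[of _ h]) auto
qed

text \<open>Exactness is shown for the cochain \<beta> obtained from \<alpha> by the factors E - i:
  all its values are boundaries, which makes \<sigma> \<beta> a primitive. The hypothesis on f
  \<alpha> g enters on words with letters in the image of g.\<close>

lemma closed_exact:
  assumes a: "V.coch k n \<alpha>" "V.closed k n \<alpha>"
    and 0: "\<And>w. length w = k \<Longrightarrow> f (\<alpha> (g (sgl w))) = 0"
  shows "V.exact k n \<alpha>"
proof -
  note ha = V.coch_hom[OF a(1)]
  obtain \<sigma> where s: "\<sigma> \<in> sym_hom V V (- 1)" "\<And>m x. x \<in> letters V m \<Longrightarrow> \<sigma> x \<in> letters V (m - 1)"
    "\<And>m z. z \<in> letters V (m - 1) \<Longrightarrow> Q (\<sigma> (Q z)) = Q z"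
    using V.Q_section by blast
  note hs = sym_homD[OF s(1)]
  obtain h where h: "h \<in> Coder V (- 1)" "h (sgl []) = 0" "\<And>m x. x \<in> letters V m \<Longrightarrow> Q (h x) + h (Q x) = \<pi> x"
    using contraction by blast
  define E where "E = CE_diff Q (- 1) h"
  have Ex: "E x = Q (h x) + h (Q x)" for x by (simp add: E_def CE_diff_def fscl_powi sg_def)
  have EC: "E \<in> Coder V 0" using CE_diff_Coder[OF V.Q h(1)] by (simp add: E_def)
  note hE = sym_homD[OF Coder_hom[OF EC]]
  have E_Nil: "E (sgl []) = 0"
    by (simp add: Ex h(2) V.Q_Nil lin_simps[OF V.hQ(1)] lin_simps[OF sym_homD(1)[OF Coder_hom[OF h(1)]]])
  define S where "S = {a. f (sgl [a]) = 0} \<union> range g_letter"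
  \<comment> \<open>The kernel is tested first. A letter of both kinds is fixed and killed by \<pi>,
    hence zero in the coalgebra, so no conflict arises.\<close>
  define c where "c a = (if f (sgl [a]) = 0 then 1 else 0 :: 'k)" for a :: "int \<times> 'v"
  have Ec: "E (sgl [a]) = fscl (c a) (sym_proj V (sgl [a]))" if aS: "a \<in> S" for a
  proof (cases "valid_word V [a]")
    case True
    then have l: "sym_proj V (sgl [a]) \<in> letters V (fst a)" by (cases a) (auto simp: letters_def)
    have E: "E (sgl [a]) = \<pi> (sgl [a])"
      using h(3)[OF l] Ex[of "sym_proj V (sgl [a])"] by (simp add: hE(2) pi_sym_proj)
    show ?thesis
    proof (cases "f (sgl [a]) = 0")
      case False
      then obtain b where "a = g_letter b" using aS by (auto simp: S_def)
      then have "\<pi> (sgl [a]) = 0"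
        using pi_g[of "sgl [b]"] by (simp add: g_letter(1) pi_sym_proj)
      then show ?thesis using False by (simp add: E c_def)
    qed (simp add: E c_def pi_ker_f)
  next
    case False
    then show ?thesis using hE(6)[OF False] sym_proj_invalid[OF False] by simp
  qed
  \<comment> \<open>As many factors as the words have letters, because the eigenvalues on words of
    length k are at most k.\<close>
  obtain \<beta> where b: "V.coch k n \<beta>" "V.closed k n \<beta>"
    "V.exact k n (\<lambda>x. \<beta> x + fscl (- ((-1) ^ k * fact k)) (\<alpha> x))"
    "\<And>w. set w \<subseteq> S \<Longrightarrow> length w = k \<Longrightarrow> \<beta> (sgl w) = fscl (\<Prod>i<k. sum_list (map c w) - of_nat (Suc i)) (\<alpha> (sgl w))"
    using V.homotopy_iterate[where k = k and c = c and S = S, OF a h(1,2) Ex EC E_Nil Ec] by blast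
  note hb = V.coch_hom[OF b(1)]
  \<comment> \<open>That \<beta> w is a boundary is stated through the fixed section \<sigma>. In
    this form it is a linear condition, so checking words with letters in S suffices.\<close>
  have key: "Q (\<sigma> (\<beta> (sgl w))) = \<beta> (sgl w)" if len: "length w = k" for w
  proof -
    have "\<beta> (sgl w) - Q (\<sigma> (\<beta> (sgl w))) = 0"
    proof (rule linear_special_words[where h = "\<lambda>x. \<beta> x - Q (\<sigma> (\<beta> x))" and S = S and p = k, OF V.V _ _ _ _ len])
      show "flin (\<lambda>x. \<beta> x - Q (\<sigma> (\<beta> x)))"
        by (rule flin_intros(2)[OF hb(1) flin_comp[OF flin_comp[OF hb(1) hs(1)] V.hQ(1)]])
      show "\<beta> (sym_proj V x) - Q (\<sigma> (\<beta> (sym_proj V x))) = \<beta> x - Q (\<sigma> (\<beta> x))" for x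
        by (simp add: hb(2))
    next
      fix m x assume x: "x \<in> part V m"
      define l where "l = sym_proj V (sgl [(m, x)])"
      have l: "l \<in> letters V m" using x by (auto simp: l_def letters_def)
      obtain u where u: "u \<in> part W m" "f l = sym_proj W (sgl [(m, u)])"
        using f_letters[OF l] unfolding letters_def by blast
      define y where "y = snd (g_letter (m, u))"
      have gy: "g_letter (m, u) = (m, y)" by (simp add: y_def g_letter_def)
      have y: "y \<in> part V m" using g_letter(2)[of "(m, u)"] by (simp add: gy)
      have "sym_proj V (sgl [(m, y)]) = g (f l)"
        using g_letter(1)[of "(m, u)"] by (simp add: gy u(2) hg(2))
      then have "sym_proj V (sgl [(m, x - y)]) = \<pi> l"
        unfolding letter_simps(3)[OF V.V x y] by (simp add: \<pi>_def l_def)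
      then have "f (sgl [(m, x - y)]) = 0"
        using f_pi[of l] hf(2)[of "sgl [(m, x - y)]"] by simp
      then have "(m, x - y) \<in> S" by (simp add: S_def)
      moreover have "(m, y) \<in> S" unfolding S_def gy[symmetric] by blast
      ultimately show "\<exists>y\<in>part V m. (m, y) \<in> S \<and> (m, x - y) \<in> S" using y by blast
    next
      fix w assume w: "set w \<subseteq> S" "length w = k"
      let ?j = "length (filter (\<lambda>a. f (sgl [a]) = 0) w)"
      have j: "sum_list (map c w) = of_nat ?j"
        by (induction w) (simp_all add: c_def)
      have "Q (\<sigma> (\<beta> (sgl w))) = \<beta> (sgl w)"
      proof (cases "?j = 0")
        case False
        have "?j \<le> k" using w(2) length_filter_le by metis
        moreover obtain j where j': "?j = Suc j" using False by (metis not0_implies_Suc)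
        \<comment> \<open>The factor with \<open>Suc i\<close> equal to the number of kernel letters
          is present, since that number lies between 1 and k.\<close>
        ultimately have "(\<Prod>i<k. of_nat ?j - of_nat (Suc i) :: 'k) = 0"
          unfolding j' by (intro prod_zero bexI[of _ j]) simp_all
        then have "\<beta> (sgl w) = 0" by (simp add: b(4)[OF w] j)
        then show ?thesis by (simp add: lin_simps[OF hs(1)] lin_simps[OF V.hQ(1)])
      next
        case True
        then have "f (sgl [a]) \<noteq> 0" if "a \<in> set w" for a
          using that by (simp add: filter_empty_conv)
        then have "\<forall>a\<in>set w. \<exists>b. a = g_letter b"
          using w(1) unfolding S_def by blast
        then obtain w' where w': "w = map g_letter w'" unfolding ex_map_conv[symmetric] by blast
        have len': "length w' = k" using w(2) by (simp add: w')
        \<comment> \<open>The word w is the leading term of g w', and \<alpha> kills shorter words;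
          hence \<alpha> w = \<alpha> (g w').\<close>
        have "lcomp V (length w') (g (sgl w')) = sym_proj V (sgl w)"
          unfolding w' by (rule coalg_morphism_leading[OF g_mor' V.V fst_g_letter g_letter(1)])
        moreover have le: "lenle V k (g (sgl w'))"
          using coalg_morphism_lenle[OF g_mor', of w'] by (simp add: len')
        moreover have "\<alpha> (g (sgl w')) = \<alpha> (lcomp V k (g (sgl w')))"
          by (rule linear_lenle[where h = \<alpha>, OF ha(1,2) le]) (rule V.cochD(2)[OF a(1)])
        ultimately have aw: "\<alpha> (sgl w) = \<alpha> (g (sgl w'))" by (simp add: len' ha(2))
        \<comment> \<open>R w' consists of shorter words, and \<alpha> g kills these. By closedness
          this makes \<alpha> w a cycle, to which acyclicity of the kernel of f applies.\<close>
        have "\<alpha> (g (R (sgl w'))) = \<alpha> (g (lcomp W k (R (sgl w'))))"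
        proof (rule linear_lenle[where h = "\<lambda>x. \<alpha> (g x)", OF flin_comp[OF hg(1) ha(1)]])
          show "\<alpha> (g (sym_proj W x)) = \<alpha> (g x)" for x by (simp add: hg(2))
          show "lenle W k (R (sgl w'))" by (rule W.Q_lenle[OF lenle_sgl]) (simp add: len')
          fix u :: "'w word" assume "length u < k"
          then show "\<alpha> (g (sgl u)) = 0"
            by (intro linear_lenle_0[where h = \<alpha>, OF ha(1,2) coalg_morphism_lenle[OF g_mor', of u]] V.cochD(2)[OF a(1)]) simp
        qed
        also have "\<dots> = 0"
          using R_leading[of w'] by (simp add: len' lin_simps[OF hg(1)] lin_simps[OF ha(1)])
        finally have "\<alpha> (Q (g (sgl w'))) = 0" by (simp add: g_R)
        then have "Q (\<alpha> (sgl w)) = 0"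
          by (simp add: aw V.closed_lenle[OF a le])
        moreover have "f (\<alpha> (sgl w)) = 0" unfolding aw by (rule 0[OF len'])
        ultimately obtain z where z: "z \<in> letters V (wdeg w + n - 1)" "Q z = \<alpha> (sgl w)"
          using acyclic[OF V.cochD(3)[OF a(1) w(2)]] by blast
        show ?thesis
          using s(3)[OF z(1)] by (simp add: b(4)[OF w] lin_simps[OF hs(1)] lin_simps[OF V.hQ(1)] z(2))
      qed
      then show "\<beta> (sgl w) - Q (\<sigma> (\<beta> (sgl w))) = 0" by simp
    qed
    then show ?thesis by simp
  qed
  have "V.exact k n \<beta>"
    unfolding V.exact_def
  proof (intro exI[of _ "\<lambda>x. \<sigma> (\<beta> x)"] conjI allI impI)
    show "V.coch k (n - 1) (\<lambda>x. \<sigma> (\<beta> x))"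
      unfolding V.coch_def
    proof (intro conjI allI impI)
      show "(\<lambda>x. \<sigma> (\<beta> x)) \<in> sym_hom V V (n - 1)"
      proof (rule sym_homI[OF flin_comp[OF hb(1) hs(1)]])
        show "\<sigma> (\<beta> (sgl w)) \<in> sym_degree V (wdeg w + (n - 1))" for w
          using hs(4)[OF hb(5)[of w]] by (simp add: algebra_simps)
      qed (simp add: hb(2))
      show "\<sigma> (\<beta> (sgl w)) = 0" if "length w < k" for w
        by (simp add: V.cochD(2)[OF b(1) that] lin_simps[OF hs(1)])
      show "\<sigma> (\<beta> (sgl w)) \<in> letters V (wdeg w + (n - 1))" if "length w = k" for w
        using s(2)[OF V.cochD(3)[OF b(1) that]] by (simp add: algebra_simps)
    qed
    fix w :: "'v word" assume w: "length w \<le> k"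
    have Qs: "Q (\<sigma> (\<beta> (sgl w))) = \<beta> (sgl w)"
    proof (cases "length w = k")
      case False
      then show ?thesis using w by (simp add: V.cochD(2)[OF b(1)] lin_simps[OF hs(1)] lin_simps[OF V.hQ(1)])
    qed (rule key)
    \<comment> \<open>Closedness now gives \<beta> (Q w) = 0, so the second summand in the
      differential of \<sigma> \<beta> vanishes.\<close>
    then have "Q (\<beta> (sgl w)) = 0" using V.Q_Q by metis
    then have "\<beta> (Q (sgl w)) = 0" using b(2) w by (simp add: V.closed_def)
    then show "\<beta> (sgl w) = Q (\<sigma> (\<beta> (sgl w))) + sg n (\<sigma> (\<beta> (Q (sgl w))))"
      by (simp add: Qs lin_simps[OF hs(1)])
  qed
  \<comment> \<open>Subtracting two exact cochains leaves a multiple of \<alpha> by (-1)^k k!, which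
    is invertible in characteristic 0.\<close>
  from V.exact_add[OF this b(3), of "- 1"]
  have "V.exact k n (\<lambda>x. fscl ((-1) ^ k * fact k) (\<alpha> x))"
    by (simp add: fs.scale_right_distrib)
  note e = V.exact_add[OF V.exact_zero this, of "inverse ((-1) ^ k * fact k)"]
  have C0: "((-1) ^ k * fact k :: 'k) \<noteq> 0" by simp
  show ?thesis
    using e unfolding fs.scale_scale left_inverse[OF C0] fs.scale_one add_0_left .
qed

text \<open>The primitive from \<open>closed_exact\<close> is a mere cochain. A coderivation with
  the same values up to length k serves equally well, because \<alpha> minus its differential then
  lies in F^(p+1).\<close>

lemma monic_1: "CE.monic 1"
  unfolding CE.monic_def
proof (intro allI ballI impI)
  fix p n \<alpha> assume a: "\<alpha> \<in> V.CE.Z (int 1) p n" and Phi: "\<Phi> \<alpha> \<in> W.CE.B 1 p n"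
  note aC = V.CE.ZD(1)[OF a] and aF = V.CE.ZD(2)[OF a] and daF = V.CE.ZD(3)[OF a]
  note ha = sym_homD[OF Coder_hom[OF aC]]
  show "\<alpha> \<in> V.CE.B 1 p n"
  proof (cases "p < 0")
    case True
    then show ?thesis using aC by (intro V.CE.BI1) (simp add: V.CE.Z_def CE_filt_0)
  next
    case False
    then obtain k where p: "p = int k" by (metis nonneg_int_cases not_less)
    have acoch: "V.coch k n \<alpha>"
      by (rule coder_coch[OF V.Linf_axioms aC]) (use aF in \<open>simp add: p\<close>)
    have "V.closed k n \<alpha>"
      unfolding V.closed_def
    proof (intro allI impI)
      fix w :: "'v word" assume w: "length w \<le> k"
      note hd = Coder_hom[OF CE_diff_Coder[OF V.Q aC]]
      have "CE_diff Q n \<alpha> (sgl w) = 0"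
        using daF w sym_homD(6)[OF hd, of w] unfolding CE_filt_iff[OF hd] p by (cases "valid_word V w") simp_all
      then show "Q (\<alpha> (sgl w)) = sg n (\<alpha> (Q (sgl w)))"
        by (simp add: CE_diff_def fscl_powi)
    qed
    moreover have "f (\<alpha> (g (sgl w))) = 0" if "length w = k" for w
    proof -
      note hP = Coder_hom[OF CE.Phi_C[OF aC]]
      have "\<Phi> \<alpha> (sgl w) = 0"
        using B_W_filt[OF Phi] that sym_homD(6)[OF hP, of w] unfolding CE_filt_iff[OF hP] p
        by (cases "valid_word W w") simp_all
      then show ?thesis by (simp add: \<Phi>_def)
    qed
    ultimately obtain \<beta>' where b': "V.coch k (n - 1) \<beta>'"
      "\<And>w. length w \<le> k \<Longrightarrow> \<alpha> (sgl w) = Q (\<beta>' (sgl w)) + sg n (\<beta>' (Q (sgl w)))"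
      using closed_exact[OF acoch] unfolding V.exact_def by blast
    note hb' = V.coch_hom[OF b'(1)]
    obtain \<beta> where b: "\<beta> \<in> Coder V (n - 1)" "\<And>w. length w < k \<Longrightarrow> \<beta> (sgl w) = 0" "\<And>w. length w = k \<Longrightarrow> \<beta> (sgl w) = \<beta>' (sgl w)"
      using Coder_extension[OF hb'(1,2) V.cochD(3)[OF b'(1)] V.V] by blast
    note hb = sym_homD[OF Coder_hom[OF b(1)]]
    have eq: "\<beta> x = \<beta>' x" if "lenle V k x" for x
    proof (rule linear_eq_lenle[where h = \<beta> and h' = \<beta>', OF hb(1,2) hb'(1,2) that])
      fix w :: "'v word" assume "length w \<le> k"
      then show "\<beta> (sgl w) = \<beta>' (sgl w)"
        using b(2,3)[of w] V.cochD(2)[OF b'(1), of w] by (cases "length w = k") auto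
    qed
    have bF: "\<beta> \<in> CE_filt V p"
      unfolding CE_filt_iff[OF Coder_hom[OF b(1)]] using b(2) by (simp add: p)
    have dbC: "CE_diff Q (n - 1) \<beta> \<in> Coder V n"
      using CE_diff_Coder[OF V.Q b(1)] by simp
    have xC: "\<alpha> - CE_diff Q (n - 1) \<beta> \<in> Coder V n"
      by (rule V.CE.subspace_diff[OF V.CE.subspace_C aC dbC])
    have xF: "\<alpha> - CE_diff Q (n - 1) \<beta> \<in> CE_filt V (p + 1)"
      unfolding CE_filt_iff[OF Coder_hom[OF xC]]
    proof (intro allI impI)
      fix w :: "'v word" assume "int (length w) < p + 1"
      then have w: "length w \<le> k" by (simp add: p)
      have le: "lenle V k (sgl w)" by (rule lenle_sgl[OF w])
      have "CE_diff Q (n - 1) \<beta> (sgl w) = Q (\<beta>' (sgl w)) + sg n (\<beta>' (Q (sgl w)))"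
        by (simp add: CE_diff_def fscl_powi eq[OF le] eq[OF V.Q_lenle[OF le]]) (simp add: sg_def)
      then show "(\<alpha> - CE_diff Q (n - 1) \<beta>) (sgl w) = 0"
        by (simp add: b'(2)[OF w])
    qed
    have "\<alpha> - CE_diff Q (n - 1) \<beta> \<in> V.CE.Z (int 1 - 1) (p + 1) n"
      using xC xF V.CE.d_F[OF xC xF] by (simp add: V.CE.Z_def)
    moreover have "\<beta> \<in> V.CE.Z (int 1 - 1) (p - int 1 + 1) (n - 1)"
      using b(1) bF V.CE.d_F[OF b(1) bF] by (simp add: V.CE.Z_def)
    ultimately have "(\<alpha> - CE_diff Q (n - 1) \<beta>) + CE_diff Q (n - 1) \<beta> \<in> V.CE.B 1 p n"
      by (rule V.CE.BI)
    then show ?thesis by simp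
  qed
qed

end


section \<open>The Euler derivation\<close>

context Linf
begin

definition euler_class :: "('k, 'v) endo \<Rightarrow> bool" where
  "euler_class x \<longleftrightarrow> (\<forall>n. \<forall>h\<in>tangent_coh V Q n. coh_class V Q n (lin_part V V 0 x n h) = scl V (of_int (n + 1)) h)"

text \<open>Lying in F^1 means killing the unit; a differential in F^2 means that x commutes with Q
  on letters up to sign.\<close>

lemma Z1_commute:
  assumes x: "x \<in> CE.Z 1 1 n"
  shows "x (sgl []) = 0" "y \<in> letters V m \<Longrightarrow> Q (x y) = sg n (x (Q y))"
proof -
  note xC = CE.ZD(1)[OF x]
  note hd = Coder_hom[OF CE_diff_Coder[OF Q xC]]
  show "x (sgl []) = 0"
    using CE.ZD(2)[OF x] unfolding CE_filt_iff[OF Coder_hom[OF xC]] by simp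
  assume "y \<in> letters V m"
  then obtain v where v: "v \<in> part V m" "y = sym_proj V (sgl [(m, v)])" unfolding letters_def by blast
  have "CE_diff Q n x (sgl [(m, v)]) = 0"
    using CE.ZD(3)[OF x] v(1) unfolding CE_filt_iff[OF hd] by simp
  then show "Q (x y) = sg n (x (Q y))"
    by (simp add: v(2) CE_diff_def fscl_powi hQ(2) sym_homD(2)[OF Coder_hom[OF xC]])
qed

text \<open>Removes the chosen representatives from the Euler condition, so that it can be checked
  on arbitrary cycles and transported along f and g.\<close>

lemma euler_class_iff:
  assumes x: "x \<in> CE.Z 1 1 0"
  shows "euler_class x \<longleftrightarrow> (\<forall>n. \<forall>y\<in>letters V n. Q y = 0 \<longrightarrow>
    (\<exists>z\<in>letters V (n - 1). Q z = x y - fscl (of_int (n + 1)) y))" (is "_ \<longleftrightarrow> ?R")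
proof -
  note xC = CE.ZD(1)[OF x] and x0 = Z1_commute(1)[OF x] and xQ = Z1_commute(2)[OF x, simplified sg_simps]
  note hx = sym_homD[OF Coder_hom[OF xC]]
  have xl: "x y \<in> letters V n" if "y \<in> letters V n" for y n
    using F1_letters[OF xC x0 that] by simp
  have iff: "coh_class V Q n (lin_part V V 0 x n h) = scl V (of_int (n + 1)) h \<longleftrightarrow>
      (\<exists>z\<in>letters V (n - 1). Q z = x (sym_proj V (sgl [(n, h)])) - fscl (of_int (n + 1)) (sym_proj V (sgl [(n, h)])))"
    if h: "h \<in> tangent_coh V Q n" for n h
  proof -
    note hp = tangent_cohD(1)[OF h]
    have "x (smono V [(n, h)]) \<in> letters V (n + 0)"
      using xl[of "smono V [(n, h)]" n] hp by (auto simp: smono_def letters_def)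
    from lin_part_letter[where f = x and d = 0, OF V this]
    have l: "lin_part V V 0 x n h \<in> part V n" "x (sym_proj V (sgl [(n, h)])) = sym_proj V (sgl [(n, lin_part V V 0 x n h)])"
      by simp_all
    note sp = part_simps(4)[OF V hp]
    have e: "coh_class V Q n (scl V (of_int (n + 1)) h) = scl V (of_int (n + 1)) h"
      by (simp only: coh_class_facts(2) tangent_cohD(3)[OF h])
    have "coh_class V Q n (lin_part V V 0 x n h) = coh_class V Q n (scl V (of_int (n + 1)) h) \<longleftrightarrow>
        lin_part V V 0 x n h - scl V (of_int (n + 1)) h \<in> coboundaries V Q n"
      by (rule coh_class_facts(3))
    then have "coh_class V Q n (lin_part V V 0 x n h) = scl V (of_int (n + 1)) h \<longleftrightarrow>
        lin_part V V 0 x n h - scl V (of_int (n + 1)) h \<in> coboundaries V Q n"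
      unfolding e .
    then show ?thesis
      unfolding coboundaries_iff[OF part_simps(3)[OF V l(1) sp]] letter_simps(3)[OF V l(1) sp] letter_simps(4)[OF V hp] l(2) .
  qed
  show ?thesis
  proof
    assume e: "euler_class x"
    show ?R
    proof (intro allI ballI impI)
      fix n y assume y: "y \<in> letters V n" "Q y = 0"
      obtain v where v: "v \<in> part V n" "y = sym_proj V (sgl [(n, v)])" using y(1) unfolding letters_def by blast
      let ?h = "coh_class V Q n v" and ?c = "of_int (n + 1) :: 'k"
      have h: "?h \<in> tangent_coh V Q n"
        by (rule coh_class_in_tangent_coh[OF v(1)]) (use y v in simp)
      note hp = tangent_cohD(1)[OF h]
      have hv: "?h - v \<in> coboundaries V Q n" by (rule coh_class_facts(4))
      obtain z1 where z1: "z1 \<in> letters V (n - 1)" "Q z1 = sym_proj V (sgl [(n, ?h - v)])"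
        using hv unfolding coboundaries_iff[OF coboundaries_part[OF hv]] by blast
      obtain z2 where z2: "z2 \<in> letters V (n - 1)"
        "Q z2 = x (sym_proj V (sgl [(n, ?h)])) - fscl ?c (sym_proj V (sgl [(n, ?h)]))"
        using e iff[OF h] h unfolding euler_class_def by blast
      have ph: "sym_proj V (sgl [(n, ?h)]) = y + Q z1"
        by (simp add: z1(2) letter_simps(3)[OF V hp v(1)] v(2))
      \<comment> \<open>Replacing the representative by y = h - Q z1 changes the primitive by x z1
        and c z1, as x commutes with Q on letters.\<close>
      have "Q (z2 - x z1 + fscl ?c z1) = x y - fscl ?c y"
        by (simp add: lin_simps[OF hQ(1)] z2(2) ph lin_simps[OF hx(1)] xQ[OF z1(1)] fs.scale_right_distrib del: of_int_add)
      moreover have "z2 - x z1 + fscl ?c z1 \<in> letters V (n - 1)"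
        by (intro fs.subspace_add[OF subspace_letters[OF V]] fs.subspace_diff[OF subspace_letters[OF V]]
            fs.subspace_scale[OF subspace_letters[OF V]] xl z1(1) z2(1))
      ultimately show "\<exists>z\<in>letters V (n - 1). Q z = x y - fscl ?c y" by blast
    qed
  next
    assume ?R
    then show "euler_class x"
      unfolding euler_class_def using iff tangent_cohD(1,2) by (auto simp: letters_def)
  qed
qed

lemma euler_derivation_eqI:
  assumes "\<xi> \<in> CE.E 1 1 0" "euler_class \<xi>" "\<And>\<eta>. \<eta> \<in> CE.E 1 1 0 \<Longrightarrow> euler_class \<eta> \<Longrightarrow> \<eta> = \<xi>"
  shows "euler_derivation V Q = \<xi>"
proof -
  have "(1::int) + - 1 = 0" by simp
  then show ?thesis
    unfolding euler_derivation_def euler_class_def[symmetric] CE_translate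
    by (simp only:) (rule the_equality; use assms in blast)
qed

end

section \<open>Existence, uniqueness and preservation of the Euler derivation\<close>

context minimal_model
begin

text \<open>Membership in F^2 concerns the unit and single letters only, and elements of Z_1 in F^1
  already kill the unit.\<close>

lemma W_letters_eq_B:
  assumes x: "x \<in> W.CE.Z 1 1 0" and 0: "\<And>n y. y \<in> letters W n \<Longrightarrow> x y = 0"
  shows "x \<in> W.CE.B 1 1 0"
proof (rule in_B_W[OF W.CE.ZD(1)[OF x]])
  note hx = Coder_hom[OF W.CE.ZD(1)[OF x]]
  show "x \<in> CE_filt W (1 + 1)"
    unfolding CE_filt_iff[OF hx]
  proof (intro allI impI)
    fix w assume w: "valid_word W w" "int (length w) < 1 + 1"
    then consider "w = []" | a where "w = [a]" by (cases w) auto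
    then show "x (sgl w) = 0"
    proof cases
      case 1
      then show ?thesis by (simp add: W.Z1_commute(1)[OF x])
    next
      case (2 a)
      then have "sym_proj W (sgl w) \<in> letters W (fst a)" using w(1) by (cases a) (auto simp: letters_def)
      from 0[OF this] show ?thesis by (simp add: sym_homD(2)[OF hx])
    qed
  qed
qed

lemma B_W_letters:
  assumes "b \<in> W.CE.B 1 1 0" "y \<in> letters W n"
  shows "b y = 0"
proof -
  have hb: "b \<in> sym_hom W W 0"
    using W.CE.B_subset_Z assms(1) by (intro Coder_hom W.CE.ZD(1)) blast
  obtain v where v: "v \<in> part W n" "y = sym_proj W (sgl [(n, v)])" using assms(2) unfolding letters_def by blast
  have "b (sgl [(n, v)]) = 0"
    using B_W_filt[OF assms(1)] v(1) unfolding CE_filt_iff[OF hb] by simp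
  then show ?thesis by (simp add: v(2) sym_homD(2)[OF hb])
qed

lemma W_euler_class_iff:
  assumes "x \<in> W.CE.Z 1 1 0"
  shows "W.euler_class x \<longleftrightarrow> (\<forall>n. \<forall>y\<in>letters W n. x y = fscl (of_int (n + 1)) y)"
proof -
  have "(\<exists>z\<in>letters W (n - 1). R z = x y - fscl (of_int (n + 1)) y) \<longleftrightarrow> x y = fscl (of_int (n + 1)) y" for n y
  proof
    assume "\<exists>z\<in>letters W (n - 1). R z = x y - fscl (of_int (n + 1)) y"
    then show "x y = fscl (of_int (n + 1)) y" using R_letters by (metis eq_iff_diff_eq_0)
  next
    assume "x y = fscl (of_int (n + 1)) y"
    moreover have "0 \<in> letters W (n - 1)" by (rule fs.subspace_0[OF subspace_letters[OF W.V]])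
    ultimately show "\<exists>z\<in>letters W (n - 1). R z = x y - fscl (of_int (n + 1)) y"
      using R_letters by (intro bexI[of _ 0]) auto
  qed
  then show ?thesis
    unfolding W.euler_class_iff[OF assms] using R_letters by blast
qed

lemma W_euler_unique:
  assumes "\<xi> \<in> W.CE.E 1 1 0" "W.euler_class \<xi>" "\<eta> \<in> W.CE.E 1 1 0" "W.euler_class \<eta>"
  shows "\<xi> = \<eta>"
proof -
  have z: "\<xi> \<in> W.CE.Z 1 1 0" "\<eta> \<in> W.CE.Z 1 1 0"
    using W.CE.E_subset_Z[OF assms(1)] W.CE.E_subset_Z[OF assms(3)] by simp_all
  have "\<xi> - \<eta> \<in> W.CE.B 1 1 0"
  proof (rule W_letters_eq_B)
    show "\<xi> - \<eta> \<in> W.CE.Z 1 1 0" by (rule W.CE.subspace_diff[OF W.CE.subspace_Z z])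
    fix n y assume "y \<in> letters W n"
    then show "(\<xi> - \<eta>) y = 0"
      using assms(2,4) unfolding W_euler_class_iff[OF z(1)] W_euler_class_iff[OF z(2)] by simp
  qed
  then show ?thesis
    using W.CE.cls_E[OF assms(1)] W.CE.cls_E[OF assms(3)] by (simp flip: W.CE.cls_facts(3))
qed

lemma Phi_euler_class:
  assumes x: "x \<in> V.CE.Z 1 1 0" "V.euler_class x" and y: "y \<in> letters W n"
  shows "f (x (g y)) = fscl (of_int (n + 1)) y"
proof -
  have "Q (g y) = 0" by (simp add: R_letters[OF y] lin_simps[OF hg(1)] flip: g_R)
  then obtain z where z: "z \<in> letters V (n - 1)" "Q z = x (g y) - fscl (of_int (n + 1)) (g y)"
    using x(2) g_letters[OF y] unfolding V.euler_class_iff[OF x(1)] by blast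
  have "f (x (g y)) = f (Q z) + fscl (of_int (n + 1)) (f (g y))"
    by (simp add: z(2) lin_simps[OF hf(1)])
  also have "f (Q z) = 0" unfolding f_Q by (rule R_letters[OF f_letters[OF z(1)]])
  finally show ?thesis by (simp add: fg letters_sym_proj[OF y])
qed

text \<open>Conjugated by f and g, both classes act on letters of W by the same scalars; their
  difference dies on E_1 of W and, by injectivity, on E_1 of V.\<close>

lemma V_euler_unique:
  assumes "\<xi> \<in> V.CE.E 1 1 0" "V.euler_class \<xi>" "\<eta> \<in> V.CE.E 1 1 0" "V.euler_class \<eta>"
  shows "\<xi> = \<eta>"
proof -
  have z: "\<xi> \<in> V.CE.Z 1 1 0" "\<eta> \<in> V.CE.Z 1 1 0"
    using V.CE.E_subset_Z[OF assms(1)] V.CE.E_subset_Z[OF assms(3)] by simp_all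
  have d: "\<xi> - \<eta> \<in> V.CE.Z 1 1 0" by (rule V.CE.subspace_diff[OF V.CE.subspace_Z z])
  have "\<Phi> (\<xi> - \<eta>) \<in> W.CE.B 1 1 0"
  proof (rule W_letters_eq_B[OF CE.Phi_Z[OF d]])
    fix n y assume "y \<in> letters W n"
    then show "\<Phi> (\<xi> - \<eta>) y = 0"
      using Phi_euler_class[OF z(1) assms(2)] Phi_euler_class[OF z(2) assms(4)]
      by (simp add: \<Phi>_def lin_simps[OF hf(1)])
  qed
  then have "\<xi> - \<eta> \<in> V.CE.B 1 1 0"
    using monic_1 d unfolding CE.monic_def by simp
  then show ?thesis
    using V.CE.cls_E[OF assms(1)] V.CE.cls_E[OF assms(3)] by (simp flip: V.CE.cls_facts(3))
qed

lemma W_euler_coderivation: "\<exists>\<epsilon>\<in>W.CE.Z 1 1 0. \<forall>n. \<forall>y\<in>letters W n. \<epsilon> y = fscl (of_int (n + 1)) y"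
proof -
  define \<psi> where "\<psi> = linext fscl (\<lambda>w. fscl (of_int (wdeg w + 1)) (sym_proj W (sgl w)))"
  have lin: "flin \<psi>" by (simp add: \<psi>_def)
  have "sym_fun W fscl (\<lambda>w. fscl (of_int (wdeg w + 1)) (sym_proj W (sgl w)))"
    by (rule W.sym_fun_wdeg[where L = "\<lambda>n. fscl (of_int (n + 1))", OF sym_fun_sym_proj flin_scale])
  then have "sym_fun W fscl (\<lambda>w. \<psi> (sgl w))" by (simp add: \<psi>_def)
  then have P: "\<psi> (sym_proj W x) = \<psi> x" for x by (rule linear_sym_proj[OF lin])
  have let': "\<psi> (sgl w) \<in> letters W (wdeg w + 0)" if w: "valid_word W w" "length w = 1" for w
  proof -
    obtain a where "w = [a]" using w(2) by (cases w) auto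
    then have "sym_proj W (sgl w) \<in> letters W (wdeg w)" using w(1) by (cases a) (auto simp: letters_def)
    then show ?thesis
      using fs.subspace_scale[OF subspace_letters[OF W.V, of "wdeg w"]] by (simp add: \<psi>_def)
  qed
  obtain \<epsilon> where e: "\<epsilon> \<in> Coder W 0" "\<And>w. length w < 1 \<Longrightarrow> \<epsilon> (sgl w) = 0" "\<And>w. length w = 1 \<Longrightarrow> \<epsilon> (sgl w) = \<psi> (sgl w)"
    using Coder_extension[OF lin P let' W.V] by blast
  have F: "\<epsilon> \<in> CE_filt W 1"
    unfolding CE_filt_iff[OF Coder_hom[OF e(1)]] using e(2) by simp
  have "\<epsilon> y = fscl (of_int (n + 1)) y" if y: "y \<in> letters W n" for n y
  proof -
    obtain v where "y = sym_proj W (sgl [(n, v)])" using y unfolding letters_def by blast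
    then show ?thesis using e(3)[of "[(n, v)]"] by (simp add: sym_homD(2)[OF Coder_hom[OF e(1)]] \<psi>_def)
  qed
  moreover have "\<epsilon> \<in> W.CE.Z 1 1 0"
    using e(1) F minimal_CE_diff[OF e(1) F] by (simp add: W.CE.Z_def)
  ultimately show ?thesis by blast
qed

text \<open>A preimage of \<epsilon> is controlled only along g. But each cycle y is g (f y) up to a
  boundary, so \<xi> y - (n + 1) y is a cycle in the kernel of f, hence a boundary.\<close>

lemma V_euler_exists: "\<exists>\<xi>\<in>V.CE.E 1 1 0. V.euler_class \<xi>"
proof -
  obtain \<epsilon> where e: "\<epsilon> \<in> W.CE.Z 1 1 0" "\<And>n y. y \<in> letters W n \<Longrightarrow> \<epsilon> y = fscl (of_int (n + 1)) y"
    using W_euler_coderivation by blast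
  obtain \<alpha> where a: "\<alpha> \<in> V.CE.Z 1 1 0" "\<epsilon> - \<Phi> \<alpha> \<in> W.CE.B 1 1 0"
    using epic_1 e(1) unfolding CE.epic_def of_nat_1 by blast
  define \<xi> where "\<xi> = V.CE.cls 1 1 0 \<alpha>"
  have xE: "\<xi> \<in> V.CE.E 1 1 0" using a(1) unfolding \<xi>_def V.CE.E_def by simp
  have xZ: "\<xi> \<in> V.CE.Z 1 1 0" using V.CE.E_subset_Z[OF xE] by simp
  note hx = sym_homD[OF Coder_hom[OF V.CE.ZD(1)[OF xZ]]]
  have fxg: "f (\<xi> (g y)) = fscl (of_int (n + 1)) y" if y: "y \<in> letters W n" for y n
  proof -
    have "(\<epsilon> - \<Phi> \<alpha>) y = 0" by (rule B_W_letters[OF a(2) y])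
    moreover have "\<Phi> (\<xi> - \<alpha>) \<in> W.CE.B 1 1 0"
      unfolding \<xi>_def by (rule CE.Phi_B[OF V.CE.cls_facts(4)])
    then have "\<Phi> (\<xi> - \<alpha>) y = 0" by (rule B_W_letters[OF _ y])
    ultimately show ?thesis using e(2)[OF y] by (simp add: \<Phi>_def lin_simps[OF hf(1)])
  qed
  have "V.euler_class \<xi>"
    unfolding V.euler_class_iff[OF xZ]
  proof (intro allI ballI impI)
    fix n y assume y: "y \<in> letters V n" "Q y = 0"
    let ?c = "of_int (n + 1) :: 'k"
    have "Q (\<pi> y) = 0" using y(2) by (simp add: Q_pi pi_simps)
    then obtain z where z: "z \<in> letters V (n - 1)" "Q z = \<pi> y"
      using acyclic[OF pi_letters[OF y(1)] _ f_pi] by blast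
    note xl = V.F1_letters[OF V.CE.ZD(1)[OF xZ] V.Z1_commute(1)[OF xZ], simplified add_0_right]
    \<comment> \<open>The \<pi>-part of a cycle is a cycle in the kernel of f, hence a boundary Q
      z.\<close>
    have y_eq: "y = Q z + g (f y)"
      by (simp add: z(2) \<pi>_def letters_sym_proj[OF y(1)])
    have "f (\<xi> y) = f (\<xi> (Q z)) + f (\<xi> (g (f y)))"
      by (subst y_eq) (simp only: lin_simps[OF hx(1)] lin_simps[OF hf(1)])
    also have "\<xi> (Q z) = Q (\<xi> z)" using V.Z1_commute(2)[OF xZ z(1)] by simp
    also have "f (Q (\<xi> z)) = 0" unfolding f_Q by (rule R_letters[OF f_letters[OF xl[OF z(1)]]])
    finally have "f (\<xi> y - fscl ?c y) = 0"
      by (simp add: fxg[OF f_letters[OF y(1)]] lin_simps[OF hf(1)] del: of_int_add)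
    moreover have "Q (\<xi> y - fscl ?c y) = 0"
      using V.Z1_commute(2)[OF xZ y(1)] y(2) by (simp add: lin_simps[OF V.hQ(1)] lin_simps[OF hx(1)])
    moreover have "\<xi> y - fscl ?c y \<in> letters V n"
      by (intro fs.subspace_diff[OF subspace_letters[OF V.V]] fs.subspace_scale[OF subspace_letters[OF V.V]] xl y(1))
    ultimately show "\<exists>z\<in>letters V (n - 1). Q z = \<xi> y - fscl ?c y"
      using acyclic by blast
  qed
  then show ?thesis using xE by blast
qed

lemma phi_euler_derivation: "CE.\<phi> 1 1 0 (euler_derivation V Q) = euler_derivation W R"
proof -
  obtain \<xi> where x: "\<xi> \<in> V.CE.E 1 1 0" "V.euler_class \<xi>" using V_euler_exists by blast
  have xZ: "\<xi> \<in> V.CE.Z 1 1 0" using V.CE.E_subset_Z[OF x(1)] by simp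
  have eV: "euler_derivation V Q = \<xi>"
    by (rule V.euler_derivation_eqI[OF x V_euler_unique[OF _ _ x]])
  let ?\<eta> = "CE.\<phi> 1 1 0 \<xi>"
  have h: "?\<eta> \<in> W.CE.E 1 1 0"
    using CE.phi_linear_between[of 1 1 0] x(1) unfolding linear_between_def by blast
  then have hZ: "?\<eta> \<in> W.CE.Z 1 1 0" using W.CE.E_subset_Z[OF h] by simp
  have "W.euler_class ?\<eta>"
    unfolding W_euler_class_iff[OF hZ]
  proof (intro allI ballI)
    fix n y assume y: "y \<in> letters W n"
    have "(?\<eta> - \<Phi> \<xi>) y = 0"
      unfolding CE.\<phi>_def by (rule B_W_letters[OF W.CE.cls_facts(4) y])
    then show "?\<eta> y = fscl (of_int (n + 1)) y"
      using Phi_euler_class[OF xZ x(2) y] by (simp add: \<Phi>_def)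
  qed
  then have "euler_derivation W R = ?\<eta>"
    by (intro W.euler_derivation_eqI[OF h _ W_euler_unique[OF _ _ h]])
  then show ?thesis by (simp add: eV)
qed

end

theorem theorem5p7:
  fixes V :: "('k::field_char_0, 'v::ab_group_add) graded_space"
    and Q :: "('k, 'v) endo"
    and W :: "('k, 'w::ab_group_add) graded_space"
    and R :: "('k, 'w) endo"
  assumes "Linf_algebra V Q"
    and "is_minimal_model W R V Q"
  shows "\<exists>\<phi>. CE_morphism V Q W R \<phi> \<and>
           (\<forall>r\<ge>1. \<forall>p q. bij_betw (\<phi> r p q) (CE_E V Q r p q) (CE_E W R r p q)) \<and>
           \<phi> 1 1 (-1) (euler_derivation V Q) = euler_derivation W R"
proof -
  obtain f g where fg: "weak_equivalence V Q W R f" "weak_equivalence W R V Q g" "\<forall>x\<in>sym_coalg W. f (g x) = x"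
    using assms(2) unfolding is_minimal_model_def by blast
  interpret minimal_model V Q W R f g
    by unfold_locales
      (use assms fg in \<open>auto simp: is_minimal_model_def minimal_Linf_def weak_equivalence_def\<close>)
  \<comment> \<open>The page maps of the locale take the total degree p + q as their last
    index.\<close>
  let ?\<phi> = "\<lambda>r p q. CE.\<phi> r p (p + q)"
  note t = V.CE_translate W.CE_translate
  have "CE_morphism V Q W R ?\<phi>"
    unfolding CE_morphism_def CE_next_def t
  proof (intro conjI allI ballI)
    fix r p q \<xi>
    show "linear_between escl (V.CE.E r p (p + q)) escl (W.CE.E r p (p + q)) (CE.\<phi> r p (p + q))"
      by (rule CE.phi_linear_between)
    show "CE.\<phi> r (p + int r) (p + int r + (q - int r + 1)) (V.CE.D r p (p + q) \<xi>) =
        W.CE.D r p (p + q) (CE.\<phi> r p (p + q) \<xi>)" if "\<xi> \<in> V.CE.E r p (p + q)"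
      using CE.phi_D[OF that] by (simp add: algebra_simps)
    show "W.CE.page r p (p + q) (W.CE.cls r p (p + q) (CE.\<phi> (Suc r) p (p + q) \<xi>)) =
        W.CE.page r p (p + q) (CE.\<phi> r p (p + q) (V.CE.page r p (p + q) (V.CE.cls r p (p + q) \<xi>)))"
      if "\<xi> \<in> V.CE.E (Suc r) p (p + q)"
      by (rule CE.phi_next[OF that])
  qed
  moreover have "\<forall>r\<ge>1. \<forall>p q. bij_betw (?\<phi> r p q) (CE_E V Q r p q) (CE_E W R r p q)"
    unfolding t using CE.phi_bij[OF epic_1 monic_1] by blast
  moreover have "?\<phi> 1 1 (-1) (euler_derivation V Q) = euler_derivation W R"
    using phi_euler_derivation by simp
  ultimately show ?thesis by (intro exI[of _ ?\<phi>] conjI)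
qed

end
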